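(* Let $\Phi=\{\phi_\ell(x)=Ax+a_\ell\}_{\ell=1}^m$ be an affinely irreducible homogeneous affine IFS on $\mathbb{R}^d$. Suppose there exists a strictly positive probability vector $\boldsymbol{p}=(p_\ell)_{\ell=1}^m$ such that the self-affine measure $\mu$ associated with $\Phi$ and $\boldsymbol{p}$ is non-Rajchman. Then $\Phi$ is a generalized Pisot IFS. Moreover, at least one of the following two cases occurs: (i) $\Phi$ is a generalized Pisot IFS of type I; (ii) $\Phi$ has an integral factor $\Psi$ such that the self-affine measure associated with $\Psi$ and $\boldsymbol{p}$ is non-Rajchman.
   Context: A homogeneous affine IFS on $\mathbb{R}^d$ ($d\ge 1$) is a finite family $\Phi=\{\phi_\ell(x)=Ax+a_\ell\}_{\ell=1}^m$ with $A\in GL_d(\mathbb{R})$ of spectral radius less than $1$ and $a_\ell\in\mathbb{R}^d$. It is affinely irreducible if there is no proper affine subspace $V$ of $\mathbb{R}^d$ with $\phi_\ell(V)=V$ for all $1\le \ell\le m$. For a probability vector $\boldsymbol{p}=(p_\ell)_{\ell=1}^m$, the associated self-affine measure is the unique Borel probability measure $\mu$ with $\mu=\sum_{\ell=1}^m p_\ell\,\mu\circ\phi_\ell^{-1}$. The Fourier transform of a Borel probability measure $\nu$ on $\mathbb{R}^d$ is $\widehat\nu(\xi)=\int e^{2\pi i\langle \xi,x\rangle}\,d\nu(x)$; $\nu$ is Rajchman if $|\widehat\nu(\xi)|\to0$ as $|\xi|\to\infty$, and non-Rajchman otherwise. On $\mathbb{C}^d$, $\langle z,w\rangle=\sum_j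 z_j\overline{w_j}$. Pisot tuple: a finite collection $\{\beta_1,\dots,\beta_k\}$ of distinct algebraic integers (real or complex) such that (i) $|\beta_j|>1$ for all $j$; (ii) there is a monic $P\in\mathbb{Z}[x]$ with $P(\beta_j)=0$ for all $1\le j\le k$ such that every other root $z$ of $P$, if any, satisfies $|z|<1$. It is of type I if, taking $P$ of smallest possible degree, $P$ has at least one root in $\{|z|<1\}$; otherwise it is of type II. Generalized Pisot IFS: a homogeneous affine IFS $\{Ax+a_\ell\}_{\ell=1}^m$ on $\mathbb{R}^d$ for which there exist $k\ge1$, $\beta_1,\dots,\beta_k\in\mathbb{C}$ and $\zeta_1,\dots,\zeta_k\in\mathbb{C}^d\setminus\{0\}$ such that: (i) $\{\beta_1,\dots,\beta_k\}$ is a Pisot tuple; (ii) $A^{\top}\zeta_j=\beta_j^{-1}\zeta_j$ for $1\le j\le k$; (iii) for every $1\le\ell\le m$ there is $P_\ell\in\mathbb{Z}[x]$ with $\langle\zeta_j,a_\ell-a_1\rangle=P_\ell(\beta_j)$ for all $1\le j\le k$. It is a generalized Pisot IFS of type I if such data can be chosen with $\{\beta_1,\dots,\beta_k\}$ a Pisot tuple of type I. Integral affine IFS: a homogeneous affine IFS $\{Ax+a_\ell\}_{\ell=1}^m$ on $\mathbb{R}^d$ such that $A^{-1}$ is an integer matrix and $a_\ell\in\mathbb{Z}^d$ for all $\ell$. Factor: an IFS $\Psi=\{\psi_\ell\}_{\ell=1}^m$ on $\mathbb{R}^q$ ($1\le q\le d$) is a factor of $\Phi=\{Ax+a_\ell\}_{\ell=1}^m$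 on $\mathbb{R}^d$ if there are a nonzero $A^{\top}$-invariant linear subspace $V\subset\mathbb{R}^d$ with $\dim V=q$ and an invertible affine map $T:V\to\mathbb{R}^q$ such that $\psi_\ell=T\circ\phi_{V,\ell}\circ T^{-1}$ for all $\ell$, where $\phi_{V,\ell}:V\to V$, $\phi_{V,\ell}(x)=P_VAx+P_Va_\ell$, and $P_V$ is the orthogonal projection of $\mathbb{R}^d$ onto $V$. It is an integral factor if in addition $\Psi$ is an integral affine IFS. *)

theory Defs
  imports "HOL-Probability.Probability" "HOL-Computational_Algebra.Polynomial"
begin

(* A factor lives on R^q for some q <= d that is existentially quantified, so q cannot be a
   type.  We realise R^q as the space R^J of vectors indexed by a set J of q coordinates, i.e.
   the vectors of R^d (= real^'n) that vanish outside J; every 1 <= q <= d is q = card J for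
   some nonempty J.  All notions about an IFS on a Euclidean space are defined once, on R^J;
   R^d itself is the case J = UNIV (see the lemmas at the end). *)

definition coord_space :: "'n set \<Rightarrow> (real^'n) set" where
  "coord_space J = {x. \<forall>i. i \<notin> J \<longrightarrow> x $ i = 0}"

(* J x J matrices: the entries outside the block J x J are 0. *)
definition matrix_on :: "'n set \<Rightarrow> real^'n^'n \<Rightarrow> bool" where
  "matrix_on J A \<longleftrightarrow> (\<forall>i j. i \<notin> J \<or> j \<notin> J \<longrightarrow> A $ i $ j = 0)"

definition mat1_on :: "'n set \<Rightarrow> real^'n^'n" where
  "mat1_on J = (\<chi> i j. if i = j \<and> i \<in> J then 1 else 0)"

definition inverse_on :: "'n::finite set \<Rightarrow> real^'n^'n \<Rightarrow> real^'n^'n \<Rightarrow> bool" where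
  "inverse_on J A C \<longleftrightarrow>
     matrix_on J A \<and> matrix_on J C \<and> A ** C = mat1_on J \<and> C ** A = mat1_on J"

definition spectrum :: "complex^'n^'n \<Rightarrow> complex set" where
  "spectrum A = {c. \<exists>z. z \<noteq> 0 \<and> A *v z = c *s z}"

(* Padding a J x J block with zeros can only add the eigenvalue 0, so this is also the
   spectral radius of the block. *)
definition spectral_radius :: "real^'n::finite^'n \<Rightarrow> real" where
  "spectral_radius A = (SUP c \<in> spectrum (map_matrix complex_of_real A). cmod c)"

(* The maps of the IFS are phi_l x = A x + a l for l in {1..m}. *)
definition ifs_map :: "real^'n::finite^'n \<Rightarrow> (nat \<Rightarrow> real^'n) \<Rightarrow> nat \<Rightarrow> real^'n \<Rightarrow> real^'n" where
  "ifs_map A a l x = A *v x + a l"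

definition homogeneous_affine_ifs ::
    "'n::finite set \<Rightarrow> nat \<Rightarrow> real^'n^'n \<Rightarrow> (nat \<Rightarrow> real^'n) \<Rightarrow> bool" where
  "homogeneous_affine_ifs J m A a \<longleftrightarrow>
     J \<noteq> {} \<and> 1 \<le> m \<and> (\<exists>C. inverse_on J A C) \<and> spectral_radius A < 1 \<and>
     (\<forall>l\<in>{1..m}. a l \<in> coord_space J)"

definition affinely_irreducible ::
    "nat \<Rightarrow> real^'n::finite^'n \<Rightarrow> (nat \<Rightarrow> real^'n) \<Rightarrow> bool" where
  "affinely_irreducible m A a \<longleftrightarrow>
     \<not> (\<exists>V. affine V \<and> V \<noteq> {} \<and> V \<noteq> UNIV \<and> (\<forall>l\<in>{1..m}. ifs_map A a l ` V = V))"

definition probability_vector :: "nat \<Rightarrow> (nat \<Rightarrow> real) \<Rightarrow> bool" where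
  "probability_vector m p \<longleftrightarrow> (\<forall>l\<in>{1..m}. 0 \<le> p l) \<and> (\<Sum>l=1..m. p l) = 1"

definition self_affine_measure ::
    "'n::finite set \<Rightarrow> nat \<Rightarrow> real^'n^'n \<Rightarrow> (nat \<Rightarrow> real^'n) \<Rightarrow> (nat \<Rightarrow> real) \<Rightarrow>
     (real^'n) measure \<Rightarrow> bool" where
  "self_affine_measure J m A a p \<mu> \<longleftrightarrow>
     prob_space \<mu> \<and> sets \<mu> = sets (restrict_space borel (coord_space J)) \<and>
     (\<forall>X\<in>sets \<mu>. measure \<mu> X =
        (\<Sum>l=1..m. p l * measure \<mu> (ifs_map A a l -` X \<inter> coord_space J)))"

definition fourier :: "(real^'n::finite) measure \<Rightarrow> real^'n \<Rightarrow> complex" where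
  "fourier \<nu> \<xi> = (\<integral>x. exp (2 * of_real pi * \<i> * of_real (\<xi> \<bullet> x)) \<partial>\<nu>)"

(* Decay as |xi| tends to infinity inside R^J. *)
definition rajchman :: "'n::finite set \<Rightarrow> (real^'n) measure \<Rightarrow> bool" where
  "rajchman J \<nu> \<longleftrightarrow> (fourier \<nu> \<longlongrightarrow> 0) (inf at_infinity (principal (coord_space J)))"

definition cvec_of_real :: "real^'n \<Rightarrow> complex^'n" where
  "cvec_of_real x = (\<chi> i. complex_of_real (x $ i))"

(* The library's inner product on complex^'n is real-valued, hence this definition. *)
definition cinner :: "complex^'n::finite \<Rightarrow> complex^'n \<Rightarrow> complex" where
  "cinner z w = (\<Sum>i\<in>UNIV. z $ i * cnj (w $ i))"

definition ipoly_at :: "int poly \<Rightarrow> complex \<Rightarrow> complex" where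
  "ipoly_at P z = poly (map_poly of_int P) z"

definition pisot_poly :: "complex set \<Rightarrow> int poly \<Rightarrow> bool" where
  "pisot_poly S P \<longleftrightarrow>
     lead_coeff P = 1 \<and> (\<forall>\<beta>\<in>S. ipoly_at P \<beta> = 0) \<and>
     (\<forall>z. ipoly_at P z = 0 \<and> z \<notin> S \<longrightarrow> cmod z < 1)"

definition pisot_tuple :: "complex set \<Rightarrow> bool" where
  "pisot_tuple S \<longleftrightarrow>
     finite S \<and> S \<noteq> {} \<and> (\<forall>\<beta>\<in>S. algebraic_int \<beta> \<and> 1 < cmod \<beta>) \<and> (\<exists>P. pisot_poly S P)"

definition pisot_tuple_type_I :: "complex set \<Rightarrow> bool" where
  "pisot_tuple_type_I S \<longleftrightarrow>
     pisot_tuple S \<and>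
     (\<exists>P. pisot_poly S P \<and> (\<forall>Q. pisot_poly S Q \<longrightarrow> degree P \<le> degree Q) \<and>
          (\<exists>z. ipoly_at P z = 0 \<and> cmod z < 1))"

definition generalized_pisot_data ::
    "nat \<Rightarrow> real^'n::finite^'n \<Rightarrow> (nat \<Rightarrow> real^'n) \<Rightarrow>
     nat \<Rightarrow> (nat \<Rightarrow> complex) \<Rightarrow> (nat \<Rightarrow> complex^'n) \<Rightarrow> bool" where
  "generalized_pisot_data m A a k \<beta> \<zeta> \<longleftrightarrow>
     1 \<le> k \<and> inj_on \<beta> {1..k} \<and> pisot_tuple (\<beta> ` {1..k}) \<and>
     (\<forall>j\<in>{1..k}. \<zeta> j \<noteq> 0 \<and>
        transpose (map_matrix complex_of_real A) *v \<zeta> j = inverse (\<beta> j) *s \<zeta> j) \<and>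
     (\<forall>l\<in>{1..m}. \<exists>P. \<forall>j\<in>{1..k}.
        cinner (\<zeta> j) (cvec_of_real (a l - a 1)) = ipoly_at P (\<beta> j))"

definition generalized_pisot_ifs ::
    "nat \<Rightarrow> real^'n::finite^'n \<Rightarrow> (nat \<Rightarrow> real^'n) \<Rightarrow> bool" where
  "generalized_pisot_ifs m A a \<longleftrightarrow>
     homogeneous_affine_ifs UNIV m A a \<and> (\<exists>k \<beta> \<zeta>. generalized_pisot_data m A a k \<beta> \<zeta>)"

definition generalized_pisot_ifs_type_I ::
    "nat \<Rightarrow> real^'n::finite^'n \<Rightarrow> (nat \<Rightarrow> real^'n) \<Rightarrow> bool" where
  "generalized_pisot_ifs_type_I m A a \<longleftrightarrow>
     homogeneous_affine_ifs UNIV m A a \<and>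
     (\<exists>k \<beta> \<zeta>. generalized_pisot_data m A a k \<beta> \<zeta> \<and> pisot_tuple_type_I (\<beta> ` {1..k}))"

definition integral_affine_ifs ::
    "'n::finite set \<Rightarrow> nat \<Rightarrow> real^'n^'n \<Rightarrow> (nat \<Rightarrow> real^'n) \<Rightarrow> bool" where
  "integral_affine_ifs J m B b \<longleftrightarrow>
     homogeneous_affine_ifs J m B b \<and>
     (\<exists>C. inverse_on J B C \<and> (\<forall>i j. C $ i $ j \<in> \<int>)) \<and>
     (\<forall>l\<in>{1..m}. \<forall>i. b l $ i \<in> \<int>)"

definition orth_proj :: "(real^'n::finite) set \<Rightarrow> real^'n \<Rightarrow> real^'n" where
  "orth_proj V x = (THE y. y \<in> V \<and> (\<forall>v\<in>V. orthogonal (x - y) v))"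

definition invertible_affine_map ::
    "(real^'n::finite) set \<Rightarrow> (real^'n) set \<Rightarrow> (real^'n \<Rightarrow> real^'n) \<Rightarrow> bool" where
  "invertible_affine_map V W T \<longleftrightarrow>
     bij_betw T V W \<and> (\<exists>L c. linear L \<and> (\<forall>x\<in>V. T x = L x + c))"

(* (B, b) on R^J is a factor of (A, a) on R^d, both with m maps. *)
definition factor_ifs ::
    "'n::finite set \<Rightarrow> nat \<Rightarrow> real^'n^'n \<Rightarrow> (nat \<Rightarrow> real^'n) \<Rightarrow>
     real^'n^'n \<Rightarrow> (nat \<Rightarrow> real^'n) \<Rightarrow> bool" where
  "factor_ifs J m B b A a \<longleftrightarrow>
     (\<exists>V T. subspace V \<and> V \<noteq> {0} \<and> (\<forall>x\<in>V. transpose A *v x \<in> V) \<and> dim V = card J \<and>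
        invertible_affine_map V (coord_space J) T \<and>
        (\<forall>l\<in>{1..m}. \<forall>y\<in>coord_space J.
           ifs_map B b l y =
             T (orth_proj V (A *v inv_into V T y) + orth_proj V (a l))))"

definition integral_factor ::
    "'n::finite set \<Rightarrow> nat \<Rightarrow> real^'n^'n \<Rightarrow> (nat \<Rightarrow> real^'n) \<Rightarrow>
     real^'n^'n \<Rightarrow> (nat \<Rightarrow> real^'n) \<Rightarrow> bool" where
  "integral_factor J m B b A a \<longleftrightarrow> factor_ifs J m B b A a \<and> integral_affine_ifs J m B b"

lemma coord_space_UNIV: "coord_space UNIV = UNIV"
  by (simp add: coord_space_def)

lemma dim_coord_space: "dim (coord_space J :: (real^'n::finite) set) = card J"
  unfolding coord_space_def using dim_substandard_cart[where ?'a = real and d = J]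
  by (simp add: dim_vec_eq)

lemma inverse_on_UNIV:
  fixes A :: "real^'n::finite^'n"
  shows "(\<exists>C. inverse_on UNIV A C) \<longleftrightarrow> invertible A"
proof -
  have "mat1_on UNIV = (mat 1 :: real^'n^'n)"
    by (simp add: mat1_on_def mat_def)
  then show ?thesis
    by (simp add: inverse_on_def matrix_on_def invertible_def)
qed

lemma homogeneous_affine_ifs_UNIV:
  "homogeneous_affine_ifs UNIV m A a \<longleftrightarrow> 1 \<le> m \<and> invertible A \<and> spectral_radius A < 1"
  by (simp add: homogeneous_affine_ifs_def inverse_on_UNIV coord_space_UNIV)

lemma self_affine_measure_UNIV:
  "self_affine_measure UNIV m A a p \<mu> \<longleftrightarrow>
     prob_space \<mu> \<and> sets \<mu> = sets borel \<and>
     (\<forall>X\<in>sets borel. measure \<mu> X = (\<Sum>l=1..m. p l * measure \<mu> (ifs_map A a l -` X)))"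
  by (auto simp: self_affine_measure_def coord_space_UNIV sets_restrict_space)

lemma rajchman_UNIV: "rajchman UNIV \<nu> \<longleftrightarrow> (fourier \<nu> \<longlongrightarrow> 0) at_infinity"
  by (simp add: rajchman_def coord_space_UNIV)

end

(* Put B = (A^T)^-1 and d_l = a_l - a_1. Since |fourier mu (B x)| <= |fourier mu x|, compactness
   turns a failure of decay into a vector v with |fourier mu (B^j v)| bounded below for all j, and
   telescoping gives that the distances eps of <B^j v, d_l> to the nearest integers K_l(j) are square
   summable in j.

   The sequences K_l then satisfy, up to square summable errors, a real linear recurrence. A pigeonhole
   argument (replacing the Hankel determinants in Pisot's theorem), Kronecker's rationality criterion
   and Fatou's lemma give a monic integer polynomial q, of least degree, such that q(shift) annihilates
   all K_l. Affine irreducibility says that <B^j v, d_l> -> 0 for all l forces v = 0. Hence q(B) v = 0,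
   and for a root beta of q with |beta| >= 1, lying on the prime factor f of q = f r, the vector
   zeta = (f/(x - beta))(B) r(B) v is a nonzero eigenvector of B whose pairings with the d_l are the
   values at beta of integer polynomials not depending on beta.

   If q has a root in the open unit disc, take for f the prime factor having that root: type I.
   Otherwise eps = 0 (after a shift), so <B^j v, d_l> is an integer for all j, and B acts on the cyclic
   space of v by the companion matrix of q, which yields the integral factor. Its measure is not
   Rajchman because its Fourier transform has modulus |fourier mu (B^j v)| along a sequence tending
   to infinity. *)

theory Submission
  imports Defs "HOL-Computational_Algebra.Polynomial_Factorial"
    "HOL-Computational_Algebra.Fundamental_Theorem_Algebra"
begin

section \<open>Recurrences of integer sequences\<close>


text \<open>The vectors \<open>B^j v\<close> pair only almost integrally with the
  \<open>d l\<close>, whereas the nearest integers obey exact recurrences. One principle carries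
  information from integers to vectors: a polynomial that kills the integers leaves a combination of
  errors, which tends to 0, and irreducibility turns decay of all pairings into vanishing. At a root
  of modulus at least 1 a geometric sequence tending to 0 is zero, so pairings with eigenvectors
  become exact; inside the disc this argument fails, hence the case distinction. No normal form of
  \<open>B\<close> is used: polynomials act on sequences by \<open>shift_act\<close>, the variable
  being the shift, and on vectors by \<open>poly_orb\<close>, and inductions peel off one linear
  factor at a time. Since \<open>q\<close> may have repeated factors, \<open>v\<close> is replaced
  by \<open>r(B) v\<close>, which a prime \<open>f\<close> annihilates. Primality serves twice: a
  nonzero integer polynomial of degree below that of \<open>f\<close> shares no root with
  \<open>f\<close>, so the eigenvectors are nonzero, and every polynomial competing with
  \<open>f\<close> for least degree is a multiple of \<open>f\<close>.\<close>

definition shift_act :: "'a::comm_ring_1 poly \<Rightarrow> (nat \<Rightarrow> 'a) \<Rightarrow> nat \<Rightarrow> 'a" where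
  "shift_act f u j = (\<Sum>i\<le>degree f. coeff f i * u (i + j))"

lemma shift_act_altdef:
  assumes "degree f \<le> N"
  shows "shift_act f u j = (\<Sum>i\<le>N. coeff f i * u (i + j))"
  unfolding shift_act_def
  by (rule sum.mono_neutral_left) (use assms in \<open>auto simp: coeff_eq_0\<close>)

lemma shift_act_0 [simp]: "shift_act 0 u j = 0"
  by (simp add: shift_act_def)

lemma shift_act_pCons [simp]: "shift_act (pCons a f) u j = a * u j + shift_act f u (Suc j)"
proof -
  have "shift_act (pCons a f) u j = (\<Sum>i\<le>Suc (degree f). coeff (pCons a f) i * u (i + j))"
    by (rule shift_act_altdef) (simp add: degree_pCons_le)
  also have "\<dots> = a * u j + (\<Sum>i\<le>degree f. coeff f i * u (i + Suc j))"
    by (simp add: sum.atMost_Suc_shift del: sum.atMost_Suc)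
  finally show ?thesis by (simp add: shift_act_def)
qed

lemma shift_act_1 [simp]: "shift_act 1 u = u"
  by (rule ext) (simp add: one_pCons)

lemma shift_act_add: "shift_act (f + g) u j = shift_act f u j + shift_act g u j"
proof (induction f arbitrary: g j)
  case (pCons a f)
  show ?case
    by (cases g) (simp add: pCons.IH distrib_right)
qed simp

lemma shift_act_smult: "shift_act (smult c f) u j = c * shift_act f u j"
  by (induction f arbitrary: j) (simp_all add: algebra_simps)

lemma shift_act_minus: "shift_act (- f) u j = - shift_act f u j"
  using shift_act_smult[of "-1" f u j] by simp

lemma shift_act_diff: "shift_act (f - g) u j = shift_act f u j - shift_act g u j"
  using shift_act_add[of f "-g" u j] by (simp add: shift_act_minus)

lemma shift_act_shift: "shift_act f (\<lambda>i. u (i + k)) j = shift_act f u (j + k)"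
  by (simp add: shift_act_def add.assoc)

lemma shift_act_mult: "shift_act (f * g) u j = shift_act f (shift_act g u) j"
  by (induction f arbitrary: j) (simp_all add: shift_act_add shift_act_smult)

lemma shift_act_commute: "shift_act f (shift_act g u) j = shift_act g (shift_act f u) j"
  by (simp only: shift_act_mult[symmetric] mult.commute)

lemma shift_act_eq_0: "(\<And>i. u i = 0) \<Longrightarrow> shift_act f u j = 0"
  by (simp add: shift_act_def)

lemma shift_act_seq_diff: "shift_act f (\<lambda>i. u i - v i) j = shift_act f u j - shift_act f v j"
  by (simp add: shift_act_def algebra_simps sum_subtractf)

lemma shift_act_seq_cmult: "shift_act f (\<lambda>i. c * u i) j = c * shift_act f u j"
  by (simp add: shift_act_def sum_distrib_left algebra_simps)

lemma shift_act_seq_sum: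
  "shift_act f (\<lambda>i. \<Sum>k\<in>I. u k i) j = (\<Sum>k\<in>I. shift_act f (u k) j)"
  by (simp add: shift_act_def sum_distrib_left sum.swap[of _ I])

lemma shift_act_monom [simp]: "shift_act (monom c n) u j = c * u (n + j)"
  by (induction n arbitrary: j) (simp_all add: monom_0 monom_Suc)

lemma shift_act_of_int:
  "of_int (shift_act f u j) = shift_act (map_poly of_int f) (\<lambda>i. of_int (u i)) j"
  by (induction f arbitrary: j) (simp_all add: map_poly_pCons)

lemma tendsto_shift_act:
  fixes u :: "nat \<Rightarrow> 'a::{comm_ring_1, real_normed_algebra}"
  assumes "u \<longlonglongrightarrow> 0"
  shows "shift_act f u \<longlonglongrightarrow> 0"
proof -
  have "(\<lambda>j. \<Sum>i\<le>degree f. coeff f i * u (i + j)) \<longlonglongrightarrow> (\<Sum>i\<le>degree f. coeff f i * 0)"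
  proof (intro tendsto_intros)
    fix i show "(\<lambda>j. u (i + j)) \<longlonglongrightarrow> 0"
      using LIMSEQ_ignore_initial_segment[OF assms, of i] by (simp add: add.commute)
  qed
  then show ?thesis
    by (simp add: shift_act_def [abs_def])
qed

text \<open>The top term of the recurrence isolates \<open>lead_coeff f * u j\<close>, and in a
  domain the leading coefficient cancels even if it is not a unit. Fatou's lemma relies on this for
  a non-monic \<open>Q\<close>.\<close>

lemma recurrence_zero:
  fixes u :: "nat \<Rightarrow> 'a::idom"
  assumes f: "f \<noteq> 0" and rec: "\<And>j. shift_act f u j = 0" and init: "\<And>j. j < degree f \<Longrightarrow> u j = 0"
  shows "u j = 0"
proof (induction j rule: less_induct)
  case (less j)
  show ?case
  proof (cases "j < degree f")
    case False
    then obtain k where k: "j = degree f + k"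
      using le_Suc_ex not_less by blast
    have "0 = (\<Sum>i\<le>degree f. coeff f i * u (i + k))"
      using rec[of k] by (simp add: shift_act_def)
    also have "\<dots> = (\<Sum>i\<in>{degree f}. coeff f i * u (i + k))"
    proof (rule sum.mono_neutral_right)
      show "\<forall>i\<in>{..degree f} - {degree f}. coeff f i * u (i + k) = 0"
        using less k by auto
    qed auto
    finally show ?thesis
      using f k by simp
  qed (use init in auto)
qed

text \<open>Kronecker's criterion. A \<open>Q\<close> of least degree among those with
  \<open>shift_act Q K\<close> vanishing up to \<open>n\<close> also works for \<open>n + 1\<close>: apply it together with a solution
  \<open>Q'\<close> for \<open>n + 1\<close> to \<open>K\<close> at the index \<open>n + 1 - degree Q'\<close>.\<close>

lemma kronecker_rational:
  fixes K :: "nat \<Rightarrow> 'a::idom"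
  assumes "\<And>n. n \<ge> n0 \<Longrightarrow> \<exists>Q. Q \<noteq> 0 \<and> degree Q \<le> n \<and> (\<forall>j\<le>n. shift_act Q K j = 0)"
  shows "\<exists>Q. Q \<noteq> 0 \<and> (\<forall>j. shift_act Q K j = 0)"
proof -
  define Ann where "Ann n = {Q. Q \<noteq> 0 \<and> (\<forall>j\<le>n. shift_act Q K j = 0)}" for n
  obtain Q0 where Q0: "Q0 \<in> Ann n0" "degree Q0 \<le> n0"
    using assms[of n0] by (auto simp: Ann_def)
  define Q where "Q = arg_min degree (\<lambda>Q. Q \<in> Ann n0)"
  have QA: "Q \<in> Ann n0" and Qmin: "\<And>P. P \<in> Ann n0 \<Longrightarrow> degree Q \<le> degree P"
    using arg_min_nat_lemma[of "\<lambda>Q. Q \<in> Ann n0" Q0 degree] Q0 by (auto simp: Q_def)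
  have "Q \<in> Ann (n0 + k)" for k
  proof (induction k)
    case 0
    then show ?case using QA by simp
  next
    case (Suc k)
    define n where "n = n0 + k"
    obtain Q' where Q': "Q' \<in> Ann (Suc n)" "degree Q' \<le> Suc n"
      using assms[of "Suc n"] by (auto simp: Ann_def n_def)
    have "Q' \<in> Ann n0"
      using Q'(1) by (auto simp: Ann_def n_def)
    then have DD: "degree Q \<le> degree Q'"
      by (rule Qmin)
    define s where "s = Suc n - degree Q'"
    have s: "degree Q' + s = Suc n"
      using Q'(2) by (simp add: s_def)
    have QK: "shift_act Q K j = 0" if "j \<le> n" for j
      using Suc that by (auto simp: Ann_def n_def)
    \<comment> \<open>For \<open>i\<close> below \<open>degree Q'\<close> the index
      \<open>i + s\<close> is at most \<open>n\<close>, where \<open>shift_act Q K\<close> vanishes;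
      only the top term survives.\<close>
    have "shift_act Q' (shift_act Q K) s = (\<Sum>i\<in>{degree Q'}. coeff Q' i * shift_act Q K (i + s))"
      unfolding shift_act_def[of Q']
      by (rule sum.mono_neutral_right) (use s QK in auto)
    then have 1: "shift_act Q' (shift_act Q K) s = lead_coeff Q' * shift_act Q K (Suc n)"
      by (simp add: s)
    \<comment> \<open>Here \<open>degree Q \<le> degree Q'\<close> keeps every index at most
      \<open>Suc n\<close>, within the range annihilated by \<open>Q'\<close>.\<close>
    have "shift_act Q (shift_act Q' K) s = 0"
      unfolding shift_act_def[of Q]
      using Q'(1) DD s by (intro sum.neutral) (auto simp: Ann_def)
    with 1 have "lead_coeff Q' * shift_act Q K (Suc n) = 0"
      by (metis shift_act_commute)
    then have "shift_act Q K (Suc n) = 0"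
      using Q'(1) by (auto simp: Ann_def)
    then have "\<forall>j\<le>Suc n. shift_act Q K j = 0"
      using QK le_Suc_eq by blast
    then show ?case using QA by (auto simp: Ann_def n_def)
  qed
  then have "shift_act Q K j = 0" for j
    unfolding Ann_def by (metis (mono_tags, lifting) le_add2 mem_Collect_eq)
  then show ?thesis
    using QA by (auto simp: Ann_def)
qed

text \<open>The values of \<open>v\<close> on \<open>G\<close> form an ideal of the integers,
  generated by a value of least nonzero modulus. The ideal is kept as an image so that its generator
  comes with a witness in \<open>G\<close>, later a polynomial.\<close>

lemma int_submodule_generator:
  fixes v :: "'a \<Rightarrow> int"
  assumes "x0 \<in> G" and comb: "\<And>x y c. x \<in> G \<Longrightarrow> y \<in> G \<Longrightarrow> \<exists>z\<in>G. v z = v x - c * v y"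
  shows "\<exists>g\<in>G. \<forall>x\<in>G. v g dvd v x"
proof (cases "\<forall>x\<in>G. v x = 0")
  case True
  then show ?thesis using assms(1) by auto
next
  case False
  then obtain x1 where x1: "x1 \<in> G \<and> v x1 \<noteq> 0" by auto
  define g where "g = arg_min (\<lambda>x. nat \<bar>v x\<bar>) (\<lambda>x. x \<in> G \<and> v x \<noteq> 0)"
  have g: "g \<in> G" "v g \<noteq> 0"
    and gmin: "\<And>x. x \<in> G \<and> v x \<noteq> 0 \<Longrightarrow> nat \<bar>v g\<bar> \<le> nat \<bar>v x\<bar>"
    using arg_min_nat_lemma[of "\<lambda>x. x \<in> G \<and> v x \<noteq> 0" x1 "\<lambda>x. nat \<bar>v x\<bar>"] x1
    by (auto simp: g_def)
  have "v g dvd v x" if x: "x \<in> G" for x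
  proof (rule ccontr)
    assume nd: "\<not> v g dvd v x"
    obtain z where z: "z \<in> G" "v z = v x - (v x div v g) * v g"
      using comb[OF x g(1)] by blast
    then have "v z = v x mod v g"
      by (simp add: minus_div_mult_eq_mod)
    moreover from this nd have "v z \<noteq> 0"
      by (simp add: dvd_eq_mod_eq_0)
    moreover have "\<bar>v x mod v g\<bar> < \<bar>v g\<bar>"
      using g(2) by (simp add: abs_mod_less)
    ultimately show False
      using gmin[of z] z(1) by auto
  qed
  then show ?thesis using g(1) by blast
qed

text \<open>Fatou's lemma. By the recurrence, a combination of shifts of \<open>K\<close> is determined by its first
  \<open>degree Q\<close> values, so every polynomial is congruent, modulo the annihilator of \<open>K\<close>, to one of
  bounded degree; apply this to a high power of the variable.\<close>

lemma fatou_monic: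
  fixes K :: "nat \<Rightarrow> int"
  assumes "Q \<noteq> 0" and ann: "\<And>j. shift_act Q K j = 0"
  shows "\<exists>q. lead_coeff q = 1 \<and> (\<forall>j. shift_act q K j = 0)"
proof -
  define I where "I t = {P. \<forall>j<t. shift_act P K j = 0}" for t
  \<comment> \<open>Modulo \<open>I t\<close> the integer polynomials are spanned by those of degree
    below \<open>N\<close>. Passing to \<open>Suc t\<close> costs one further polynomial
    \<open>g\<close>, whose value at position \<open>t\<close> generates all values attained there
    on \<open>I t\<close>.\<close>
  have "\<exists>N. \<forall>P. \<exists>R. (R = 0 \<or> degree R < N) \<and> P - R \<in> I t" for t
  proof (induction t)
    case 0
    then show ?case by (auto simp: I_def)
  next
    case (Suc t)
    then obtain N where N: "\<And>P. \<exists>R. (R = 0 \<or> degree R < N) \<and> P - R \<in> I t" by blast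
    have "\<exists>g\<in>I t. \<forall>x\<in>I t. shift_act g K t dvd shift_act x K t"
    proof (rule int_submodule_generator)
      show "0 \<in> I t" by (simp add: I_def)
      show "\<exists>z\<in>I t. shift_act z K t = shift_act x K t - c * shift_act y K t"
        if "x \<in> I t" "y \<in> I t" for x y c
        using that
        by (intro bexI[of _ "x - smult c y"]) (auto simp: I_def shift_act_diff shift_act_smult)
    qed
    then obtain g where g: "g \<in> I t" "\<And>x. x \<in> I t \<Longrightarrow> shift_act g K t dvd shift_act x K t"
      by blast
    have "\<exists>R. (R = 0 \<or> degree R < max N (Suc (degree g))) \<and> P - R \<in> I (Suc t)" for P
    proof -
      obtain R where R: "R = 0 \<or> degree R < N" "P - R \<in> I t" using N by blast
      obtain c where c: "shift_act (P - R) K t = shift_act g K t * c"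
        using g(2)[OF R(2)] by (auto elim: dvdE)
      have "degree (R + smult c g) < max N (Suc (degree g))"
        using R(1) by (intro degree_add_less le_less_trans[OF degree_smult_le]) auto
      moreover have "P - (R + smult c g) = (P - R) - smult c g" by simp
      moreover have "(P - R) - smult c g \<in> I (Suc t)"
        using R(2) g(1) c
        by (auto simp: I_def shift_act_diff[of "P - R"] shift_act_smult less_Suc_eq)
      ultimately show ?thesis by metis
    qed
    then show ?case by blast
  qed
  then obtain N where N: "\<And>P. \<exists>R. (R = 0 \<or> degree R < N) \<and> P - R \<in> I (degree Q)" by meson
  obtain R where R: "R = 0 \<or> degree R < N" "monom 1 N - R \<in> I (degree Q)" using N by blast
  define q where "q = monom 1 N - R"
  have "lead_coeff q = 1"
  proof -
    have "coeff R N = 0" using R(1) by (auto simp: coeff_eq_0)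
    then have "coeff q N = 1" by (simp add: q_def)
    moreover have "degree q \<le> N"
      unfolding q_def using R(1) by (intro degree_diff_le) (auto simp: degree_monom_le)
    ultimately show ?thesis
      by (metis le_antisym le_degree zero_neq_one)
  qed
  moreover have "shift_act q K j = 0" for j
  proof (rule recurrence_zero[OF assms(1)])
    show "shift_act Q (shift_act q K) j = 0" for j
      by (subst shift_act_commute) (simp add: ann[abs_def] shift_act_eq_0)
    show "shift_act q K j = 0" if "j < degree Q" for j
      using R(2) that by (simp add: I_def q_def)
  qed
  ultimately show ?thesis by blast
qed

section \<open>Almost recurrent integer sequences\<close>


lemma sum_PiE_insert:
  assumes "x \<notin> I"
  shows "(\<Sum>q\<in>Pi\<^sub>E (insert x I) T. h q) = (\<Sum>k\<in>T x. \<Sum>q\<in>Pi\<^sub>E I T. h (q(x := k)))"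
proof -
  have "(\<Sum>q\<in>Pi\<^sub>E (insert x I) T. h q) = (\<Sum>(k, q)\<in>T x \<times> Pi\<^sub>E I T. h (q(x := k)))"
    unfolding PiE_insert_eq
    by (subst sum.reindex[OF inj_combinator[OF assms]]) (simp add: case_prod_unfold)
  then show ?thesis by (simp add: sum.cartesian_product)
qed

text \<open>Under the uniform distribution on the box the coordinates \<open>q i\<close> are
  independent with mean zero, so the cross terms cancel and the variances add; the power of
  \<open>card B\<close> undoes the normalisation.\<close>

lemma second_moment_box:
  fixes e :: "'i \<Rightarrow> real" and B :: "int set"
  assumes "finite I" and fB: "finite B" and mean: "(\<Sum>k\<in>B. real_of_int k) = 0"
    and M: "\<And>k. k \<in> B \<Longrightarrow> (real_of_int k)\<^sup>2 \<le> M"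
  shows "(\<Sum>q\<in>Pi\<^sub>E I (\<lambda>_. B). (\<Sum>i\<in>I. of_int (q i) * e i)\<^sup>2)
    \<le> real (card B) ^ card I * (M * (\<Sum>i\<in>I. (e i)\<^sup>2))"
  using assms(1)
proof (induction I rule: finite_induct)
  case (insert x I)
  let ?P = "Pi\<^sub>E I (\<lambda>_. B)"
  let ?S = "\<lambda>q. \<Sum>i\<in>I. real_of_int (q i) * e i"
  let ?b = "real (card B)"
  have cP: "real (card ?P) = ?b ^ card I"
    using insert.hyps by (simp add: card_PiE)
  have S: "(\<Sum>i\<in>insert x I. real_of_int ((q(x := k)) i) * e i) = of_int k * e x + ?S q" for q k
  proof -
    have "(\<Sum>i\<in>I. real_of_int ((q(x := k)) i) * e i) = ?S q"
      using insert.hyps by (intro sum.cong) auto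
    then show ?thesis using insert.hyps by simp
  qed
  have inner: "(\<Sum>k\<in>B. (of_int k * e x + s)\<^sup>2) \<le> ?b * (M * (e x)\<^sup>2) + ?b * s\<^sup>2" for s
  proof -
    have "(\<Sum>k\<in>B. (of_int k * e x + s)\<^sup>2)
        = (\<Sum>k\<in>B. (real_of_int k)\<^sup>2 * (e x)\<^sup>2) + 2 * e x * s * (\<Sum>k\<in>B. real_of_int k) + ?b * s\<^sup>2"
    proof -
      have "(\<Sum>k\<in>B. (of_int k * e x + s)\<^sup>2)
          = (\<Sum>k\<in>B. (real_of_int k)\<^sup>2 * (e x)\<^sup>2 + (2 * e x * s) * real_of_int k + s\<^sup>2)"
        by (intro sum.cong refl) (simp add: power2_sum power_mult_distrib)
      then show ?thesis by (simp add: sum.distrib sum_distrib_left)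
    qed
    also have "\<dots> \<le> (\<Sum>k\<in>B. M * (e x)\<^sup>2) + 0 + ?b * s\<^sup>2"
      unfolding mean by (intro add_mono sum_mono mult_right_mono M) auto
    finally show ?thesis by simp
  qed
  have "(\<Sum>q\<in>Pi\<^sub>E (insert x I) (\<lambda>_. B). (\<Sum>i\<in>insert x I. of_int (q i) * e i)\<^sup>2)
      = (\<Sum>q\<in>?P. \<Sum>k\<in>B. (of_int k * e x + ?S q)\<^sup>2)"
    unfolding sum_PiE_insert[OF insert.hyps(2)] S by (rule sum.swap)
  also have "\<dots> \<le> (\<Sum>q\<in>?P. ?b * (M * (e x)\<^sup>2) + ?b * (?S q)\<^sup>2)"
    by (intro sum_mono inner)
  also have "\<dots> = ?b ^ card I * (?b * (M * (e x)\<^sup>2)) + ?b * (\<Sum>q\<in>?P. (?S q)\<^sup>2)"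
    by (simp add: sum.distrib cP flip: sum_distrib_left)
  also have "\<dots> \<le> ?b ^ card I * (?b * (M * (e x)\<^sup>2))
      + ?b * (?b ^ card I * (M * (\<Sum>i\<in>I. (e i)\<^sup>2)))"
    by (intro add_left_mono mult_left_mono insert.IH) auto
  also have "\<dots> = ?b ^ card (insert x I) * (M * (\<Sum>i\<in>insert x I. (e i)\<^sup>2))"
    using insert.hyps by (simp add: algebra_simps)
  finally show ?case .
qed simp

text \<open>With base 3 the full two-sided geometric series equals 2, since
  \<open>1 + 2 * (1/3 + 1/9 + ...) = 2\<close>; hence the factor \<open>2 ^ card I\<close> of the
  next count.\<close>

lemma sum_third_power_abs_le:
  "(\<Sum>k\<in>{- int N..int N}. (1/3) ^ nat \<bar>k\<bar> :: real) \<le> 2"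
proof -
  have "(\<Sum>k\<in>{- int N..int N}. (1/3) ^ nat \<bar>k\<bar> :: real) = 2 - (1/3) ^ N"
  proof (induction N)
    case (Suc N)
    have "{- int (Suc N)..int (Suc N)}
        = insert (- int (Suc N)) (insert (int (Suc N)) {- int N..int N})"
      by auto
    then have "(\<Sum>k\<in>{- int (Suc N)..int (Suc N)}. (1/3) ^ nat \<bar>k\<bar> :: real)
        = 2 * (1/3) ^ Suc N + (\<Sum>k\<in>{- int N..int N}. (1/3) ^ nat \<bar>k\<bar>)"
      by (simp add: nat_add_distrib)
    then show ?case by (simp add: Suc.IH)
  qed simp
  then show ?thesis by simp
qed

text \<open>Each vector is weighted by the power \<open>3 ^ (s - \<bar>w\<bar>)\<close>, which is at least 1.\<close>

lemma card_int_vectors_l1_le: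
  assumes "finite I"
  shows "real (card {w \<in> Pi\<^sub>E I (\<lambda>_. {- int N..int N}). (\<Sum>i\<in>I. \<bar>w i\<bar>) \<le> int s})
    \<le> 3 ^ s * 2 ^ card I"
proof -
  let ?P = "Pi\<^sub>E I (\<lambda>_. {- int N..int N})"
  let ?W = "{w \<in> ?P. (\<Sum>i\<in>I. \<bar>w i\<bar>) \<le> int s}"
  have fP: "finite ?P"
    using assms by (intro finite_PiE) auto
  have "real (card ?W) = (\<Sum>w\<in>?W. 1)" by simp
  also have "\<dots> \<le> (\<Sum>w\<in>?W. 3 ^ s * (\<Prod>i\<in>I. (1/3) ^ nat \<bar>w i\<bar>))"
  proof (rule sum_mono)
    fix w assume "w \<in> ?W"
    then have "(\<Sum>i\<in>I. \<bar>w i\<bar>) \<le> int s" by simp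
    then have le: "(\<Sum>i\<in>I. nat \<bar>w i\<bar>) \<le> s"
    proof -
      assume "(\<Sum>i\<in>I. \<bar>w i\<bar>) \<le> int s"
      moreover have "int (\<Sum>i\<in>I. nat \<bar>w i\<bar>) = (\<Sum>i\<in>I. \<bar>w i\<bar>)" by simp
      ultimately show ?thesis by linarith
    qed
    have "(3::real) ^ s * (\<Prod>i\<in>I. (1/3) ^ nat \<bar>w i\<bar>) = 3 ^ s * (1/3) ^ (\<Sum>i\<in>I. nat \<bar>w i\<bar>)"
      by (simp add: power_sum)
    also have "\<dots> = 3 ^ (s - (\<Sum>i\<in>I. nat \<bar>w i\<bar>))"
    proof -
      have "(3::real) ^ s = 3 ^ (s - (\<Sum>i\<in>I. nat \<bar>w i\<bar>)) * 3 ^ (\<Sum>i\<in>I. nat \<bar>w i\<bar>)"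
        using le by (simp flip: power_add)
      then show ?thesis by (simp add: power_one_over)
    qed
    also have "\<dots> \<ge> 1" by simp
    finally show "(1::real) \<le> 3 ^ s * (\<Prod>i\<in>I. (1/3) ^ nat \<bar>w i\<bar>)" .
  qed
  also have "\<dots> \<le> (\<Sum>w\<in>?P. 3 ^ s * (\<Prod>i\<in>I. (1/3) ^ nat \<bar>w i\<bar>))"
    using fP by (intro sum_mono2 mult_nonneg_nonneg prod_nonneg) auto
  also have "\<dots> = 3 ^ s * (\<Prod>i\<in>I. \<Sum>k\<in>{- int N..int N}. (1/3) ^ nat \<bar>k\<bar>)"
    using assms by (subst prod_sum_PiE) (auto simp: sum_distrib_left)
  also have "\<dots> \<le> 3 ^ s * (\<Prod>i\<in>I. 2)"
    by (intro mult_left_mono prod_mono) (auto intro!: sum_nonneg sum_third_power_abs_le)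
  finally show ?thesis by simp
qed

text \<open>A nonzero rounding forces \<open>\<bar>x\<bar> \<ge> 1/2\<close>, and there the linear
  bound \<open>2 * \<bar>x\<bar>\<close> is dominated by the square. This converts a bound on a sum
  of squares into an l1 bound on the rounded vector.\<close>

lemma abs_round_le_square: "real_of_int \<bar>round x\<bar> \<le> 4 * x\<^sup>2" for x :: real
proof (cases "round x = 0")
  case False
  have 1: "\<bar>of_int (round x) - x\<bar> \<le> 1/2" by (rule of_int_round_abs_le)
  have "1 \<le> \<bar>real_of_int (round x)\<bar>" using False by linarith
  then have x: "1/2 \<le> \<bar>x\<bar>" and "\<bar>real_of_int (round x)\<bar> \<le> 2 * \<bar>x\<bar>" using 1 by linarith+
  moreover have "2 * \<bar>x\<bar> \<le> 4 * (\<bar>x\<bar> * \<bar>x\<bar>)"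
    using mult_right_mono[OF x, of "\<bar>x\<bar>"] by simp
  ultimately show ?thesis by (simp add: power2_eq_square)
qed simp

text \<open>Numbers with equal rounding share a half-open unit interval, which makes the inequality
  strict, as \<open>int_recurrence_vanishes\<close> requires.\<close>

lemma abs_diff_less_1_if_round_eq:
  fixes x y :: real
  assumes "round x = round y"
  shows "\<bar>x - y\<bar> < 1"
  using assms unfolding round_def by linarith

text \<open>Since \<open>g\<close> is monic, once the earlier terms vanish the defect is the integer
  \<open>Y j\<close> itself, and an integer of modulus below 1 is 0.\<close>

lemma int_recurrence_vanishes:
  fixes Y :: "nat \<Rightarrow> int" and g :: "real poly"
  assumes g: "lead_coeff g = 1" and init: "\<And>j. j < degree g \<Longrightarrow> Y j = 0"
    and small: "\<And>j. j \<le> n \<Longrightarrow> \<bar>shift_act g (\<lambda>i. of_int (Y i)) j\<bar> < 1"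
  shows "j \<le> n \<Longrightarrow> Y j = 0"
proof (induction j rule: less_induct)
  case (less j)
  show ?case
  proof (cases "j < degree g")
    case False
    then obtain k where k: "j = degree g + k"
      using le_Suc_ex not_less by blast
    have "shift_act g (\<lambda>i. of_int (Y i)) k = (\<Sum>i\<in>{degree g}. coeff g i * of_int (Y (i + k)))"
      unfolding shift_act_def
    proof (rule sum.mono_neutral_right)
      show "\<forall>i\<in>{..degree g} - {degree g}. coeff g i * of_int (Y (i + k)) = 0"
        using less k by auto
    qed auto
    also have "\<dots> = of_int (Y j)" using g k by simp
    finally have "\<bar>real_of_int (Y j)\<bar> < 1" using small[of k] less.prems k by simp
    then show ?thesis by linarith
  qed (use init in auto)
qed

lemma poly_of_coeffs:
  fixes q :: "nat \<Rightarrow> 'a::comm_ring_1"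
  obtains Q where "degree Q \<le> n" "\<And>i. i \<le> n \<Longrightarrow> coeff Q i = q i"
    "\<And>u j. shift_act Q u j = (\<Sum>i\<le>n. q i * u (i + j))"
proof -
  define Q where "Q = (\<Sum>i\<le>n. monom (q i) i)"
  have 1: "degree Q \<le> n"
    unfolding Q_def by (rule degree_sum_le) (auto intro: order.trans[OF degree_monom_le])
  have 2: "coeff Q i = q i" if "i \<le> n" for i
    using that by (simp add: Q_def coeff_sum if_distrib[where f = "coeff _"] cong: if_cong)
  have "shift_act Q u j = (\<Sum>i\<le>n. q i * u (i + j))" for u j
    unfolding shift_act_altdef[OF 1] by (intro sum.cong) (auto simp: 2)
  with 1 2 show thesis by (rule that)
qed

text \<open>Row \<open>j\<close> of the Hankel array sums to at most the tail of the series from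
  \<open>j\<close>. All but finitely many rows are therefore small, and the exceptional ones are
  averaged away by \<open>n + 1\<close>.\<close>

lemma hankel_average_small:
  fixes e :: "nat \<Rightarrow> real"
  assumes sm: "summable (\<lambda>i. (e i)\<^sup>2)" and "\<theta> > 0"
  shows "\<exists>n0. \<forall>n\<ge>n0. (\<Sum>j\<le>n. \<Sum>i\<le>n. (e (i + j))\<^sup>2) \<le> \<theta> * real (n + 1)"
proof -
  define E where "E = (\<Sum>i. (e i)\<^sup>2)"
  have tail: "summable (\<lambda>i. (e (i + j))\<^sup>2)" for j
    using summable_ignore_initial_segment[OF sm, of j] by simp
  define \<tau> where "\<tau> j = (\<Sum>i. (e (i + j))\<^sup>2)" for j
  have \<tau>0: "\<tau> j \<ge> 0" for j unfolding \<tau>_def by (intro suminf_nonneg tail) auto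
  have \<tau>E: "\<tau> j \<le> E" for j
    using suminf_split_initial_segment[OF sm, of j] sum_nonneg[of "{..<j}" "\<lambda>i. (e i)\<^sup>2"]
    by (auto simp: \<tau>_def E_def)
  have fin: "(\<Sum>i\<le>n. (e (i + j))\<^sup>2) \<le> \<tau> j" for n j
    unfolding \<tau>_def by (rule sum_le_suminf[OF tail]) auto
  have "\<exists>N. \<forall>n\<ge>N. norm (\<Sum>i. (e (i + n))\<^sup>2) < \<theta>/2"
    using suminf_exist_split[OF _ sm, of "\<theta>/2"] assms(2) by auto
  then obtain N where N: "\<And>n. n \<ge> N \<Longrightarrow> \<tau> n \<le> \<theta>/2"
    unfolding \<tau>_def by (force simp: abs_less_iff)
  show ?thesis
  proof (intro exI allI impI)
    \<comment> \<open>From this size on, the at most \<open>N\<close> exceptional rows, each bounded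
      by \<open>E\<close>, use up only the other half of \<open>\<theta>\<close>.\<close>
    fix n assume n: "n \<ge> nat \<lceil>2 * real N * E / \<theta>\<rceil>"
    have "2 * real N * E / \<theta> \<le> real (n + 1)" using n by linarith
    then have NE: "real N * E \<le> \<theta>/2 * real (n + 1)" using assms(2) by (simp add: field_simps)
    have "(\<Sum>j\<le>n. \<Sum>i\<le>n. (e (i + j))\<^sup>2) \<le> (\<Sum>j\<le>n. (if j < N then E else 0) + \<theta>/2)"
    proof (rule sum_mono)
      fix j
      show "(\<Sum>i\<le>n. (e (i + j))\<^sup>2) \<le> (if j < N then E else 0) + \<theta>/2"
        using fin[where n = n and j = j] \<tau>E[of j] N[of j] assms(2) by (cases "j < N") auto
    qed
    also have "\<dots> = (\<Sum>j\<in>{..n} \<inter> {j. j < N}. E) + \<theta>/2 * real (n + 1)"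
      by (simp add: sum.distrib sum.If_cases)
    also have "(\<Sum>j\<in>{..n} \<inter> {j. j < N}. E) \<le> real N * E"
    proof -
      have "card ({..n} \<inter> {j. j < N}) \<le> card {..<N}" by (intro card_mono) auto
      then show ?thesis using \<tau>0[of 0] \<tau>E[of 0] by (simp add: mult_right_mono)
    qed
    finally show "(\<Sum>j\<le>n. \<Sum>i\<le>n. (e (i + j))\<^sup>2) \<le> \<theta> * real (n + 1)"
      using NE by linarith
  qed
qed

text \<open>Pigeonhole on the coefficient box \<open>{-H..H} ^ (n + 1)\<close>. For at least half of the box the
  numbers \<open>W j = shift_act g (shift_act Q K) j\<close> have a small sum of squares by the second moment
  estimate, so that their roundings take few values; together with the first \<open>degree g\<close> entries of
  \<open>shift_act Q K\<close> there are fewer values than polynomials.\<close>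

lemma hankel_degenerate:
  fixes K :: "nat \<Rightarrow> int" and g :: "real poly"
  assumes g: "lead_coeff g = 1"
    and sm: "summable (\<lambda>j. (shift_act g (\<lambda>i. of_int (K i)) j)\<^sup>2)"
    and growth: "\<And>j. \<bar>real_of_int (K j)\<bar> \<le> C * \<rho> ^ j" and \<rho>: "\<rho> \<ge> 1"
  shows "\<exists>n0. \<forall>n\<ge>n0. \<exists>Q. Q \<noteq> 0 \<and> degree Q \<le> n \<and> (\<forall>j\<le>n. shift_act Q K j = 0)"
proof -
  define d where "d = degree g"
  define e where "e = shift_act g (\<lambda>i. real_of_int (K i))"
  \<comment> \<open>The values will number at most \<open>(6 * (4 * \<rho>) ^ d) ^ (n + 1)\<close>;
    a box side of at least twice that base leaves a factor \<open>2 ^ (n + 1)\<close> to beat the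
    loss of half of the box.\<close>
  define H where "H = nat \<lceil>6 * (4 * \<rho>) ^ d\<rceil>"
  have H12: "12 * (4 * \<rho>) ^ d \<le> real (2 * H + 1)"
    unfolding H_def by linarith
  have "1 \<le> (4 * \<rho>) ^ d" using \<rho> by (intro one_le_power) simp
  then have H1: "H \<ge> 1"
    unfolding H_def by linarith
  have C0: "C \<ge> 0" using growth[of 0] by simp
  \<comment> \<open>\<open>C'\<close> collects the constants in
    \<open>2 * R + 1 \<le> C' * (n + 1) * \<rho> ^ n\<close>, where \<open>R\<close> bounds the
    first \<open>d\<close> entries of \<open>Y q\<close>.\<close>
  define C' where "C' = 2 * real H * C * \<rho> ^ d + 1"
  \<comment> \<open>The 8 makes the mean over the box of the sums of squares at most
    \<open>(n + 1) / 8\<close>, half of the threshold in \<open>G\<close>, so that Markov's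
    inequality keeps at least half of the box.\<close>
  obtain n1 where n1: "\<And>n. n \<ge> n1 \<Longrightarrow>
      (\<Sum>j\<le>n. \<Sum>i\<le>n. (e (i + j))\<^sup>2) \<le> 1 / (8 * (real H)\<^sup>2) * real (n + 1)"
    using hankel_average_small[of e "1 / (8 * (real H)\<^sup>2)"] sm H1 by (auto simp: e_def)
  show ?thesis
  proof (rule exI, intro allI impI)
    fix n assume n: "n \<ge> max (max n1 1) (nat \<lceil>C'\<rceil>)"
    define b where "b = 2 * H + 1"
    define B where "B = {- int H..int H}"
    have cB: "card B = b" by (simp add: B_def b_def)
    have fB: "finite B" by (simp add: B_def)
    define P where "P = Pi\<^sub>E {..n} (\<lambda>_. B)"
    have fP: "finite P" unfolding P_def by (intro finite_PiE) (auto simp: B_def)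
    have cP: "real (card P) = real b ^ (n + 1)" by (simp add: P_def card_PiE cB)
    define Y where "Y q j = (\<Sum>i\<le>n. q i * K (i + j))" for q j
    define W where "W q j = (\<Sum>i\<le>n. real_of_int (q i) * e (i + j))" for q j
    \<comment> \<open>Applying \<open>g\<close> commutes with combining shifts, so
      \<open>W q\<close> is the recurrence defect of the integer sequence
      \<open>Y q\<close>.\<close>
    have WY: "W q j = shift_act g (\<lambda>i. of_int (Y q i)) j" for q j
    proof -
      have "shift_act g (\<lambda>t. real_of_int (K (i + t))) j = e (i + j)" for i
        using shift_act_shift[of g "\<lambda>t. real_of_int (K t)" i j] by (simp add: e_def add.commute)
      then show ?thesis
        unfolding W_def Y_def of_int_sum shift_act_seq_sum of_int_mult shift_act_seq_cmult by simp
    qed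
    have mean: "(\<Sum>k\<in>B. real_of_int k) = 0"
    proof -
      have "(\<Sum>k\<in>B. real_of_int k) = (\<Sum>k\<in>B. real_of_int (- k))"
        by (rule sum.reindex_bij_witness[of _ uminus uminus]) (auto simp: B_def)
      then show ?thesis by (simp add: sum_negf)
    qed
    have sq: "(real_of_int k)\<^sup>2 \<le> (real H)\<^sup>2" if "k \<in> B" for k
      using that by (intro power2_le_iff_abs_le[THEN iffD2]) (auto simp: B_def)
    have "(\<Sum>q\<in>P. \<Sum>j\<le>n. (W q j)\<^sup>2) = (\<Sum>j\<le>n. \<Sum>q\<in>P. (W q j)\<^sup>2)"
      by (rule sum.swap)
    also have "\<dots> \<le> (\<Sum>j\<le>n. real b ^ (n + 1) * ((real H)\<^sup>2 * (\<Sum>i\<le>n. (e (i + j))\<^sup>2)))"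
    proof (rule sum_mono)
      fix j
      show "(\<Sum>q\<in>P. (W q j)\<^sup>2) \<le> real b ^ (n + 1) * ((real H)\<^sup>2 * (\<Sum>i\<le>n. (e (i + j))\<^sup>2))"
        using second_moment_box[of "{..n}" B "(real H)\<^sup>2" "\<lambda>i. e (i + j)"] mean sq
        by (simp add: P_def W_def cB fB)
    qed
    also have "\<dots> = real b ^ (n + 1) * (real H)\<^sup>2 * (\<Sum>j\<le>n. \<Sum>i\<le>n. (e (i + j))\<^sup>2)"
      by (simp add: sum_distrib_left mult.assoc)
    also have "\<dots> \<le> real b ^ (n + 1) * (real H)\<^sup>2 * (1 / (8 * (real H)\<^sup>2) * real (n + 1))"
      using n by (intro mult_left_mono n1) auto
    also have "\<dots> = real b ^ (n + 1) * real (n + 1) / 8"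
      using H1 by simp
    finally have total: "(\<Sum>q\<in>P. \<Sum>j\<le>n. (W q j)\<^sup>2) \<le> real b ^ (n + 1) * real (n + 1) / 8" .
    \<comment> \<open>The threshold matches the factor 4 of \<open>abs_round_le_square\<close>: the
      roundings get l1 norm at most \<open>n + 1\<close>.\<close>
    define G where "G = {q \<in> P. (\<Sum>j\<le>n. (W q j)\<^sup>2) \<le> real (n + 1) / 4}"
    have "real (card (P - G)) * (real (n + 1) / 4) = (\<Sum>q\<in>P - G. real (n + 1) / 4)"
      by simp
    also have "\<dots> \<le> (\<Sum>q\<in>P - G. \<Sum>j\<le>n. (W q j)\<^sup>2)"
      by (intro sum_mono) (auto simp: G_def)
    also have "\<dots> \<le> (\<Sum>q\<in>P. \<Sum>j\<le>n. (W q j)\<^sup>2)"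
      using fP by (intro sum_mono2) (auto intro!: sum_nonneg)
    finally have "real (card (P - G)) * real (n + 1) \<le> (real b ^ (n + 1) / 2) * real (n + 1)"
      using total by linarith
    then have "real (card (P - G)) \<le> real b ^ (n + 1) / 2"
      by (rule mult_right_le_imp_le) simp
    moreover have "real (card P) = real (card G) + real (card (P - G))"
      using fP by (subst card_Diff_subset) (auto simp: G_def finite_subset card_mono of_nat_diff)
    ultimately have cG: "real b ^ (n + 1) / 2 \<le> real (card G)"
      using cP by linarith
    define R where "R = real (n + 1) * real H * C * \<rho> ^ (n + d)"
    have R0: "R \<ge> 0" using C0 \<rho> by (simp add: R_def)
    define r where "r = nat \<lfloor>R\<rfloor>"
    have rR: "real r \<le> R" using R0 unfolding r_def by linarith
    define V where "V = {w \<in> Pi\<^sub>E {..n} (\<lambda>_. {- int (n + 1)..int (n + 1)}). (\<Sum>i\<le>n. \<bar>w i\<bar>) \<le> int (n + 1)}"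
    define U where "U = Pi\<^sub>E {..<d} (\<lambda>_. {- int r..int r})"
    define \<Phi> where "\<Phi> q = (restrict (Y q) {..<d}, restrict (\<lambda>j. round (W q j)) {..n})" for q
    have YR: "\<bar>real_of_int (Y q j)\<bar> \<le> R" if q: "q \<in> P" and j: "j < d" for q j
    proof -
      have "\<bar>real_of_int (Y q j)\<bar> \<le> (\<Sum>i\<le>n. \<bar>real_of_int (q i)\<bar> * \<bar>real_of_int (K (i + j))\<bar>)"
        unfolding Y_def of_int_sum of_int_mult abs_mult[symmetric] by (rule sum_abs)
      also have "\<dots> \<le> (\<Sum>i\<le>n. real H * (C * \<rho> ^ (n + d)))"
      proof (intro sum_mono mult_mono)
        fix i assume i: "i \<in> {..n}"
        then have "q i \<in> B" using q by (auto simp: P_def)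
        then show "\<bar>real_of_int (q i)\<bar> \<le> real H" by (auto simp: B_def)
        have "\<bar>real_of_int (K (i + j))\<bar> \<le> C * \<rho> ^ (i + j)" by (rule growth)
        also have "\<dots> \<le> C * \<rho> ^ (n + d)"
          using i j \<rho> C0 by (intro mult_left_mono power_increasing) auto
        finally show "\<bar>real_of_int (K (i + j))\<bar> \<le> C * \<rho> ^ (n + d)" .
      qed auto
      finally show ?thesis by (simp add: R_def mult_ac)
    qed
    have "\<Phi> ` G \<subseteq> U \<times> V"
    proof (rule image_subsetI)
      fix q assume qG: "q \<in> G"
      obtain u v where uv: "\<Phi> q = (u, v)" by (cases "\<Phi> q")
      have q: "q \<in> P" and qW: "(\<Sum>j\<le>n. (W q j)\<^sup>2) \<le> real (n + 1) / 4"
        using qG by (auto simp: G_def)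
      have "u \<in> U"
      proof -
        have "Y q j \<in> {- int r..int r}" if "j < d" for j
          using YR[OF q that] unfolding r_def by (auto simp: abs_le_iff) linarith+
        then have "restrict (Y q) {..<d} \<in> U" by (auto simp: U_def restrict_PiE_iff)
        then show ?thesis using uv by (simp add: \<Phi>_def)
      qed
      moreover have "v \<in> V"
      proof -
        have "real_of_int (\<Sum>j\<le>n. \<bar>round (W q j)\<bar>) \<le> (\<Sum>j\<le>n. 4 * (W q j)\<^sup>2)"
          unfolding of_int_sum by (intro sum_mono abs_round_le_square)
        also have "\<dots> \<le> real (n + 1)"
          using qW by (simp flip: sum_distrib_left)
        finally have s: "(\<Sum>j\<le>n. \<bar>round (W q j)\<bar>) \<le> int (n + 1)" by linarith
        have "round (W q j) \<in> {- int (n + 1)..int (n + 1)}" if "j \<le> n" for j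
          using member_le_sum[of j "{..n}" "\<lambda>j. \<bar>round (W q j)\<bar>"] that s
          unfolding atLeastAtMost_iff by (simp add: abs_le_iff)
        then have "restrict (\<lambda>j. round (W q j)) {..n} \<in> V"
          unfolding V_def mem_Collect_eq restrict_PiE_iff using s by auto
        then show ?thesis using uv by (simp add: \<Phi>_def)
      qed
      ultimately show "\<Phi> q \<in> U \<times> V" using uv by simp
    qed
    moreover have fUV: "finite (U \<times> V)"
      unfolding U_def V_def
      by (intro finite_cartesian_product finite_subset[OF Collect_subset] finite_PiE) auto
    ultimately have "card (\<Phi> ` G) \<le> card (U \<times> V)" by (rule card_mono[rotated])
    then have "real (card (\<Phi> ` G)) \<le> real (card U) * real (card V)"
      by (simp add: card_cartesian_product flip: of_nat_mult)
    also have "\<dots> \<le> (2 * R + 1) ^ d * 6 ^ (n + 1)"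
    proof (intro mult_mono)
      have "real (card U) = (2 * real r + 1) ^ d" by (simp add: U_def card_PiE algebra_simps)
      also have "\<dots> \<le> (2 * R + 1) ^ d" using rR by (intro power_mono) auto
      finally show "real (card U) \<le> (2 * R + 1) ^ d" .
      have "real (card V) \<le> 3 ^ (n + 1) * 2 ^ card {..n}"
        unfolding V_def by (rule card_int_vectors_l1_le) simp
      then show "real (card V) \<le> 6 ^ (n + 1)"
        by (simp flip: power_mult_distrib)
    qed (use R0 in auto)
    also have "\<dots> < real b ^ (n + 1) / 2"
    proof -
      have "2 * R + 1 \<le> C' * real (n + 1) * \<rho> ^ n"
      proof -
        have "1 \<le> real (n + 1) * \<rho> ^ n" using mult_mono[of 1 "real (n + 1)" 1 "\<rho> ^ n"] one_le_power[OF \<rho>, of n] by simp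
        then show ?thesis by (simp add: R_def C'_def power_add algebra_simps)
      qed
      \<comment> \<open>The factors \<open>C'\<close> and \<open>n + 1\<close> are each absorbed
        into \<open>2 ^ (n + 1)\<close>, which is the origin of the 4 in
        \<open>4 * \<rho>\<close>.\<close>
      also have "\<dots> \<le> 2 ^ (n + 1) * 2 ^ (n + 1) * \<rho> ^ (n + 1)"
      proof (intro mult_mono)
        have two: "real (n + 1) \<le> 2 ^ (n + 1)"
          using less_exp[of "n + 1"] by (metis of_nat_le_iff of_nat_numeral of_nat_power order_less_imp_le)
        then show "real (n + 1) \<le> 2 ^ (n + 1)" .
        have "C' \<le> real n" using n by linarith
        then show "C' \<le> 2 ^ (n + 1)" using two by linarith
        show "\<rho> ^ n \<le> \<rho> ^ (n + 1)" using \<rho> by (intro power_increasing) auto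
      qed (use \<rho> in auto)
      also have "\<dots> = (4 * \<rho>) ^ (n + 1)"
        by (simp only: power_mult_distrib[symmetric]) simp
      finally have "(2 * R + 1) ^ d \<le> ((4 * \<rho>) ^ (n + 1)) ^ d"
        using R0 by (intro power_mono) auto
      then have 1: "(2 * R + 1) ^ d * 6 ^ (n + 1) \<le> (6 * (4 * \<rho>) ^ d) ^ (n + 1)"
        by (simp add: power_mult_distrib power_mult[symmetric] mult.commute)
      have "0 < (6 * (4 * \<rho>) ^ d) ^ (n + 1)" using \<rho> by simp
      then have "(6 * (4 * \<rho>) ^ d) ^ (n + 1) < 2 ^ n * (6 * (4 * \<rho>) ^ d) ^ (n + 1)"
        using n one_less_power[of "2::real" n] by (simp only: mult_less_cancel_right1) auto
      also have "\<dots> = (12 * (4 * \<rho>) ^ d) ^ (n + 1) / 2"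
      proof -
        have "(12 * (4 * \<rho>) ^ d) ^ (n + 1) = (2 * (6 * (4 * \<rho>) ^ d)) ^ (n + 1)"
          by (simp only: mult.assoc[symmetric]) simp
        also have "\<dots> = 2 ^ (n + 1) * (6 * (4 * \<rho>) ^ d) ^ (n + 1)" by (rule power_mult_distrib)
        finally show ?thesis by (metis nonzero_mult_div_cancel_left power_Suc Suc_eq_plus1 mult.assoc zero_neq_numeral)
      qed
      also have "\<dots> \<le> real b ^ (n + 1) / 2"
        using H12 \<rho> by (intro divide_right_mono power_mono) (auto simp: b_def)
      finally show ?thesis using 1 by linarith
    qed
    finally have "card (\<Phi> ` G) < card G" using cG by linarith
    then have "\<not> inj_on \<Phi> G" by (rule pigeonhole)
    then obtain q q' where qq: "q \<in> G" "q' \<in> G" "q \<noteq> q'" "\<Phi> q = \<Phi> q'"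
      by (auto simp: inj_on_def)
    obtain Q where Q: "degree Q \<le> n" "\<And>i. i \<le> n \<Longrightarrow> coeff Q i = q i - q' i"
      "\<And>u j. shift_act Q u j = (\<Sum>i\<le>n. (q i - q' i) * u (i + j))"
      using poly_of_coeffs[where n = n and q = "\<lambda>i. q i - q' i"] by blast
    have QY: "shift_act Q K j = Y q j - Y q' j" for j
      by (simp add: Q(3) Y_def algebra_simps sum_subtractf)
    have "\<exists>i\<le>n. q i \<noteq> q' i"
      using qq(1-3) PiE_ext[of q "{..n}" "\<lambda>_. B" q'] by (auto simp: G_def P_def)
    then have "Q \<noteq> 0" using Q(2) by fastforce
    moreover have "shift_act Q K j = 0" if "j \<le> n" for j
    \<comment> \<open>The sequence \<open>Y q - Y q'\<close> starts with \<open>d\<close> zeros, and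
      its defect is a difference of two reals with equal rounding.\<close>
    proof (rule int_recurrence_vanishes[OF g _ _ that])
      show "shift_act Q K j = 0" if "j < degree g" for j
        using qq(4) that by (auto simp: QY \<Phi>_def d_def restrict_def fun_eq_iff dest!: spec[of _ j])
      show "\<bar>shift_act g (\<lambda>i. of_int (shift_act Q K i)) j\<bar> < 1" if "j \<le> n" for j
      proof -
        have "round (W q j) = round (W q' j)"
          using qq(4) that by (auto simp: \<Phi>_def restrict_def fun_eq_iff split: if_splits dest!: spec[of _ j])
        then have "\<bar>W q j - W q' j\<bar> < 1" by (rule abs_diff_less_1_if_round_eq)
        then show ?thesis by (simp add: QY WY shift_act_seq_diff)
      qed
    qed
    ultimately show "\<exists>Q. Q \<noteq> 0 \<and> degree Q \<le> n \<and> (\<forall>j\<le>n. shift_act Q K j = 0)"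
      using Q(1) by blast
  qed
qed

lemma almost_linear_recurrent_int_sequence:
  fixes K :: "nat \<Rightarrow> int" and g :: "real poly"
  assumes "lead_coeff g = 1"
    and "summable (\<lambda>j. (shift_act g (\<lambda>i. of_int (K i)) j)\<^sup>2)"
    and "\<And>j. \<bar>real_of_int (K j)\<bar> \<le> C * \<rho> ^ j" and "\<rho> \<ge> 1"
  shows "\<exists>q. lead_coeff q = 1 \<and> (\<forall>j. shift_act q K j = 0)"
proof -
  obtain n0 where "\<forall>n\<ge>n0. \<exists>Q. Q \<noteq> 0 \<and> degree Q \<le> n \<and> (\<forall>j\<le>n. shift_act Q K j = 0)"
    using hankel_degenerate[OF assms] by blast
  then obtain Q where "Q \<noteq> 0" "\<And>j. shift_act Q K j = 0"
    using kronecker_rational[of n0 K] by blast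
  then show ?thesis by (rule fatou_monic)
qed

section \<open>The Fourier transform of a self-affine measure\<close>


definition orb :: "'a::comm_semiring_1^'n::finite^'n \<Rightarrow> 'a^'n \<Rightarrow> nat \<Rightarrow> 'a^'n" where
  "orb M v j = ((*v) M ^^ j) v"

lemma orb_0 [simp]: "orb M v 0 = v"
  by (simp add: orb_def)

lemma orb_Suc: "orb M v (Suc j) = M *v orb M v j"
  by (simp add: orb_def)

lemma orb_orb: "orb M (orb M v i) j = orb M v (i + j)"
  by (simp add: orb_def add.commute[of i j] funpow_add)

lemma orb_Suc_shift: "orb M (M *v v) j = orb M v (Suc j)"
  using orb_orb[of M v 1 j] by (simp add: orb_Suc)

lemma orb_inverse:
  assumes "M ** N = mat 1"
  shows "orb M (orb N v (i + j)) i = orb N v j"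
proof (induction i arbitrary: j)
  case (Suc i)
  have "orb M (orb N v (Suc i + j)) (Suc i) = orb M (M *v orb N v (Suc (i + j))) i"
    by (simp add: orb_Suc_shift)
  also have "M *v orb N v (Suc (i + j)) = orb N v (i + j)"
    by (simp add: orb_Suc matrix_vector_mul_assoc assms)
  finally show ?case by (simp add: Suc.IH)
qed simp

lemma orb_zero [simp]: "orb M 0 j = 0"
  by (induction j) (simp_all add: orb_Suc)

lemma continuous_orb: "continuous_on UNIV (\<lambda>v :: real^'n::finite. orb M v j)"
proof (induction j)
  case (Suc j)
  then show ?case
    unfolding orb_Suc by (rule linear_continuous_on_compose) simp
qed simp

section \<open>Characters, Fourier transforms and the refinement equation\<close>

definition echar :: "real \<Rightarrow> complex" where
  "echar t = exp (2 * of_real pi * \<i> * of_real t)"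

lemma echar_cis: "echar t = cis (2 * pi * t)"
  by (simp add: echar_def cis_conv_exp mult_ac)

lemma norm_echar [simp]: "norm (echar t) = 1"
  by (simp add: echar_cis)

lemma echar_add: "echar (s + t) = echar s * echar t"
  by (simp add: echar_cis cis_mult distrib_left)

lemma fourier_echar: "fourier \<nu> \<xi> = (\<integral>x. echar (\<xi> \<bullet> x) \<partial>\<nu>)"
  by (simp add: fourier_def echar_def)

lemma continuous_echar [continuous_intros]: "continuous_on S f \<Longrightarrow> continuous_on S (\<lambda>x. echar (f x))"
  unfolding echar_def by (intro continuous_intros)

lemma measurable_echar [measurable]: "echar \<in> borel_measurable borel"
  by (intro borel_measurable_continuous_onI continuous_echar continuous_on_id)

lemma measurable_echar_inner:
  fixes \<nu> :: "(real^'n::finite) measure"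
  assumes "sets \<nu> = sets borel"
  shows "(\<lambda>y. echar (x \<bullet> y)) \<in> borel_measurable \<nu>"
  by (subst measurable_cong_sets[OF assms refl])
    (intro borel_measurable_continuous_onI continuous_intros)

lemma norm_fourier_le_1:
  assumes "prob_space \<nu>"
  shows "norm (fourier \<nu> \<xi>) \<le> 1"
proof -
  interpret prob_space \<nu> by fact
  have "norm (fourier \<nu> \<xi>) \<le> (\<integral>x. norm (echar (\<xi> \<bullet> x)) \<partial>\<nu>)"
    unfolding fourier_echar by (rule integral_norm_bound)
  then show ?thesis by (simp add: prob_space)
qed

lemma tendsto_fourier:
  fixes \<nu> :: "(real^'n::finite) measure"
  assumes "prob_space \<nu>" and sets: "sets \<nu> = sets borel" and lim: "x \<longlonglongrightarrow> \<xi>"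
  shows "(\<lambda>k. fourier \<nu> (x k)) \<longlonglongrightarrow> fourier \<nu> \<xi>"
proof -
  interpret prob_space \<nu> by fact
  show ?thesis
    unfolding fourier_echar
  proof (rule integral_dominated_convergence[where w = "\<lambda>_. 1"])
    show "AE y in \<nu>. (\<lambda>k. echar (x k \<bullet> y)) \<longlonglongrightarrow> echar (\<xi> \<bullet> y)"
      unfolding echar_def by (intro AE_I2 tendsto_intros lim)
  qed (use sets in \<open>simp_all add: measurable_echar_inner\<close>)
qed

text \<open>Self-affinity is given for sets only. Integrals follow by recognising
  \<open>\<mu>\<close> as the law of \<open>A *v x + a l\<close> with \<open>l\<close> drawn by
  \<open>p\<close> independently of \<open>x\<close> drawn by \<open>\<mu>\<close>, and integrating
  in the two variables separately.\<close>

lemma integral_self_affine: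
  fixes A :: "real^'n::finite^'n" and f :: "real^'n \<Rightarrow> complex"
  assumes "self_affine_measure UNIV m A a p \<mu>" and p: "probability_vector m p"
    and f [measurable]: "f \<in> borel_measurable borel" and bound: "\<And>x. norm (f x) \<le> 1"
  shows "(\<integral>x. f x \<partial>\<mu>) = (\<Sum>l=1..m. of_real (p l) * (\<integral>x. f (A *v x + a l) \<partial>\<mu>))"
proof -
  have \<mu>: "prob_space \<mu>" "sets \<mu> = sets borel"
    and sa: "\<And>X. X \<in> sets borel \<Longrightarrow> measure \<mu> X = (\<Sum>l=1..m. p l * measure \<mu> (ifs_map A a l -` X))"
    using assms(1) by (auto simp: self_affine_measure_UNIV)
  interpret prob_space \<mu> by fact
  have [measurable_cong]: "sets \<mu> = sets borel" by fact
  have p0: "0 \<le> p l" if "l \<in> {1..m}" for l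
    using p that by (auto simp: probability_vector_def)
  define pm where "pm = point_measure {1..m} (\<lambda>l. ennreal (p l))"
  have spm [measurable_cong]: "sets pm = sets (count_space {1..m})"
    by (simp add: pm_def point_measure_def)
  have "finite_measure pm"
    by standard (simp add: pm_def space_point_measure emeasure_point_measure_finite)
  then interpret pm: finite_measure pm .
  interpret P: pair_sigma_finite pm \<mu> ..
  interpret F: finite_measure "pm \<Otimes>\<^sub>M \<mu>"
    by (rule finite_measure_pair_measure) unfold_locales
  define g where "g = (\<lambda>(l, x). A *v x + a l)"
  have "(\<lambda>x. A *v x + a l) \<in> borel_measurable borel" for l
    by (intro borel_measurable_continuous_onI continuous_intros linear_continuous_on) simp
  note this [measurable]
  have "g \<in> count_space {1..m} \<Otimes>\<^sub>M \<mu> \<rightarrow>\<^sub>M borel"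
    by (rule measurable_pair_measure_countable1) (auto simp: g_def)
  then have g [measurable]: "g \<in> pm \<Otimes>\<^sub>M \<mu> \<rightarrow>\<^sub>M borel"
    by (simp cong: measurable_cong_sets sets_pair_measure_cong add: spm)
  have "distr (pm \<Otimes>\<^sub>M \<mu>) borel g = \<mu>"
  proof (rule measure_eqI)
    fix X assume "X \<in> sets (distr (pm \<Otimes>\<^sub>M \<mu>) borel g)"
    then have X [measurable]: "X \<in> sets borel" by simp
    have "emeasure (distr (pm \<Otimes>\<^sub>M \<mu>) borel g) X
        = (\<integral>\<^sup>+ l. emeasure \<mu> (Pair l -` (g -` X \<inter> space (pm \<Otimes>\<^sub>M \<mu>))) \<partial>pm)"
      by (subst emeasure_distr) (simp_all add: emeasure_pair_measure_alt)
    also have "\<dots> = (\<Sum>l\<in>{1..m}. p l * emeasure \<mu> (Pair l -` (g -` X \<inter> space (pm \<Otimes>\<^sub>M \<mu>))))"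
      unfolding pm_def by (subst nn_integral_point_measure_finite) (auto simp: mult.commute)
    also have "\<dots> = (\<Sum>l\<in>{1..m}. ennreal (p l * measure \<mu> (ifs_map A a l -` X)))"
    proof (rule sum.cong)
      fix l assume l: "l \<in> {1..m}"
      have "Pair l -` (g -` X \<inter> space (pm \<Otimes>\<^sub>M \<mu>)) = ifs_map A a l -` X"
        using l sets_eq_imp_space_eq[OF \<mu>(2)] sets_eq_imp_space_eq[OF spm]
        by (auto simp: g_def ifs_map_def space_pair_measure)
      then show "p l * emeasure \<mu> (Pair l -` (g -` X \<inter> space (pm \<Otimes>\<^sub>M \<mu>)))
          = ennreal (p l * measure \<mu> (ifs_map A a l -` X))"
        using p0[OF l] by (simp add: emeasure_eq_measure ennreal_mult)
    qed simp
    also have "\<dots> = emeasure \<mu> X"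
      using p0 by (subst sum_ennreal) (auto simp: emeasure_eq_measure sa)
    finally show "emeasure (distr (pm \<Otimes>\<^sub>M \<mu>) borel g) X = emeasure \<mu> X" .
  qed (simp add: \<mu>)
  then have "(\<integral>x. f x \<partial>\<mu>) = (\<integral>x. f x \<partial>distr (pm \<Otimes>\<^sub>M \<mu>) borel g)" by simp
  also have "\<dots> = (\<integral>z. f (g z) \<partial>(pm \<Otimes>\<^sub>M \<mu>))"
    by (rule integral_distr) auto
  also have "\<dots> = (\<integral>l. (\<integral>x. f (g (l, x)) \<partial>\<mu>) \<partial>pm)"
  proof (rule P.integral_fst'[symmetric])
    show "integrable (pm \<Otimes>\<^sub>M \<mu>) (\<lambda>z. f (g z))"
      by (rule F.integrable_const_bound[where B = 1]) (auto intro: bound)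
  qed
  also have "\<dots> = (\<Sum>l=1..m. of_real (p l) * (\<integral>x. f (A *v x + a l) \<partial>\<mu>))"
    unfolding pm_def using p0
    by (subst lebesgue_integral_point_measure_finite) (auto simp: g_def scaleR_conv_of_real)
  finally show ?thesis .
qed

text \<open>The Fourier transform of the discrete measure with mass \<open>p l\<close> at
  \<open>a l\<close>.\<close>

definition trig_mask :: "nat \<Rightarrow> (nat \<Rightarrow> real^'n::finite) \<Rightarrow> (nat \<Rightarrow> real) \<Rightarrow> real^'n \<Rightarrow> complex" where
  "trig_mask m a p \<xi> = (\<Sum>l=1..m. of_real (p l) * echar (\<xi> \<bullet> a l))"

lemma fourier_self_affine:
  fixes A :: "real^'n::finite^'n"
  assumes "self_affine_measure UNIV m A a p \<mu>" and p: "probability_vector m p"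
  shows "fourier \<mu> \<xi> = trig_mask m a p \<xi> * fourier \<mu> (transpose A *v \<xi>)"
proof -
  have "fourier \<mu> \<xi> = (\<Sum>l=1..m. of_real (p l) * (\<integral>x. echar (\<xi> \<bullet> (A *v x + a l)) \<partial>\<mu>))"
    unfolding fourier_echar by (rule integral_self_affine[OF assms]) auto
  also have "\<dots> = (\<Sum>l=1..m. of_real (p l) * echar (\<xi> \<bullet> a l) * fourier \<mu> (transpose A *v \<xi>))"
    by (simp add: inner_add_right echar_add fourier_echar dot_lmul_matrix
        transpose_matrix_vector mult_ac)
  finally show ?thesis by (simp add: trig_mask_def sum_distrib_right)
qed

lemma norm_trig_mask_le_1:
  assumes "probability_vector m p"
  shows "norm (trig_mask m a p \<xi>) \<le> 1"
proof -
  have "norm (trig_mask m a p \<xi>) \<le> (\<Sum>l=1..m. norm (of_real (p l) * echar (\<xi> \<bullet> a l)))"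
    unfolding trig_mask_def by (rule norm_sum)
  also have "\<dots> = (\<Sum>l=1..m. p l)"
    using assms by (intro sum.cong) (auto simp: probability_vector_def norm_mult)
  finally show ?thesis using assms by (simp add: probability_vector_def)
qed

text \<open>Squaring gives \<open>(p + q)\<^sup>2 - 2 * p * q * (1 - c)\<close> with
  \<open>c\<close> the cosine; multiplying the correction by \<open>p + q \<le> 1\<close> turns this
  into the first two terms of a complete square.\<close>

lemma norm_two_term_le:
  fixes p q s t :: real
  assumes "0 \<le> p" "0 \<le> q" "p + q \<le> 1"
  shows "norm (of_real p * echar s + of_real q * echar t) \<le> p + q - p * q * (1 - cos (2 * pi * (t - s)))"
proof (rule power2_le_imp_le)
  define c where "c = cos (2 * pi * (t - s))"
  have c: "c \<le> 1" "-1 \<le> c" by (simp_all add: c_def)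
  have cc: "cos (2 * pi * s) * cos (2 * pi * t) + sin (2 * pi * s) * sin (2 * pi * t) = c"
    by (simp add: c_def right_diff_distrib cos_diff mult_ac add_ac)
  have "(norm (of_real p * echar s + of_real q * echar t))\<^sup>2
      = p\<^sup>2 * ((cos (2 * pi * s))\<^sup>2 + (sin (2 * pi * s))\<^sup>2) + q\<^sup>2 * ((cos (2 * pi * t))\<^sup>2 + (sin (2 * pi * t))\<^sup>2)
        + 2 * p * q * (cos (2 * pi * s) * cos (2 * pi * t) + sin (2 * pi * s) * sin (2 * pi * t))"
    unfolding cmod_power2 by (simp add: echar_cis power2_eq_square algebra_simps
      del: sin_cos_squared_add sin_cos_squared_add2 sin_cos_squared_add3)
  also have "\<dots> = p\<^sup>2 + q\<^sup>2 + 2 * p * q * c"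
    unfolding cc sin_cos_squared_add2 by simp
  also have "\<dots> = (p + q)\<^sup>2 - 2 * (p * q * (1 - c))"
    by (simp add: power2_eq_square algebra_simps)
  also have "\<dots> \<le> (p + q)\<^sup>2 - 2 * (p + q) * (p * q * (1 - c))"
  proof -
    have "(p + q) * (p * q * (1 - c)) \<le> 1 * (p * q * (1 - c))"
      using assms c by (intro mult_right_mono) auto
    then show ?thesis by linarith
  qed
  also have "\<dots> \<le> (p + q - p * q * (1 - c))\<^sup>2"
    by (simp add: power2_diff)
  finally show "(norm (of_real p * echar s + of_real q * echar t))\<^sup>2
      \<le> (p + q - p * q * (1 - cos (2 * pi * (t - s))))\<^sup>2"
    by (simp add: c_def)
  have "p * q * (1 - c) \<le> p * q * 2" using assms c by (intro mult_left_mono) auto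
  also have "p * q * 2 \<le> p + q"
    using mult_left_mono[of q 1 p] mult_right_mono[of p 1 q] assms by simp
  finally show "0 \<le> p + q - p * q * (1 - cos (2 * pi * (t - s)))" by (simp add: c_def)
qed

text \<open>The terms other than 1 and \<open>l\<close> are bounded by their weights, so the loss
  comes from the phase difference of a single pair; this is how the differences
  \<open>a l - a 1\<close> enter.\<close>

lemma trig_mask_defect:
  assumes p: "probability_vector m p" and l: "l \<in> {1..m}"
  shows "p 1 * p l * (1 - cos (2 * pi * (\<xi> \<bullet> (a l - a 1)))) \<le> 1 - norm (trig_mask m a p \<xi>)"
proof (cases "l = 1")
  case True
  then show ?thesis using norm_trig_mask_le_1[OF p] by simp
next
  case False
  have p0: "0 \<le> p k" if "k \<in> {1..m}" for k
    using p that by (auto simp: probability_vector_def)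
  have 1: "1 \<in> {1..m}" using l by simp
  define R where "R = {1..m} - {1, l}"
  have split: "(\<Sum>k=1..m. h k) = h 1 + h l + (\<Sum>k\<in>R. h k)" for h :: "nat \<Rightarrow> 'b::comm_monoid_add"
  proof -
    have "{1..m} = insert 1 (insert l R)" using l 1 by (auto simp: R_def)
    moreover have "finite R" "1 \<notin> R" "l \<notin> R" by (auto simp: R_def)
    ultimately show ?thesis using False by (simp add: add.assoc)
  qed
  have "norm (trig_mask m a p \<xi>) \<le> norm (of_real (p 1) * echar (\<xi> \<bullet> a 1) + of_real (p l) * echar (\<xi> \<bullet> a l))
      + norm (\<Sum>k\<in>R. of_real (p k) * echar (\<xi> \<bullet> a k))"
    unfolding trig_mask_def split by (rule norm_triangle_ineq)
  also have "norm (\<Sum>k\<in>R. of_real (p k) * echar (\<xi> \<bullet> a k)) \<le> (\<Sum>k\<in>R. norm (of_real (p k) * echar (\<xi> \<bullet> a k)))"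
    by (rule norm_sum)
  also have "\<dots> = (\<Sum>k\<in>R. p k)"
    using p0 by (intro sum.cong) (auto simp: norm_mult R_def)
  also have sR: "\<dots> = 1 - p 1 - p l"
    using p split[of p] by (simp add: probability_vector_def)
  also have "norm (of_real (p 1) * echar (\<xi> \<bullet> a 1) + of_real (p l) * echar (\<xi> \<bullet> a l))
      \<le> p 1 + p l - p 1 * p l * (1 - cos (2 * pi * (\<xi> \<bullet> a l - \<xi> \<bullet> a 1)))"
  proof (rule norm_two_term_le)
    have "0 \<le> (\<Sum>k\<in>R. p k)" using p0 by (intro sum_nonneg) (auto simp: R_def)
    then show "p 1 + p l \<le> 1" using sR by simp
  qed (use p0 l 1 in auto)
  finally show ?thesis by (simp add: inner_diff_right)
qed

text \<open>With \<open>z = \<bar>y\<bar> / 2\<close> one has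
  \<open>1 - cos y = 2 * (sin z)\<^sup>2\<close>, and \<open>sin z \<ge> z / 2\<close> by the Taylor
  remainder of order three; 1.6 exceeds \<open>pi / 2\<close> and its square is below 3.\<close>

lemma one_minus_cos_ge:
  fixes y :: real
  assumes "\<bar>y\<bar> \<le> pi"
  shows "y\<^sup>2 / 8 \<le> 1 - cos y"
proof -
  define z where "z = \<bar>y\<bar> / 2"
  have z: "0 \<le> z" "z \<le> 1.6" using assms pi_less_4 pi_approx by (auto simp: z_def)
  have "\<bar>sin z - (\<Sum>m<3. sin_coeff m * z ^ m)\<bar> \<le> inverse (fact 3) * \<bar>z\<bar> ^ 3"
    by (rule Maclaurin_sin_bound)
  then have "z - z ^ 3 / 6 \<le> sin z"
    using z by (simp add: eval_nat_numeral sin_coeff_def abs_le_iff)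
      (simp add: abs_if field_simps split: if_splits)
  moreover have "z ^ 3 / 6 \<le> z / 2"
  proof -
    have "z * z \<le> 1.6 * 1.6" using z by (intro mult_mono) auto
    then have "z * z * z \<le> 3 * z" using z by (intro mult_right_mono) auto
    then show ?thesis by (simp add: power3_eq_cube)
  qed
  ultimately have "z / 2 \<le> sin z" by simp
  then have "(z / 2)\<^sup>2 \<le> (sin z)\<^sup>2" using z by (intro power_mono) auto
  moreover have "cos y = 1 - 2 * (sin z)\<^sup>2"
    using cos_double_sin[of z] by (simp add: z_def)
  ultimately show ?thesis by (simp add: z_def power_divide)
qed

lemma round_error_square_le:
  fixes x :: real
  shows "(x - of_int (round x))\<^sup>2 \<le> 1 - cos (2 * pi * x)"
proof -
  define e where "e = x - of_int (round x)"
  have e: "\<bar>e\<bar> \<le> 1/2" using of_int_round_abs_le[of x] by (simp add: e_def abs_minus_commute)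
  have "cos (2 * pi * x) = cos (2 * pi * e + 2 * pi * of_int (round x))"
    by (simp add: e_def algebra_simps)
  also have "\<dots> = cos (2 * pi * e)"
    using sin_int_2pin[of "round x"] cos_int_2pin[of "round x"] by (simp add: cos_add)
  finally have c: "cos (2 * pi * x) = cos (2 * pi * e)" .
  have "\<bar>2 * pi * e\<bar> \<le> pi" using e by (simp add: abs_mult)
  then have "(2 * pi * e)\<^sup>2 / 8 \<le> 1 - cos (2 * pi * x)"
    unfolding c by (rule one_minus_cos_ge)
  moreover have "e\<^sup>2 \<le> (2 * pi * e)\<^sup>2 / 8"
  proof -
    have "8 \<le> (2 * pi)\<^sup>2" using pi_gt3 by (simp add: power2_eq_square mult_mono[of 3 pi 3 pi, simplified] order_trans[of _ "36"])
    then have "8 * e\<^sup>2 \<le> (2 * pi)\<^sup>2 * e\<^sup>2" by (intro mult_right_mono) auto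
    then show ?thesis by (simp add: power_mult_distrib)
  qed
  ultimately show ?thesis by (simp add: e_def)
qed

section \<open>Orbits of linear maps\<close>


text \<open>This is \<open>f(M) v\<close>, read off coordinatewise from \<open>shift_act\<close>, so
  that facts on sequences transfer without powers of \<open>M\<close>.\<close>

definition poly_orb :: "'a::comm_ring_1 poly \<Rightarrow> 'a^'n::finite^'n \<Rightarrow> 'a^'n \<Rightarrow> 'a^'n" where
  "poly_orb f M v = (\<chi> i. shift_act f (\<lambda>k. orb M v k $ i) 0)"

lemma orb_poly_orb: "orb M (poly_orb f M v) j $ i = shift_act f (\<lambda>k. orb M v k $ i) j"
proof (induction j arbitrary: i)
  case (Suc j)
  have "orb M (poly_orb f M v) (Suc j) $ i
      = (\<Sum>c\<in>UNIV. M $ i $ c * (\<Sum>k\<le>degree f. coeff f k * orb M v (k + j) $ c))"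
    by (simp add: orb_Suc matrix_vector_mult_def Suc.IH shift_act_def)
  also have "\<dots> = (\<Sum>k\<le>degree f. coeff f k * (\<Sum>c\<in>UNIV. M $ i $ c * orb M v (k + j) $ c))"
    by (simp add: sum_distrib_left sum.swap[of _ UNIV] mult_ac)
  also have "\<dots> = shift_act f (\<lambda>k. orb M v k $ i) (Suc j)"
    by (simp add: shift_act_def orb_Suc matrix_vector_mult_def)
  finally show ?case .
qed (simp add: poly_orb_def)

lemma poly_orb_mult: "poly_orb (f * g) M v = poly_orb f M (poly_orb g M v)"
  by (simp add: poly_orb_def vec_eq_iff shift_act_mult orb_poly_orb[unfolded poly_orb_def])

lemma poly_orb_const [simp]: "poly_orb [:c:] M v = c *s v"
  by (simp add: poly_orb_def vec_eq_iff)

lemma poly_orb_linear_factor: "poly_orb [:- c, 1:] M v = M *v v - c *s v"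
  by (simp add: poly_orb_def vec_eq_iff orb_Suc)

lemma poly_orb_zero [simp]: "poly_orb f M 0 = 0"
  by (simp add: poly_orb_def vec_eq_iff shift_act_eq_0)

text \<open>\<open>CARD('n) + 1\<close> orbit vectors cannot be independent. A repetition in the
  orbit is treated apart, because a relation on the set of vectors would not tell the exponents
  apart.\<close>

lemma ex_annihilating_poly:
  fixes M :: "'a::field^'n::finite^'n"
  shows "\<exists>f. f \<noteq> 0 \<and> poly_orb f M v = 0"
proof (cases "inj_on (orb M v) {..CARD('n)}")
  case False
  then obtain i j where ij: "i \<noteq> j" "orb M v i = orb M v j" by (auto simp: inj_on_def)
  have "coeff (monom 1 i - monom 1 j :: 'a poly) i = 1" using ij by simp
  then have "monom 1 i - monom 1 j \<noteq> (0 :: 'a poly)" by force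
  moreover have "poly_orb (monom 1 i - monom 1 j) M v = 0"
    using ij by (simp add: poly_orb_def vec_eq_iff shift_act_diff)
  ultimately show ?thesis by blast
next
  case True
  let ?S = "orb M v ` {..CARD('n)}"
  have "card ?S = CARD('n) + 1" using True by (simp add: card_image)
  then have "vec.dependent ?S"
    by (intro vec.dependent_biggerset_general)
      (simp add: le_imp_less_Suc dim_subset_UNIV_cart_gen)
  then obtain u where u: "\<exists>w\<in>?S. u w \<noteq> 0" "(\<Sum>w\<in>?S. u w *s w) = 0"
    by (subst (asm) vec.dependent_finite) auto
  obtain f where f: "degree f \<le> CARD('n)" "\<And>i. i \<le> CARD('n) \<Longrightarrow> coeff f i = u (orb M v i)"
    "\<And>w j. shift_act f w j = (\<Sum>i\<le>CARD('n). u (orb M v i) * w (i + j))"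
    using poly_of_coeffs[where n = "CARD('n)" and q = "\<lambda>i. u (orb M v i)"] by blast
  have "f \<noteq> 0" using u(1) f(2) by force
  moreover have "poly_orb f M v = (\<Sum>w\<in>?S. u w *s w)"
    unfolding sum.reindex[OF True] by (simp add: poly_orb_def vec_eq_iff f(3))
  ultimately show ?thesis using u(2) by auto
qed

lemma perturbed_contraction_tendsto_0:
  fixes w :: "nat \<Rightarrow> complex"
  assumes lim: "(\<lambda>n. w (Suc n) - c * w n) \<longlonglongrightarrow> 0" and c: "norm c < 1"
  shows "w \<longlonglongrightarrow> 0"
proof (rule LIMSEQ_I)
  fix r :: real assume r: "r > 0"
  \<comment> \<open>Chosen so that \<open>r / 2\<close> is the fixed point of the map sending
    \<open>t\<close> to \<open>norm c * t + s\<close>.\<close>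
  define s where "s = r / 2 * (1 - norm c)"
  have "s > 0" using r c by (simp add: s_def)
  then obtain N where N: "\<And>n. n \<ge> N \<Longrightarrow> norm (w (Suc n) - c * w n) < s"
    using LIMSEQ_D[OF lim, of s] by auto
  have bound: "norm (w (N + k)) \<le> norm c ^ k * norm (w N) + r / 2" for k
  proof (induction k)
    case (Suc k)
    have "norm (w (N + Suc k)) \<le> norm (w (Suc (N + k)) - c * w (N + k)) + norm (c * w (N + k))"
      using norm_triangle_ineq[of "w (Suc (N + k)) - c * w (N + k)" "c * w (N + k)"] by simp
    also have "\<dots> \<le> s + norm c * (norm c ^ k * norm (w N) + r / 2)"
      using N[of "N + k"] Suc by (intro add_mono) (auto simp: norm_mult mult_left_mono)
    also have "\<dots> = norm c ^ Suc k * norm (w N) + r / 2"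
      by (simp add: s_def field_simps)
    finally show ?case .
  qed (use r in simp)
  have "(\<lambda>k. norm c ^ k * norm (w N)) \<longlonglongrightarrow> 0 * norm (w N)"
    using c by (intro tendsto_intros LIMSEQ_power_zero) auto
  then obtain K where K: "\<And>k. k \<ge> K \<Longrightarrow> norm c ^ k * norm (w N) < r / 2"
    using r LIMSEQ_D[of "\<lambda>k. norm c ^ k * norm (w N)" 0 "r / 2"] by (auto simp: abs_mult)
  show "\<exists>n0. \<forall>n\<ge>n0. norm (w n - 0) < r"
  proof (intro exI allI impI)
    fix n assume "n \<ge> N + K"
    then obtain k where "n = N + k" "k \<ge> K"
      by (metis add_leD1 le_Suc_ex nat_add_left_cancel_le)
    then show "norm (w n - 0) < r" using bound[of k] K[of k] by simp
  qed
qed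

text \<open>Induction on an annihilator of \<open>v\<close>, splitting off a root \<open>c\<close>.
  If \<open>norm c < 1\<close>, the decay of the orbit of \<open>M *v v - c *s v\<close> passes to
  that of \<open>v\<close>; otherwise \<open>c\<close> is no eigenvalue, so the remaining factor
  already annihilates \<open>v\<close>. This replaces Jordan blocks.\<close>

lemma orb_tendsto_0_if_eigenvalues:
  fixes M :: "complex^'n::finite^'n"
  assumes ev: "\<And>c z. z \<noteq> 0 \<Longrightarrow> M *v z = c *s z \<Longrightarrow> norm c < 1"
  shows "(\<lambda>j. orb M v j $ i) \<longlonglongrightarrow> 0"
proof -
  have "(\<lambda>j. orb M v j $ i) \<longlonglongrightarrow> 0" if "f \<noteq> 0" "poly_orb f M v = 0" for f v
    using that
  proof (induction "degree f" arbitrary: f v)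
    case 0
    then obtain a where "f = [:a:]" "a \<noteq> 0" by (metis degree_eq_zeroE pCons_0_0)
    with 0 have "v = 0" by (simp add: vec_eq_iff)
    then show ?case by simp
  next
    case (Suc n)
    obtain c where "poly f c = 0"
      using alg_closed_imp_poly_has_root[of f] Suc.hyps(2) by auto
    then obtain g where g: "f = [:- c, 1:] * g" by (auto simp: poly_eq_0_iff_dvd elim: dvdE)
    have g0: "g \<noteq> 0" using g Suc.prems by auto
    have "degree f = Suc (degree g)" unfolding g using g0 by (subst degree_mult_eq) auto
    then have dg: "n = degree g" using Suc.hyps by simp
    show ?case
    proof (cases "norm c < 1")
      case True
      let ?v = "poly_orb [:- c, 1:] M v"
      have "poly_orb g M ?v = 0"
        using Suc.prems(2) unfolding g by (simp add: poly_orb_mult[symmetric] mult.commute)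
      then have "(\<lambda>j. orb M ?v j $ i) \<longlonglongrightarrow> 0" by (rule Suc.hyps(1)[OF dg g0])
      then have "(\<lambda>j. orb M v (Suc j) $ i - c * orb M v j $ i) \<longlonglongrightarrow> 0"
        by (simp add: orb_poly_orb)
      then show ?thesis using True by (rule perturbed_contraction_tendsto_0)
    next
      case False
      have "poly_orb [:- c, 1:] M (poly_orb g M v) = 0"
        using Suc.prems(2) unfolding g poly_orb_mult .
      then have "poly_orb g M v = 0"
        using ev[of "poly_orb g M v" c] False by (auto simp: poly_orb_linear_factor)
      then show ?thesis by (rule Suc.hyps(1)[OF dg g0])
    qed
  qed
  then show ?thesis using ex_annihilating_poly[of M v] by blast
qed

text \<open>A real supremum carries information only over a set bounded above; the bound comes from
  a coordinate of the eigenvector of largest modulus.\<close>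

lemma spectrum_bounded:
  fixes M :: "complex^'n::finite^'n"
  assumes "c \<in> spectrum M"
  shows "norm c \<le> (\<Sum>i\<in>UNIV. \<Sum>k\<in>UNIV. norm (M $ i $ k))"
proof -
  obtain z where z: "z \<noteq> 0" "M *v z = c *s z" using assms by (auto simp: spectrum_def)
  obtain i where i: "\<And>k. norm (z $ k) \<le> norm (z $ i)"
  proof -
    have "finite (range (\<lambda>k. norm (z $ k)))" by simp
    then have "Max (range (\<lambda>k. norm (z $ k))) \<in> range (\<lambda>k. norm (z $ k))"
      by (intro Max_in) auto
    then obtain i where i: "Max (range (\<lambda>k. norm (z $ k))) = norm (z $ i)" by (rule imageE)
    show thesis by (rule that[of i]) (simp flip: i)
  qed
  have zi: "norm (z $ i) > 0"
  proof (rule ccontr)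
    assume "\<not> norm (z $ i) > 0"
    then have "z = 0" using i by (simp add: vec_eq_iff)
    then show False using z(1) by simp
  qed
  have "norm c * norm (z $ i) = norm ((M *v z) $ i)"
    by (simp add: z(2) norm_mult)
  also have "\<dots> \<le> (\<Sum>k\<in>UNIV. norm (M $ i $ k * z $ k))"
    unfolding matrix_vector_mult_def by (simp add: norm_sum)
  also have "\<dots> \<le> (\<Sum>k\<in>UNIV. norm (M $ i $ k) * norm (z $ i))"
    by (intro sum_mono) (simp add: norm_mult mult_left_mono i)
  also have "\<dots> = (\<Sum>k\<in>UNIV. norm (M $ i $ k)) * norm (z $ i)"
    by (simp add: sum_distrib_right)
  also have "\<dots> \<le> (\<Sum>i\<in>UNIV. \<Sum>k\<in>UNIV. norm (M $ i $ k)) * norm (z $ i)"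
    by (intro mult_right_mono member_le_sum) (auto intro: sum_nonneg)
  finally show ?thesis using zi by simp
qed

lemma eigenvalue_less_1:
  fixes A :: "real^'n::finite^'n"
  assumes "spectral_radius A < 1" "z \<noteq> 0" "map_matrix complex_of_real A *v z = c *s z"
  shows "norm c < 1"
proof -
  have c: "c \<in> spectrum (map_matrix complex_of_real A)" using assms by (auto simp: spectrum_def)
  have "bdd_above (norm ` spectrum (map_matrix complex_of_real A))"
    using spectrum_bounded by (intro bdd_aboveI2) blast
  then have "norm c \<le> spectral_radius A"
    unfolding spectral_radius_def by (rule cSUP_upper2[OF _ c]) simp
  then show ?thesis using assms(1) by simp
qed

lemma cvec_of_real_nth [simp]: "cvec_of_real x $ i = complex_of_real (x $ i)"
  by (simp add: cvec_of_real_def)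

lemma cvec_of_real_matrix_mult:
  "cvec_of_real (M *v x) = map_matrix complex_of_real M *v cvec_of_real x"
  by (simp add: vec_eq_iff matrix_vector_mult_def map_matrix_def)

lemma cvec_of_real_orb:
  "cvec_of_real (orb M x j) = orb (map_matrix complex_of_real M) (cvec_of_real x) j"
  by (induction j) (simp_all add: orb_Suc cvec_of_real_matrix_mult)

lemma cvec_of_real_eq_0_iff [simp]: "cvec_of_real x = 0 \<longleftrightarrow> x = 0"
  by (simp add: vec_eq_iff)

lemma orb_real_tendsto_0:
  fixes A :: "real^'n::finite^'n"
  assumes "spectral_radius A < 1"
  shows "orb A v \<longlonglongrightarrow> 0"
proof (rule vec_tendstoI)
  fix i
  have "(\<lambda>j. orb (map_matrix complex_of_real A) (cvec_of_real v) j $ i) \<longlonglongrightarrow> 0"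
    using eigenvalue_less_1[OF assms] by (rule orb_tendsto_0_if_eigenvalues)
  then have "(\<lambda>j. complex_of_real (orb A v j $ i)) \<longlonglongrightarrow> complex_of_real 0"
    by (simp flip: cvec_of_real_orb)
  then show "(\<lambda>j. orb A v j $ i) \<longlonglongrightarrow> 0 $ i"
    unfolding tendsto_of_real_iff by simp
qed

text \<open>Bilinear rather than sesquilinear: on real second arguments it agrees with
  \<open>cinner\<close>, and real transposes move across it.\<close>

definition rpair :: "complex^'n::finite \<Rightarrow> real^'n \<Rightarrow> complex" where
  "rpair z w = (\<Sum>i\<in>UNIV. z $ i * of_real (w $ i))"

lemma cinner_cvec_of_real: "cinner z (cvec_of_real w) = rpair z w"
  by (simp add: cinner_def rpair_def)

lemma rpair_cvec_of_real: "rpair (cvec_of_real x) w = of_real (x \<bullet> w)"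
  by (simp add: rpair_def inner_vec_def)

lemma rpair_add_right: "rpair z (v + w) = rpair z v + rpair z w"
  by (simp add: rpair_def distrib_left sum.distrib)

lemma rpair_scaleR_right: "rpair z (c *\<^sub>R w) = of_real c * rpair z w"
  by (simp add: rpair_def sum_distrib_left mult_ac)

lemma rpair_zero_right [simp]: "rpair z 0 = 0"
  by (simp add: rpair_def)

lemma rpair_zero_left [simp]: "rpair 0 w = 0"
  by (simp add: rpair_def)

lemma rpair_smult_left: "rpair (c *s z) w = c * rpair z w"
  by (simp add: rpair_def sum_distrib_left mult_ac)

lemma rpair_axis [simp]: "rpair z (axis i 1) = z $ i"
  by (simp add: rpair_def axis_def if_distrib[where f = "\<lambda>x. z $ _ * complex_of_real x"] cong: if_cong)

lemma rpair_transpose: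
  "rpair (map_matrix complex_of_real (transpose M) *v z) w = rpair z (M *v w)"
proof -
  have "rpair (map_matrix complex_of_real (transpose M) *v z) w
      = (\<Sum>i\<in>UNIV. \<Sum>k\<in>UNIV. of_real (M $ k $ i) * z $ k * of_real (w $ i))"
    by (simp add: rpair_def matrix_vector_mult_def map_matrix_def transpose_def sum_distrib_right)
  also have "\<dots> = (\<Sum>k\<in>UNIV. \<Sum>i\<in>UNIV. of_real (M $ k $ i) * z $ k * of_real (w $ i))"
    by (rule sum.swap)
  also have "\<dots> = rpair z (M *v w)"
    by (simp add: rpair_def matrix_vector_mult_def sum_distrib_left mult_ac)
  finally show ?thesis .
qed

lemma rpair_orb_transpose:
  "rpair (orb (map_matrix complex_of_real (transpose M)) z j) w = rpair z (orb M w j)"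
proof (induction j arbitrary: w)
  case (Suc j)
  show ?case
    by (simp add: orb_Suc rpair_transpose Suc.IH orb_Suc_shift)
qed simp

lemma rpair_poly_orb:
  "rpair (orb M (poly_orb f M v) j) w = shift_act f (\<lambda>k. rpair (orb M v k) w) j"
  unfolding rpair_def shift_act_seq_sum
  by (simp add: orb_poly_orb shift_act_seq_cmult[of f "of_real _"] mult.commute[of _ "of_real _"])

lemma tendsto_rpair:
  assumes "x \<longlonglongrightarrow> l"
  shows "(\<lambda>k. rpair z (x k)) \<longlonglongrightarrow> rpair z l"
  unfolding rpair_def by (intro tendsto_intros assms)

section \<open>The inverse transpose and affine irreducibility\<close>

locale irreducible_ifs =
  fixes A :: "real^'n::finite^'n" and a :: "nat \<Rightarrow> real^'n" and m :: nat
  assumes hom: "homogeneous_affine_ifs UNIV m A a" and irr: "affinely_irreducible m A a"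
begin

definition "C = (SOME C. A ** C = mat 1 \<and> C ** A = mat 1)"
definition "B = transpose C"
abbreviation "Bc \<equiv> map_matrix complex_of_real B"
abbreviation "Tc \<equiv> map_matrix complex_of_real (transpose A)"
definition "d l = a l - a 1"

lemma m1: "1 \<le> m" and invertible_A: "invertible A" and radius: "spectral_radius A < 1"
  using hom by (auto simp: homogeneous_affine_ifs_UNIV)

lemma AC: "A ** C = mat 1" and CA: "C ** A = mat 1"
  using someI_ex[OF invertible_A[unfolded invertible_def]] by (simp_all add: C_def)

lemma BT: "B ** transpose A = mat 1" and TB: "transpose A ** B = mat 1"
  using AC CA by (simp_all add: B_def transpose_mat flip: matrix_transpose_mul)

lemma BcTc: "Bc ** Tc = mat 1" and TcBc: "Tc ** Bc = mat 1"
proof -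
  have "Bc ** Tc = map_matrix complex_of_real (B ** transpose A)"
    "Tc ** Bc = map_matrix complex_of_real (transpose A ** B)"
    by (simp_all add: vec_eq_iff map_matrix_def matrix_matrix_mult_def)
  then show "Bc ** Tc = mat 1" "Tc ** Bc = mat 1"
    by (simp_all add: BT TB vec_eq_iff map_matrix_def mat_def)
qed

lemma orb_A_tendsto: "orb A v \<longlonglongrightarrow> 0"
  by (rule orb_real_tendsto_0[OF radius])

lemma inner_orb_transpose: "orb (transpose M) v j \<bullet> w = v \<bullet> orb M w j"
  for M :: "real^'n^'n"
proof (induction j arbitrary: w)
  case (Suc j)
  have "orb (transpose M) v (Suc j) \<bullet> w = orb (transpose M) v j \<bullet> (M *v w)"
    by (simp add: orb_Suc dot_lmul_matrix transpose_matrix_vector)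
  then show ?case by (simp add: Suc.IH orb_Suc_shift)
qed simp

text \<open>The coordinates of this orbit are pairings of \<open>v\<close> with orbits of
  \<open>A\<close>; this bypasses a comparison of the spectra of \<open>A\<close> and its
  transpose.\<close>

lemma orb_T_tendsto: "orb (transpose A) v \<longlonglongrightarrow> 0"
proof (rule vec_tendstoI)
  fix i
  have "(\<lambda>j. v \<bullet> orb A (axis i 1) j) \<longlonglongrightarrow> v \<bullet> 0"
    by (intro tendsto_intros orb_A_tendsto)
  then show "(\<lambda>j. orb (transpose A) v j $ i) \<longlonglongrightarrow> 0 $ i"
    by (simp add: inner_orb_transpose[symmetric] inner_axis)
qed

text \<open>A vector fixed by \<open>A\<close> has a constant orbit, which tends to 0; so identity
  minus \<open>A\<close> is injective, hence surjective. The fixed point later serves as the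
  origin.\<close>

lemma fixed_point: "\<exists>x. A *v x + a 1 = x"
proof -
  have inj: "x = 0" if "x - A *v x = 0" for x
  proof -
    have "orb A x j = x" for j using that by (induction j) (simp_all add: orb_Suc)
    then have "orb A x = (\<lambda>_. x)" by (simp add: fun_eq_iff)
    then have "(\<lambda>_. x) \<longlonglongrightarrow> 0" using orb_A_tendsto[of x] by metis
    then show ?thesis by (simp add: LIMSEQ_const_iff)
  qed
  have lin: "linear (\<lambda>x. x - A *v x)"
    by (intro linear_compose_sub linear_ident matrix_vector_mul_linear)
  then have "surj (\<lambda>x. x - A *v x)"
    using inj by (intro linear_injective_imp_surjective) (simp_all add: linear_injective_0)
  then obtain x where "x - A *v x = a 1" by (metis surjD)
  then show ?thesis by (metis add.commute diff_add_cancel)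
qed

text \<open>Pairing \<open>z\<close> with the decaying orbit of a basis vector under
  \<open>A\<close> gives \<open>inverse \<beta> ^ j * z $ i\<close>, which must therefore tend to
  0.\<close>

lemma Bc_eigenvalue:
  assumes "z \<noteq> 0" "Bc *v z = \<beta> *s z"
  shows "1 < norm \<beta>"
proof -
  obtain i where i: "z $ i \<noteq> 0" using assms(1) by (auto simp: vec_eq_iff)
  have z: "\<beta> *s (Tc *v z) = z"
    using arg_cong[OF assms(2), of "(*v) Tc"]
    by (simp add: matrix_vector_mul_assoc TcBc vector_scalar_commute)
  then have "\<beta> \<noteq> 0" using assms(1) by auto
  then have Tz: "Tc *v z = inverse \<beta> *s z"
    by (subst z[symmetric]) (simp add: vector_smult_assoc vector_scalar_commute)
  have "orb Tc z j = inverse \<beta> ^ j *s z" for j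
    by (induction j) (simp_all add: orb_Suc vector_scalar_commute Tz vector_smult_assoc mult_ac)
  then have "inverse \<beta> ^ j * z $ i = rpair z (orb A (axis i 1) j)" for j
    by (simp flip: rpair_orb_transpose)
  moreover have "(\<lambda>j. rpair z (orb A (axis i 1) j)) \<longlonglongrightarrow> rpair z 0"
    by (intro tendsto_rpair orb_A_tendsto)
  ultimately have "(\<lambda>j. norm (inverse \<beta> ^ j * z $ i)) \<longlonglongrightarrow> 0"
    by (simp add: tendsto_norm_zero)
  then have "eventually (\<lambda>j. norm (inverse \<beta> ^ j * z $ i) < norm (z $ i)) sequentially"
    by (rule order_tendstoD(2)) (simp add: i)
  then have "\<exists>j. norm (inverse \<beta> ^ j * z $ i) < norm (z $ i)"
    using eventually_happens trivial_limit_sequentially by blast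
  then obtain j where "norm (inverse \<beta>) ^ j < 1"
    using i by (auto simp: norm_mult norm_power)
  then have "norm (inverse \<beta>) < 1"
    using one_le_power[of "norm (inverse \<beta>)" j] by linarith
  then show ?thesis using \<open>\<beta> \<noteq> 0\<close> by (simp add: norm_inverse inverse_less_1_iff)
qed

text \<open>Irreducibility enters here. The vectors whose pairings with the orbit decay form a
  subspace \<open>W\<close>, stable under \<open>C\<close> by an index shift and, by dimension,
  under \<open>A\<close>. Moved to the fixed point of the first map it is invariant under all maps,
  so it is the whole space; then every coordinate of the orbit decays, impossible for an expanding
  map unless \<open>v = 0\<close>.\<close>

lemma eq_0_if_orbit_tendsto_0:
  assumes lim: "\<And>l. l \<in> {1..m} \<Longrightarrow> (\<lambda>j. rpair (orb Bc v j) (d l)) \<longlonglongrightarrow> 0"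
  shows "v = 0"
proof -
  define W where "W = {w. (\<lambda>j. rpair (orb Bc v j) w) \<longlonglongrightarrow> 0}"
  have sub: "subspace W"
    unfolding subspace_def W_def
    by (simp add: rpair_add_right rpair_scaleR_right tendsto_add_zero tendsto_mult_right_zero)
  have dW: "d l \<in> W" if "l \<in> {1..m}" for l using lim[OF that] by (simp add: W_def)
  have CW: "C *v w \<in> W" if "w \<in> W" for w
  proof -
    have "rpair (orb Bc v j) (C *v w) = rpair (orb Bc v (Suc j)) w" for j
      unfolding orb_Suc B_def by (rule rpair_transpose[symmetric])
    then show ?thesis using LIMSEQ_Suc[of "\<lambda>j. rpair (orb Bc v j) w" 0] that by (simp add: W_def)
  qed
  have injC: "inj ((*v) C)"
    by (metis AC inj_on_inverseI matrix_vector_mul_assoc matrix_vector_mul_lid)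
  have "(*v) C ` W = W"
  proof (rule subspace_dim_equal)
    show "subspace ((*v) C ` W)" by (intro linear_subspace_image sub) simp
    have "dim ((*v) C ` W) = dim W"
      by (rule dim_image_eq) (auto intro: inj_on_subset[OF injC])
    then show "dim W \<le> dim ((*v) C ` W)" by simp
  qed (use sub CW in auto)
  then have AW: "A *v w \<in> W" if "w \<in> W" for w
    using that by (metis (no_types, lifting) AC imageE matrix_vector_mul_assoc matrix_vector_mul_lid)
  obtain x1 where x1: "A *v x1 + a 1 = x1" using fixed_point by blast
  define V where "V = (+) x1 ` W"
  have step: "ifs_map A a l (x1 + w) = x1 + (A *v w + d l)" for l w
    unfolding ifs_map_def d_def matrix_vector_right_distrib by (subst (2) x1[symmetric]) simp
  have "ifs_map A a l ` V = V" if l: "l \<in> {1..m}" for l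
  proof
    show "ifs_map A a l ` V \<subseteq> V"
      using AW dW[OF l] sub by (auto simp: V_def step subspace_add)
    show "V \<subseteq> ifs_map A a l ` V"
    proof
      fix y assume "y \<in> V"
      then obtain w where w: "w \<in> W" "y = x1 + w" by (auto simp: V_def)
      let ?u = "C *v (w - d l)"
      have "?u \<in> W" using CW dW[OF l] w(1) sub by (simp add: subspace_diff)
      moreover have "y = ifs_map A a l (x1 + ?u)"
        unfolding step w(2) by (simp add: matrix_vector_mul_assoc AC)
      ultimately show "y \<in> ifs_map A a l ` V" by (auto simp: V_def)
    qed
  qed
  moreover have "affine V" unfolding V_def
    using subspace_imp_affine[OF sub] by (simp add: affine_translation[symmetric])
  moreover have "V \<noteq> {}" using subspace_0[OF sub] by (auto simp: V_def)
  ultimately have "V \<noteq> UNIV \<Longrightarrow> affine V \<and> V \<noteq> {} \<and> V \<noteq> UNIV \<and> (\<forall>l\<in>{1..m}. ifs_map A a l ` V = V)"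
    by simp
  then have "V = UNIV"
    using irr[unfolded affinely_irreducible_def not_ex, THEN spec[of _ V]] by argo
  have WU: "w \<in> W" for w
  proof -
    have "x1 + w \<in> V" using \<open>V = UNIV\<close> by simp
    then show ?thesis by (auto simp: V_def)
  qed
  have comp: "(\<lambda>j. orb Bc v j $ i) \<longlonglongrightarrow> 0" for i
    using WU[of "axis i 1"] by (simp add: W_def)
  have "v $ i = 0" for i
  proof -
    \<comment> \<open>Moving the \<open>j\<close> steps of \<open>A\<close> across the pairing
      undoes those of \<open>Bc\<close>: a pairing of two sequences tending to 0 is the constant
      \<open>v $ i\<close>.\<close>
    have eq: "rpair (orb Bc v j) (orb A (axis i 1) j) = v $ i" for j
    proof -
      have "rpair (orb Bc v j) (orb A (axis i 1) j) = rpair (orb Tc (orb Bc v (j + 0)) j) (axis i 1)"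
        by (simp only: rpair_orb_transpose add_0_right)
      also have "\<dots> = rpair v (axis i 1)" by (subst orb_inverse[OF TcBc]) simp
      finally show ?thesis by simp
    qed
    have "(\<lambda>j. rpair (orb Bc v j) (orb A (axis i 1) j)) \<longlonglongrightarrow> (\<Sum>k\<in>UNIV. 0 * complex_of_real ((0::real^'n) $ k))"
      unfolding rpair_def by (intro tendsto_intros comp orb_A_tendsto)
    then show ?thesis by (simp add: eq LIMSEQ_const_iff)
  qed
  then show ?thesis by (simp add: vec_eq_iff)
qed

end

section \<open>Integer annihilators and eigenvectors\<close>


lemma map_poly_of_int_mult:
  "map_poly of_int (p * q) = (map_poly of_int p * map_poly of_int q :: 'a::comm_ring_1 poly)"
  by (rule poly_eqI) (simp add: coeff_map_poly coeff_mult)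

lemma ipoly_at_mult [simp]: "ipoly_at (P * Q) z = ipoly_at P z * ipoly_at Q z"
  by (simp add: ipoly_at_def map_poly_of_int_mult)

lemma map_poly_of_int_add:
  "map_poly of_int (p + q) = (map_poly of_int p + map_poly of_int q :: 'a::comm_ring_1 poly)"
  by (rule poly_eqI) (simp add: coeff_map_poly)

lemma ipoly_at_add [simp]: "ipoly_at (P + Q) z = ipoly_at P z + ipoly_at Q z"
  by (simp add: ipoly_at_def map_poly_of_int_add)

lemma ipoly_at_0 [simp]: "ipoly_at 0 z = 0"
  by (simp add: ipoly_at_def)

lemma ipoly_at_pCons [simp]: "ipoly_at (pCons a P) z = of_int a + z * ipoly_at P z"
  by (simp add: ipoly_at_def map_poly_pCons)

lemma ipoly_at_1 [simp]: "ipoly_at 1 z = 1"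
  by (simp add: one_pCons)

lemma ipoly_at_smult [simp]: "ipoly_at (smult c P) z = of_int c * ipoly_at P z"
  by (induction P) (simp_all add: algebra_simps)

lemma ex_prime_factor_with_root:
  assumes "q \<noteq> 0" "ipoly_at q z = 0"
  shows "\<exists>f. prime f \<and> f dvd q \<and> ipoly_at f z = 0"
  using assms
proof (induction q rule: prime_divisors_induct)
  case (unit q)
  then obtain r where "1 = q * r" by (auto elim: dvdE)
  then have "ipoly_at q z * ipoly_at r z = 1" by (metis ipoly_at_1 ipoly_at_mult)
  then show ?case using unit by simp
next
  case (factor p q)
  then show ?case by (cases "ipoly_at p z = 0") (auto intro: dvd_mult)
qed simp

text \<open>The leading coefficient divides 1, and its sign is fixed because \<open>prime\<close>
  includes being normalised.\<close>

lemma prime_dvd_monic_imp_monic: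
  fixes f q :: "int poly"
  assumes "prime f" "f dvd q" "lead_coeff q = 1"
  shows "lead_coeff f = 1"
proof -
  obtain r where "q = f * r" using assms(2) by (rule dvdE)
  then have "lead_coeff f dvd 1" using assms(3) by (metis dvd_triv_left lead_coeff_mult)
  moreover have "normalize f = f" using assms(1) by (simp add: prime_def)
  then have "unit_factor f = 1" using assms(1) by (metis not_prime_0 unit_factor_1 unit_factor_mult_normalize mult_cancel_right1 normalize_eq_0_iff)
  then have "sgn (lead_coeff f) = 1" by (simp add: unit_factor_poly_def one_pCons)
  ultimately show ?thesis by (auto simp: sgn_if split: if_splits)
qed

text \<open>A form of Gauss's lemma. Pseudo-division by a \<open>P0\<close> of least degree with
  root \<open>z\<close> shows that \<open>P0\<close> divides a nonzero integer multiple of every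
  polynomial with that root. The prime \<open>f\<close> must then divide \<open>P0\<close>, and it
  cannot divide a nonzero constant.\<close>

lemma prime_poly_dvd_if_common_root:
  fixes f :: "int poly"
  assumes f: "prime f" "ipoly_at f z = 0" and R: "ipoly_at R z = 0"
  shows "f dvd R"
proof -
  have f0: "f \<noteq> 0" using f by auto
  define P0 where "P0 = arg_min degree (\<lambda>P. P \<noteq> 0 \<and> ipoly_at P z = 0)"
  have P0: "P0 \<noteq> 0" "ipoly_at P0 z = 0"
    and min: "\<And>P. P \<noteq> 0 \<and> ipoly_at P z = 0 \<Longrightarrow> degree P0 \<le> degree P"
    using arg_min_nat_lemma[of "\<lambda>P. P \<noteq> 0 \<and> ipoly_at P z = 0" f degree] f f0
    by (auto simp: P0_def)
  have div: "\<exists>c u. c \<noteq> 0 \<and> smult c P = P0 * u" if "ipoly_at P z = 0" for P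
  proof -
    obtain u r where "pseudo_divmod P P0 = (u, r)" by (cases "pseudo_divmod P P0")
    note ur = pseudo_divmod[OF P0(1) this]
    define c where "c = lead_coeff P0 ^ (Suc (degree P) - degree P0)"
    have c: "c \<noteq> 0" "smult c P = P0 * u + r" "r = 0 \<or> degree r < degree P0"
      using P0(1) ur by (simp_all add: c_def)
    have "ipoly_at (smult c P) z = ipoly_at (P0 * u + r) z" using c(2) by simp
    then have "ipoly_at r z = 0" using that P0(2) by simp
    then have "r = 0" using c(3) min[of r] by (metis not_less)
    then show ?thesis using c by auto
  qed
  have const: "degree P = 0 \<Longrightarrow> P \<noteq> 0 \<Longrightarrow> ipoly_at P z \<noteq> 0" for P
    by (auto elim: degree_eq_zeroE)
  obtain c u where c: "c \<noteq> 0" "smult c f = P0 * u" using div[OF f(2)] by blast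
  obtain c' u' where c': "c' \<noteq> 0" "smult c' R = P0 * u'" using div[OF R] by blast
  have "f dvd P0 * u" using c(2) by (metis dvd_refl dvd_smult)
  then have "f dvd P0 \<or> f dvd u" using f(1) prime_dvd_multD by blast
  then have fP: "f dvd P0"
  proof
    assume "f dvd u"
    then obtain w where "u = f * w" by (rule dvdE)
    then have "f * [:c:] = f * (P0 * w)" using c(2) by (simp add: mult_ac)
    then have "[:c:] = P0 * w" using mult_left_cancel[OF f0] by blast
    moreover have "w \<noteq> 0" using calculation c(1) by auto
    ultimately have "degree P0 = 0"
      using degree_mult_eq[OF P0(1), of w] by (metis add_is_0 degree_pCons_0)
    then show ?thesis using const P0 by blast
  qed
  have "f dvd [:c':] * R" using fP c'(2) by (simp add: dvd_mult2)
  then have "f dvd [:c':] \<or> f dvd R" using f(1) prime_dvd_multD by blast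
  moreover have "\<not> f dvd [:c':]"
  proof
    assume "f dvd [:c':]"
    then have "degree f \<le> degree [:c':]" using c'(1) by (intro dvd_imp_degree_le) auto
    then show False using const f f0 by simp
  qed
  ultimately show ?thesis by blast
qed

text \<open>Up to sign the constant coefficient is the product of all roots, and a nonzero integer
  has modulus at least 1.\<close>

lemma monic_int_poly_large_root:
  assumes lc: "lead_coeff f = 1" and deg: "degree f > 0" and f0: "coeff f 0 \<noteq> 0"
  shows "\<exists>z. ipoly_at f z = 0 \<and> 1 \<le> norm z"
proof (rule ccontr)
  assume "\<not> ?thesis"
  then have small: "\<And>z. ipoly_at f z = 0 \<Longrightarrow> norm z < 1" by (auto simp: not_le)
  define F :: "complex poly" where "F = map_poly of_int f"
  have dF: "degree F = degree f" and lF: "lead_coeff F = 1"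
    using lc by (simp_all add: F_def degree_map_poly coeff_map_poly)
  then have "F \<noteq> 0" by auto
  then obtain S where S: "size S = degree F" "F = smult (lead_coeff F) (\<Prod>x\<in>#S. [:- x, 1:])"
    using alg_closed_imp_factorization by blast
  have FS: "F = (\<Prod>x\<in>#S. [:- x, 1:])" using S(2) lF by simp
  have root: "norm x < 1" if x: "x \<in># S" for x
  proof -
    have "[:- x, 1:] dvd F" unfolding FS using x by (intro dvd_prod_mset) auto
    then have "poly F x = 0" by (simp add: poly_eq_0_iff_dvd)
    then show ?thesis using small by (simp add: ipoly_at_def F_def)
  qed
  have prod: "norm (poly (\<Prod>x\<in>#T. [:- x, 1:]) 0) < 1" if "T \<subseteq># S" "T \<noteq> {#}" for T
    using that
  proof (induction T)
    case (add x T)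
    have x: "norm x < 1" using add.prems by (intro root) (auto dest: mset_subset_eqD)
    show ?case
    proof (cases "T = {#}")
      case False
      then have "norm (poly (\<Prod>x\<in>#T. [:- x, 1:]) 0) < 1"
        using add by (auto dest: mset_subset_eq_insertD subset_mset.less_imp_le)
      then have "norm x * norm (poly (\<Prod>x\<in>#T. [:- x, 1:]) 0) < 1 * 1"
        using x by (intro mult_strict_mono') auto
      then show ?thesis by (simp add: norm_mult)
    qed (use x in simp)
  qed simp
  have "S \<noteq> {#}" using S(1) dF deg by auto
  then have "norm (poly F 0) < 1" using prod[of S] FS by simp
  then have "norm (of_int (coeff f 0) :: complex) < 1"
    by (simp add: F_def poly_0_coeff_0 coeff_map_poly)
  then show False using f0 by simp
qed

text \<open>The synthetic quotient is \<open>(f(x) - f(c)) / (x - c)\<close>. Replacing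
  \<open>x ^ i\<close> by \<open>K i\<close> gives the polynomial part of \<open>f(c)\<close> times
  the formal series with coefficient \<open>K i\<close> at \<open>c ^ -(i + 1)\<close>: the
  numerator of a generating function, with integer coefficients independent of \<open>c\<close>.
  These depend on the first \<open>degree f\<close> entries of \<open>K\<close> through a triangular
  system with diagonal \<open>lead_coeff f\<close>.\<close>

lemma remainder_poly:
  "\<exists>R :: int poly. (R = 0 \<or> degree R < degree f) \<and> (R = 0 \<longrightarrow> (\<forall>i<degree f. K i = 0)) \<and>
    (\<forall>c. shift_act (synthetic_div (map_poly of_int f) c) (\<lambda>i. of_int (K i)) 0 = ipoly_at R c)"
proof (induction f arbitrary: K)
  case 0
  then show ?case by (intro exI[of _ 0]) simp
next
  case (pCons a f)
  obtain R where R: "R = 0 \<or> degree R < degree f" "R = 0 \<longrightarrow> (\<forall>i<degree f. K (Suc i) = 0)"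
    "\<And>c. shift_act (synthetic_div (map_poly of_int f) c) (\<lambda>i. of_int (K (Suc i))) 0 = ipoly_at R c"
    using pCons.IH[of "\<lambda>i. K (Suc i)"] by blast
  define R' where "R' = smult (K 0) f + R"
  have shift: "shift_act h (\<lambda>i. of_int (K (Suc i))) 0 = shift_act h (\<lambda>i. of_int (K i)) (Suc 0)"
    for h :: "complex poly"
    using shift_act_shift[of h "\<lambda>i. of_int (K i)" 1 0] by simp
  have "shift_act (synthetic_div (map_poly of_int (pCons a f)) c) (\<lambda>i. of_int (K i)) 0 = ipoly_at R' c" for c
    by (simp add: R'_def map_poly_pCons R(3)[symmetric] shift ipoly_at_def[of f] mult.commute)
  moreover have "R' = 0 \<or> degree R' < degree (pCons a f)"
  proof (cases "f = 0")
    case True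
    then show ?thesis using R(1) by (simp add: R'_def)
  next
    case False
    then have "degree R' < Suc (degree f)"
      unfolding R'_def using R(1) by (intro degree_add_less le_less_trans[OF degree_smult_le]) auto
    then show ?thesis using False by simp
  qed
  moreover have "\<forall>i<degree (pCons a f). K i = 0" if "R' = 0"
  proof (cases "f = 0")
    case False
    have "coeff R (degree f) = 0" using R(1) by (auto simp: coeff_eq_0)
    then have "K 0 * lead_coeff f = 0"
      using arg_cong[OF that, of "\<lambda>p. coeff p (degree f)"] by (simp add: R'_def)
    then have "K 0 = 0" using False by simp
    moreover from this have "R = 0" using that by (simp add: R'_def)
    ultimately show ?thesis using R(2) False by (auto simp: less_Suc_eq_0_disj)
  qed simp
  ultimately show ?case by blast
qed

lemma eq_0_if_growth_tendsto_0:
  fixes \<beta> y :: complex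
  assumes "(\<lambda>j. \<beta> ^ j * y) \<longlonglongrightarrow> 0" "1 \<le> norm \<beta>"
  shows "y = 0"
proof (rule ccontr)
  assume "y \<noteq> 0"
  moreover have "(\<lambda>j. norm (\<beta> ^ j * y)) \<longlonglongrightarrow> 0" using assms(1) by (rule tendsto_norm_zero)
  ultimately have "eventually (\<lambda>j. norm (\<beta> ^ j * y) < norm y) sequentially"
    by (intro order_tendstoD(2)) auto
  then obtain j where "norm (\<beta> ^ j * y) < norm y"
    using eventually_happens trivial_limit_sequentially by blast
  then have "norm \<beta> ^ j < 1" using \<open>y \<noteq> 0\<close> by (simp add: norm_mult norm_power)
  then show False using one_le_power[OF assms(2), of j] by linarith
qed

section \<open>Approximating integers and eigenvectors of \<open>B\<close>\<close>

context irreducible_ifs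
begin

definition approximates :: "complex^'n \<Rightarrow> (nat \<Rightarrow> nat \<Rightarrow> int) \<Rightarrow> bool" where
  "approximates v K \<longleftrightarrow> (\<forall>l\<in>{1..m}. (\<lambda>j. rpair (orb Bc v j) (d l) - of_int (K l j)) \<longlonglongrightarrow> 0)"

definition annihilates :: "int poly \<Rightarrow> (nat \<Rightarrow> nat \<Rightarrow> int) \<Rightarrow> bool" where
  "annihilates f K \<longleftrightarrow> (\<forall>l\<in>{1..m}. \<forall>j. shift_act f (K l) j = 0)"

text \<open>As \<open>f\<close> annihilates the integers, the pairings of \<open>f(B) v\<close> are
  combinations of shifted errors alone.\<close>

lemma poly_orb_eq_0:
  assumes ap: "approximates v K" and an: "annihilates f K"
  shows "poly_orb (map_poly of_int f) Bc v = 0"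
proof (rule eq_0_if_orbit_tendsto_0)
  fix l assume l: "l \<in> {1..m}"
  let ?f = "map_poly of_int f"
  have "rpair (orb Bc (poly_orb ?f Bc v) j) (d l)
      = shift_act ?f (\<lambda>k. rpair (orb Bc v k) (d l) - of_int (K l k)) j" for j
    using an l unfolding annihilates_def
    by (simp add: rpair_poly_orb shift_act_seq_diff shift_act_of_int[symmetric])
  moreover have "shift_act ?f (\<lambda>k. rpair (orb Bc v k) (d l) - of_int (K l k)) \<longlonglongrightarrow> 0"
    using ap l by (intro tendsto_shift_act) (auto simp: approximates_def)
  ultimately show "(\<lambda>j. rpair (orb Bc (poly_orb ?f Bc v) j) (d l)) \<longlonglongrightarrow> 0"
    by presburger
qed

lemma approximates_poly_orb:
  assumes "approximates v K"
  shows "approximates (poly_orb (map_poly of_int r) Bc v) (\<lambda>l. shift_act r (K l))"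
  unfolding approximates_def
proof
  fix l assume l: "l \<in> {1..m}"
  have "shift_act (map_poly of_int r) (\<lambda>k. rpair (orb Bc v k) (d l) - of_int (K l k)) \<longlonglongrightarrow> 0"
    using assms l by (intro tendsto_shift_act) (auto simp: approximates_def)
  moreover have "shift_act (map_poly of_int r) (\<lambda>k. rpair (orb Bc v k) (d l) - of_int (K l k))
    = (\<lambda>j. rpair (orb Bc (poly_orb (map_poly of_int r) Bc v) j) (d l) - of_int (shift_act r (K l) j))"
    by (rule ext) (simp add: rpair_poly_orb shift_act_seq_diff shift_act_of_int)
  ultimately show "(\<lambda>j. rpair (orb Bc (poly_orb (map_poly of_int r) Bc v) j) (d l)
      - of_int (shift_act r (K l) j)) \<longlonglongrightarrow> 0"
    by (simp only:)
qed

text \<open>For a root \<open>\<beta>\<close> of \<open>f\<close> the synthetic quotient is exactly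
  \<open>f / (x - \<beta>)\<close>, so applying \<open>B - \<beta>\<close> yields
  \<open>f(B) v\<close>.\<close>

definition eigenvec :: "int poly \<Rightarrow> complex^'n \<Rightarrow> complex \<Rightarrow> complex^'n" where
  "eigenvec f v \<beta> = poly_orb (synthetic_div (map_poly of_int f) \<beta>) Bc v"

lemma synthetic_div_root:
  fixes f :: "int poly"
  assumes "ipoly_at f \<beta> = 0"
  shows "map_poly of_int f = [:- \<beta>, 1:] * synthetic_div (map_poly of_int f) \<beta>"
  using synthetic_div_correct'[of \<beta> "map_poly of_int f"] assms by (simp add: ipoly_at_def)

lemma Bc_eigenvec:
  assumes ap: "approximates v K" and an: "annihilates f K" and root: "ipoly_at f \<beta> = 0"
  shows "Bc *v eigenvec f v \<beta> = \<beta> *s eigenvec f v \<beta>"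
proof -
  have "poly_orb [:- \<beta>, 1:] Bc (eigenvec f v \<beta>) = poly_orb (map_poly of_int f) Bc v"
    unfolding eigenvec_def poly_orb_mult[symmetric] synthetic_div_root[OF root, symmetric] ..
  then show ?thesis using poly_orb_eq_0[OF ap an] by (simp add: poly_orb_linear_factor)
qed

text \<open>Both sides are initial terms of geometric sequences with ratio \<open>\<beta>\<close>,
  whose difference is a combination of shifted errors and tends to 0. A ratio of modulus at least 1
  leaves only equality.\<close>

lemma eigenvec_pairing:
  assumes ap: "approximates v K" and an: "annihilates f K" and root: "ipoly_at f \<beta> = 0"
    and \<beta>: "1 \<le> norm \<beta>" and l: "l \<in> {1..m}"
  shows "rpair (eigenvec f v \<beta>) (d l)
    = shift_act (synthetic_div (map_poly of_int f) \<beta>) (\<lambda>i. of_int (K l i)) 0"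
proof -
  define h where "h = synthetic_div (map_poly of_int f) \<beta>"
  define Y where "Y = shift_act h (\<lambda>i. of_int (K l i))"
  have "Y (Suc j) - \<beta> * Y j = 0" for j
  proof -
    have "Y (Suc j) - \<beta> * Y j = shift_act ([:- \<beta>, 1:] * h) (\<lambda>i. of_int (K l i)) j"
      unfolding shift_act_mult by (simp add: Y_def)
    also have "\<dots> = of_int (shift_act f (K l) j)"
      unfolding h_def synthetic_div_root[OF root, symmetric] shift_act_of_int ..
    finally show ?thesis using an l by (simp add: annihilates_def)
  qed
  then have Y: "Y j = \<beta> ^ j * Y 0" for j
    by (induction j) (simp_all add: algebra_simps)
  have eig: "orb Bc (eigenvec f v \<beta>) j = \<beta> ^ j *s eigenvec f v \<beta>" for j
    by (induction j)
      (simp_all add: orb_Suc vector_scalar_commute Bc_eigenvec[OF ap an root] vector_smult_assoc mult_ac)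
  have "\<beta> ^ j * (rpair (eigenvec f v \<beta>) (d l) - Y 0)
      = shift_act h (\<lambda>k. rpair (orb Bc v k) (d l) - of_int (K l k)) j" for j
  proof -
    have "\<beta> ^ j * rpair (eigenvec f v \<beta>) (d l) = rpair (orb Bc (eigenvec f v \<beta>) j) (d l)"
      by (simp add: eig rpair_smult_left)
    also have "\<dots> = shift_act h (\<lambda>k. rpair (orb Bc v k) (d l)) j"
      by (simp add: eigenvec_def rpair_poly_orb h_def)
    finally show ?thesis
      using Y[of j] by (simp add: shift_act_seq_diff right_diff_distrib Y_def)
  qed
  moreover have "shift_act h (\<lambda>k. rpair (orb Bc v k) (d l) - of_int (K l k)) \<longlonglongrightarrow> 0"
    using ap l by (intro tendsto_shift_act) (auto simp: approximates_def)
  ultimately have "(\<lambda>j. \<beta> ^ j * (rpair (eigenvec f v \<beta>) (d l) - Y 0)) \<longlonglongrightarrow> 0"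
    by presburger
  then have "rpair (eigenvec f v \<beta>) (d l) - Y 0 = 0" using \<beta> by (rule eq_0_if_growth_tendsto_0)
  then show ?thesis by (simp add: Y_def h_def)
qed

text \<open>The \<open>R l\<close> are the numerators from \<open>remainder_poly\<close>, so one
  integer polynomial serves all roots. A nonzero sequence has a nonzero numerator of degree below
  \<open>degree f\<close>; the prime \<open>f\<close> cannot divide it, so it vanishes at no root of
  \<open>f\<close>.\<close>

lemma prime_annihilator_pairing:
  assumes ap: "approximates v K" and an: "annihilates f K"
    and f: "prime f" "lead_coeff f = 1" and K: "\<exists>l\<in>{1..m}. \<exists>j. K l j \<noteq> 0"
  obtains R l0 where "l0 \<in> {1..m}"
    "\<And>\<beta> l. ipoly_at f \<beta> = 0 \<Longrightarrow> 1 \<le> norm \<beta> \<Longrightarrow> l \<in> {1..m} \<Longrightarrow>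
      rpair (eigenvec f v \<beta>) (d l) = ipoly_at (R l) \<beta>"
    "\<And>\<beta>. ipoly_at f \<beta> = 0 \<Longrightarrow> ipoly_at (R l0) \<beta> \<noteq> 0"
proof -
  define good where "good l R \<longleftrightarrow> (R = 0 \<or> degree R < degree f) \<and> (R = 0 \<longrightarrow> (\<forall>i<degree f. K l i = 0)) \<and>
    (\<forall>c. shift_act (synthetic_div (map_poly of_int f) c) (\<lambda>i. of_int (K l i)) 0 = ipoly_at R c)"
    for l R
  define R where "R l = (SOME R. good l R)" for l
  have "good l (R l)" for l
    unfolding R_def by (rule someI_ex) (unfold good_def, rule remainder_poly)
  note this [unfolded good_def]
  then have R: "R l = 0 \<or> degree (R l) < degree f"
      "R l = 0 \<Longrightarrow> \<forall>i<degree f. K l i = 0"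
      "shift_act (synthetic_div (map_poly of_int f) c) (\<lambda>i. of_int (K l i)) 0 = ipoly_at (R l) c"
    for l c
    by simp_all
  obtain l0 j0 where l0: "l0 \<in> {1..m}" "K l0 j0 \<noteq> 0" using K by blast
  have f0: "f \<noteq> 0" using f by auto
  have R0: "R l0 \<noteq> 0"
  proof
    assume "R l0 = 0"
    then have init: "\<forall>i<degree f. K l0 i = 0" by (rule R(2))
    have "K l0 j0 = 0"
    proof (rule recurrence_zero[OF f0])
      show "shift_act f (K l0) j = 0" for j using an l0(1) by (simp add: annihilates_def)
    qed (use init in simp)
    then show False using l0(2) by simp
  qed
  show thesis
  proof (rule that[OF l0(1)])
    show "rpair (eigenvec f v \<beta>) (d l) = ipoly_at (R l) \<beta>"
      if "ipoly_at f \<beta> = 0" "1 \<le> norm \<beta>" "l \<in> {1..m}" for \<beta> l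
      using eigenvec_pairing[OF ap an that] R(3) by simp
    show "ipoly_at (R l0) \<beta> \<noteq> 0" if root: "ipoly_at f \<beta> = 0" for \<beta>
    proof
      assume "ipoly_at (R l0) \<beta> = 0"
      then have "f dvd R l0" using f(1) root by (intro prime_poly_dvd_if_common_root)
      then have "degree f \<le> degree (R l0)" using R0 by (rule dvd_imp_degree_le)
      then show False using R(1)[of l0] R0 by simp
    qed
  qed
qed

text \<open>A nonzero pairing witnesses a nonzero eigenvector, and all eigenvalues of
  \<open>B\<close> have modulus above 1; this excludes the unit circle.\<close>

lemma prime_annihilator_roots:
  assumes ap: "approximates v K" and an: "annihilates f K"
    and f: "prime f" "lead_coeff f = 1" and K: "\<exists>l\<in>{1..m}. \<exists>j. K l j \<noteq> 0"
    and root: "ipoly_at f \<beta> = 0" "1 \<le> norm \<beta>"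
  shows "eigenvec f v \<beta> \<noteq> 0" and "1 < norm \<beta>"
proof -
  obtain R l0 where "l0 \<in> {1..m}"
    "\<And>\<beta> l. ipoly_at f \<beta> = 0 \<Longrightarrow> 1 \<le> norm \<beta> \<Longrightarrow> l \<in> {1..m} \<Longrightarrow>
      rpair (eigenvec f v \<beta>) (d l) = ipoly_at (R l) \<beta>"
    "\<And>\<beta>. ipoly_at f \<beta> = 0 \<Longrightarrow> ipoly_at (R l0) \<beta> \<noteq> 0"
    using prime_annihilator_pairing[OF ap an f K] by metis
  then show nz: "eigenvec f v \<beta> \<noteq> 0" using root by force
  show "1 < norm \<beta>" using Bc_eigenvalue[OF nz] Bc_eigenvec[OF ap an root(1)] .
qed

end

section \<open>Non-decaying frequencies\<close>


lemma summable_square_add: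
  fixes u v :: "nat \<Rightarrow> real"
  assumes "summable (\<lambda>j. (u j)\<^sup>2)" "summable (\<lambda>j. (v j)\<^sup>2)"
  shows "summable (\<lambda>j. (u j + v j)\<^sup>2)"
proof (rule summable_comparison_test')
  show "summable (\<lambda>j. 2 * (u j)\<^sup>2 + 2 * (v j)\<^sup>2)"
    by (intro summable_add summable_mult assms)
  show "norm ((u j + v j)\<^sup>2) \<le> 2 * (u j)\<^sup>2 + 2 * (v j)\<^sup>2" for j
    using zero_le_power2[of "u j - v j"] unfolding real_norm_def abs_power2
    by (simp add: power2_sum power2_diff)
qed

lemma summable_square_shift_act:
  fixes u :: "nat \<Rightarrow> real"
  assumes "summable (\<lambda>j. (u j)\<^sup>2)"
  shows "summable (\<lambda>j. (shift_act f u j)\<^sup>2)"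
proof (induction f)
  case (pCons a f)
  have "summable (\<lambda>j. (a * u j)\<^sup>2)"
    using assms by (simp add: power_mult_distrib summable_mult)
  moreover have "summable (\<lambda>j. (shift_act f u (Suc j))\<^sup>2)"
    using pCons.IH by (subst summable_Suc_iff)
  ultimately show ?case
    by (simp add: summable_square_add)
qed simp

lemma norm_orb_le:
  fixes M :: "real^'n::finite^'n"
  assumes "\<And>x. norm (M *v x) \<le> b * norm x" "0 \<le> b"
  shows "norm (orb M v j) \<le> b ^ j * norm v"
proof (induction j)
  case (Suc j)
  have "norm (orb M v (Suc j)) \<le> b * norm (orb M v j)" by (simp add: orb_Suc assms(1))
  also have "\<dots> \<le> b * (b ^ j * norm v)" by (intro mult_left_mono Suc assms)
  finally show ?case by simp
qed simp

lemma shift_act_inner_orb: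
  fixes M :: "real^'n::finite^'n"
  shows "shift_act f (\<lambda>k. orb M v k \<bullet> w) j = orb M (poly_orb f M v) j \<bullet> w"
  unfolding inner_vec_def shift_act_seq_sum inner_real_def
  by (simp add: orb_poly_orb shift_act_seq_cmult mult.commute[of _ "w $ _"])

context irreducible_ifs
begin

lemma B_bounded: obtains b where "1 \<le> b" "\<And>x. norm (B *v x) \<le> b * norm x"
proof -
  obtain b where b: "\<And>x. norm (B *v x) \<le> b * norm x"
    using linear_bounded[OF matrix_vector_mul_linear[of B]] by blast
  show thesis
  proof (rule that[of "max 1 b"])
    show "norm (B *v x) \<le> max 1 b * norm x" for x
      using b[of x] mult_right_mono[of b "max 1 b" "norm x"] by simp
  qed simp
qed

lemma fourier_B:
  assumes "self_affine_measure UNIV m A a p \<mu>" "probability_vector m p"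
  shows "fourier \<mu> (B *v x) = trig_mask m a p (B *v x) * fourier \<mu> x"
  using fourier_self_affine[OF assms, of "B *v x"] by (simp add: matrix_vector_mul_assoc TB)

lemma norm_fourier_orb_T:
  assumes "self_affine_measure UNIV m A a p \<mu>" "probability_vector m p"
  shows "norm (fourier \<mu> x) \<le> norm (fourier \<mu> (orb (transpose A) x i))"
proof (induction i)
  case (Suc i)
  let ?y = "orb (transpose A) x i"
  have "norm (fourier \<mu> ?y) \<le> 1 * norm (fourier \<mu> (transpose A *v ?y))"
    unfolding fourier_self_affine[OF assms, of ?y] norm_mult
    by (intro mult_right_mono norm_trig_mask_le_1 assms) simp
  then show ?case using Suc by (simp add: orb_Suc)
qed simp

text \<open>A frequency \<open>\<xi>\<close> with large Fourier coefficient is pulled back by the contraction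
  \<open>transpose A\<close> into a fixed annulus; the direction is a limit point there.\<close>

lemma nonrajchman_direction:
  assumes sa: "self_affine_measure UNIV m A a p \<mu>" and p: "probability_vector m p"
    and nr: "\<not> rajchman UNIV \<mu>"
  obtains \<eta> \<delta> where "\<eta> \<noteq> 0" "0 < \<delta>" "\<And>j. \<delta> \<le> norm (fourier \<mu> (orb B \<eta> j))"
proof -
  let ?T = "transpose A"
  have \<mu>: "prob_space \<mu>" "sets \<mu> = sets borel"
    using sa by (auto simp: self_affine_measure_UNIV)
  obtain b where b: "1 \<le> b" "\<And>x. norm (B *v x) \<le> b * norm x" using B_bounded by blast
  obtain \<delta> where \<delta>: "0 < \<delta>" and large: "\<And>k. \<exists>\<xi>. k \<le> norm \<xi> \<and> \<delta> \<le> norm (fourier \<mu> \<xi>)"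
    using nr unfolding rajchman_UNIV tendsto_iff eventually_at_infinity by (auto simp: not_less)
  \<comment> \<open>Only the indices with \<open>b ^ j < real k\<close> are controlled; this stretch
    grows with \<open>k\<close> and exhausts all \<open>j\<close> in the limit.\<close>
  have "\<exists>\<eta>. 1 \<le> b * norm \<eta> \<and> norm \<eta> \<le> 1 \<and> (\<forall>j. b ^ j < real k \<longrightarrow> \<delta> \<le> norm (fourier \<mu> (orb B \<eta> j)))"
    for k :: nat
  proof -
    \<comment> \<open>The 2 excludes \<open>n = 0\<close> below; the bound by \<open>k\<close>
      ensures that every controlled \<open>j\<close> is at most \<open>n\<close>.\<close>
    obtain \<xi> where \<xi>: "max (real k) 2 \<le> norm \<xi>" "\<delta> \<le> norm (fourier \<mu> \<xi>)" using large by blast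
    have "\<exists>n. norm (orb ?T \<xi> n) < 1"
      using LIMSEQ_D[OF orb_T_tendsto[of \<xi>], of 1] by auto
    then obtain n0 where "norm (orb ?T \<xi> n0) \<le> 1" by (auto intro: less_imp_le)
    \<comment> \<open>Stopping at the first entry into the unit ball keeps the predecessor outside,
      so the vector has norm at least \<open>1 / b\<close>.\<close>
    define n where "n = (LEAST n. norm (orb ?T \<xi> n) \<le> 1)"
    have n: "norm (orb ?T \<xi> n) \<le> 1" unfolding n_def by (rule LeastI) fact
    have "n \<noteq> 0"
    proof
      assume "n = 0"
      then show False using n \<xi>(1) by simp
    qed
    then obtain n' where n': "n = Suc n'" by (cases n) auto
    have "\<not> norm (orb ?T \<xi> n') \<le> 1" 
      using not_less_Least[of n' "\<lambda>n. norm (orb ?T \<xi> n) \<le> 1"] n' unfolding n_def by simp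
    moreover have "orb ?T \<xi> n' = B *v orb ?T \<xi> n"
      using orb_inverse[OF BT, of \<xi> 1 n'] by (simp add: n' orb_Suc[of B _ 0])
    ultimately have low: "1 \<le> b * norm (orb ?T \<xi> n)" using b(2)[of "orb ?T \<xi> n"] by simp
    have pull: "orb B (orb ?T \<xi> n) j = orb ?T \<xi> (n - j)" if "j \<le> n" for j
      using orb_inverse[OF BT, of \<xi> j "n - j"] that by simp
    have "\<delta> \<le> norm (fourier \<mu> (orb B (orb ?T \<xi> n) j))" if j: "b ^ j < real k" for j
    proof -
      have "j \<le> n"
      proof (rule ccontr)
        assume "\<not> j \<le> n"
        then have "b ^ n \<le> b ^ j" using b(1) by (intro power_increasing) auto
        moreover have "norm \<xi> \<le> b ^ n * norm (orb ?T \<xi> n)"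
          using norm_orb_le[of B b "orb ?T \<xi> n" n] b pull[of n] by simp
        moreover have "b ^ n * norm (orb ?T \<xi> n) \<le> b ^ n * 1"
          using n b(1) by (intro mult_left_mono) auto
        ultimately show False using j \<xi>(1) by simp
      qed
      then show ?thesis using pull[of j] norm_fourier_orb_T[OF sa p, of \<xi> "n - j"] \<xi>(2) by simp
    qed
    then show ?thesis using low n by blast
  qed
  then obtain \<eta> where \<eta>: "\<And>k. 1 \<le> b * norm (\<eta> k)" "\<And>k. norm (\<eta> k) \<le> 1"
      "\<And>k j. b ^ j < real k \<Longrightarrow> \<delta> \<le> norm (fourier \<mu> (orb B (\<eta> k) j))"
    by metis
  have "compact (cball (0 :: real^'n) 1)" by simp
  then obtain l r where r: "strict_mono r" "(\<eta> \<circ> r) \<longlonglongrightarrow> l"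
    using \<eta>(2) unfolding compact_def by (metis mem_cball_0)
  show thesis
  proof (rule that[of l \<delta>])
    have "(\<lambda>k. b * norm ((\<eta> \<circ> r) k)) \<longlonglongrightarrow> b * norm l" by (intro tendsto_intros r)
    then have "1 \<le> b * norm l" by (rule LIMSEQ_le_const) (use \<eta>(1) in auto)
    then show "l \<noteq> 0" by auto
    show "\<delta> \<le> norm (fourier \<mu> (orb B l j))" for j
    proof -
      have "(\<lambda>k. orb B ((\<eta> \<circ> r) k) j) \<longlonglongrightarrow> orb B l j"
        using continuous_on_tendsto_compose[OF continuous_orb r(2), of B j] by simp
      then have "(\<lambda>k. norm (fourier \<mu> (orb B ((\<eta> \<circ> r) k) j))) \<longlonglongrightarrow> norm (fourier \<mu> (orb B l j))"
        by (intro tendsto_norm tendsto_fourier[OF \<mu>])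
      moreover have "\<delta> \<le> norm (fourier \<mu> (orb B ((\<eta> \<circ> r) k) j))" if k: "k \<ge> nat \<lceil>b ^ j\<rceil> + 1" for k
      proof -
        have "b ^ j < real k" using k by linarith
        also have "real k \<le> real (r k)" using seq_suble[OF r(1)] by simp
        finally show ?thesis using \<eta>(3) by simp
      qed
      ultimately show ?thesis by (intro LIMSEQ_le_const) auto
    qed
  qed fact
qed

text \<open>Each application of \<open>B\<close> multiplies the Fourier modulus by that of the mask.
  The lower bound \<open>\<delta>\<close> makes the drop at least a fixed positive multiple of the
  squared rounding error, and drops of a sequence in the unit interval have bounded sum.\<close>

lemma frequency_errors_summable:
  assumes sa: "self_affine_measure UNIV m A a p \<mu>" and p: "probability_vector m p"
    and pos: "\<And>l. l \<in> {1..m} \<Longrightarrow> 0 < p l"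
    and \<delta>: "0 < \<delta>" "\<And>j. \<delta> \<le> norm (fourier \<mu> (orb B \<eta> j))" and l: "l \<in> {1..m}"
  shows "summable (\<lambda>j. (orb B \<eta> j \<bullet> d l - of_int (round (orb B \<eta> j \<bullet> d l)))\<^sup>2)"
proof -
  define s where "s j = norm (fourier \<mu> (orb B \<eta> j))" for j
  define e where "e j = (orb B \<eta> j \<bullet> d l - of_int (round (orb B \<eta> j \<bullet> d l)))\<^sup>2" for j
  have s1: "s j \<le> 1" for j
    using sa norm_fourier_le_1[of \<mu>] by (auto simp: s_def self_affine_measure_UNIV)
  have c: "0 < p 1 * p l" using pos[of 1] pos[OF l] m1 by simp
  have step: "\<delta> * (p 1 * p l) * e (Suc j) \<le> s j - s (Suc j)" for j
  proof -
    let ?M = "norm (trig_mask m a p (orb B \<eta> (Suc j)))"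
    have "p 1 * p l * e (Suc j) \<le> p 1 * p l * (1 - cos (2 * pi * (orb B \<eta> (Suc j) \<bullet> d l)))"
      using c unfolding e_def by (intro mult_left_mono round_error_square_le) simp
    also have "\<dots> \<le> 1 - ?M" unfolding d_def by (rule trig_mask_defect[OF p l])
    finally have "\<delta> * (p 1 * p l * e (Suc j)) \<le> \<delta> * (1 - ?M)"
      using \<delta>(1) by (intro mult_left_mono) auto
    also have "\<dots> \<le> s j * (1 - ?M)"
      using \<delta>(2) norm_trig_mask_le_1[OF p] by (intro mult_right_mono) (auto simp: s_def)
    also have "\<dots> = s j - s (Suc j)"
      by (simp add: s_def orb_Suc fourier_B[OF sa p] norm_mult algebra_simps)
    finally show ?thesis by (simp add: mult.assoc)
  qed
  have "summable (\<lambda>j. \<delta> * (p 1 * p l) * e (Suc j))"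
  proof (rule bounded_imp_summable)
    show "0 \<le> \<delta> * (p 1 * p l) * e (Suc n)" for n using \<delta> c by (simp add: e_def)
    show "(\<Sum>k\<le>n. \<delta> * (p 1 * p l) * e (Suc k)) \<le> 1" for n
    proof -
      have "(\<Sum>k\<le>n. \<delta> * (p 1 * p l) * e (Suc k)) \<le> (\<Sum>k\<le>n. s k - s (Suc k))"
        by (intro sum_mono step)
      also have "\<dots> = s 0 - s (Suc n)" by (rule sum_telescope)
      also have "\<dots> \<le> 1" using s1[of 0] norm_ge_zero[of "fourier \<mu> (orb B \<eta> (Suc n))"]
        unfolding s_def by linarith
      finally show ?thesis .
    qed
  qed
  then have "summable (\<lambda>j. e (Suc j))"
    using \<delta>(1) c by (subst (asm) summable_cmult_iff) auto
  then show ?thesis by (simp add: e_def summable_Suc_iff[of e, unfolded e_def])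
qed

text \<open>The real sequence \<open>x\<close> obeys a monic recurrence \<open>g\<close> exactly, so
  the defect of its rounding is, up to sign, \<open>g\<close> applied to the rounding errors.
  Boundedness of \<open>B\<close> gives the exponential growth bound.\<close>

lemma frequency_recurrence:
  assumes sm: "summable (\<lambda>j. (orb B \<eta> j \<bullet> w - of_int (round (orb B \<eta> j \<bullet> w)))\<^sup>2)"
  shows "\<exists>q. lead_coeff q = 1 \<and> (\<forall>j. shift_act q (\<lambda>j. round (orb B \<eta> j \<bullet> w)) j = 0)"
proof -
  define x where "x j = orb B \<eta> j \<bullet> w" for j
  define K where "K j = round (x j)" for j
  obtain f where f: "f \<noteq> 0" "poly_orb f B \<eta> = 0" using ex_annihilating_poly by blast
  define g where "g = smult (inverse (lead_coeff f)) f"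
  have lg: "lead_coeff g = 1" using f(1) by (simp add: g_def)
  have gx: "shift_act g x j = 0" for j
    using f(2) shift_act_inner_orb[of f B \<eta> w j] by (simp add: g_def shift_act_smult x_def[abs_def])
  have "shift_act g (\<lambda>i. real_of_int (K i)) j = - shift_act g (\<lambda>i. x i - of_int (K i)) j" for j
    by (simp add: shift_act_seq_diff gx)
  then have "summable (\<lambda>j. (shift_act g (\<lambda>i. real_of_int (K i)) j)\<^sup>2)"
    using summable_square_shift_act[OF sm, of g] by (simp add: K_def x_def)
  moreover obtain b where b: "1 \<le> b" "\<And>x. norm (B *v x) \<le> b * norm x" using B_bounded by blast
  have "\<bar>real_of_int (K j)\<bar> \<le> (norm \<eta> * norm w + 1) * b ^ j" for j
  proof -
    have "\<bar>x j\<bar> \<le> norm (orb B \<eta> j) * norm w" unfolding x_def by (rule Cauchy_Schwarz_ineq2)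
    also have "\<dots> \<le> (b ^ j * norm \<eta>) * norm w" using b by (intro mult_right_mono norm_orb_le) auto
    finally have "\<bar>x j\<bar> \<le> norm \<eta> * norm w * b ^ j" by (simp add: mult_ac)
    moreover have "\<bar>of_int (K j) - x j\<bar> \<le> 1/2" unfolding K_def by (rule of_int_round_abs_le)
    moreover have "1 \<le> b ^ j" using b(1) by simp
    ultimately have "\<bar>real_of_int (K j)\<bar> \<le> norm \<eta> * norm w * b ^ j + b ^ j" by linarith
    then show ?thesis by (simp add: algebra_simps)
  qed
  ultimately have "\<exists>q. lead_coeff q = 1 \<and> (\<forall>j. shift_act q K j = 0)"
    using almost_linear_recurrent_int_sequence[OF lg _ _ b(1)] by blast
  then show ?thesis by (simp add: K_def[abs_def] x_def)
qed

definition minimal_annihilator :: "int poly \<Rightarrow> (nat \<Rightarrow> nat \<Rightarrow> int) \<Rightarrow> bool" where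
  "minimal_annihilator q K \<longleftrightarrow> lead_coeff q = 1 \<and> annihilates q K \<and>
    (\<forall>P. lead_coeff P = 1 \<and> annihilates P K \<longrightarrow> degree q \<le> degree P)"

lemma approximation_nonzero:
  assumes "approximates v K" "v \<noteq> 0"
  shows "\<exists>l\<in>{1..m}. \<exists>j. K l j \<noteq> 0"
proof (rule ccontr)
  assume "\<not> ?thesis"
  then have "(\<lambda>j. rpair (orb Bc v j) (d l)) \<longlonglongrightarrow> 0" if "l \<in> {1..m}" for l
    using assms(1) that by (auto simp: approximates_def)
  then show False using eq_0_if_orbit_tendsto_0 assms(2) by blast
qed

lemma orb_B_eq_0_iff: "orb B v j = 0 \<longleftrightarrow> v = 0"
proof
  assume "orb B v j = 0"
  then show "v = 0" using orb_inverse[OF TB, of v j 0] by simp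
qed simp

text \<open>Shifting the sequences as far as it lowers the degree of the annihilator makes its constant
  coefficient nonzero.\<close>

lemma minimal_data:
  assumes sa: "self_affine_measure UNIV m A a p \<mu>" and p: "probability_vector m p"
    and pos: "\<And>l. l \<in> {1..m} \<Longrightarrow> 0 < p l" and nr: "\<not> rajchman UNIV \<mu>"
  obtains v K q \<delta> where "v \<noteq> 0" "0 < \<delta>" "\<And>j. \<delta> \<le> norm (fourier \<mu> (orb B v j))"
    "approximates (cvec_of_real v) K" "minimal_annihilator q K" "coeff q 0 \<noteq> 0" "0 < degree q"
proof -
  obtain \<eta> \<delta> where \<eta>: "\<eta> \<noteq> 0" and \<delta>: "0 < \<delta>" "\<And>j. \<delta> \<le> norm (fourier \<mu> (orb B \<eta> j))"
    using nonrajchman_direction[OF sa p nr] by blast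
  define K where "K l j = round (orb B \<eta> j \<bullet> d l)" for l j
  note sm = frequency_errors_summable[OF sa p pos \<delta>]
  have "\<exists>q. lead_coeff q = 1 \<and> (\<forall>j. shift_act q (K l) j = 0)" if "l \<in> {1..m}" for l
    unfolding K_def using frequency_recurrence[OF sm[OF _ that]] by simp
  then obtain Q where Q: "\<And>l. l \<in> {1..m} \<Longrightarrow> lead_coeff (Q l) = 1"
      "\<And>l j. l \<in> {1..m} \<Longrightarrow> shift_act (Q l) (K l) j = 0"
    by metis
  have Kapp: "approximates (cvec_of_real \<eta>) K"
    unfolding approximates_def
  proof
    fix l assume l: "l \<in> {1..m}"
    have "(\<lambda>j. (orb B \<eta> j \<bullet> d l - of_int (K l j))\<^sup>2) \<longlonglongrightarrow> 0"
      unfolding K_def by (rule summable_LIMSEQ_zero[OF sm[OF _ l]])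
    then have "(\<lambda>j. orb B \<eta> j \<bullet> d l - of_int (K l j)) \<longlonglongrightarrow> 0"
      using tendsto_real_sqrt[of _ 0] by (simp add: tendsto_rabs_zero_iff) 
    then have "(\<lambda>j. complex_of_real (orb B \<eta> j \<bullet> d l - of_int (K l j))) \<longlonglongrightarrow> of_real 0"
      by (rule tendsto_of_real)
    then show "(\<lambda>j. rpair (orb Bc (cvec_of_real \<eta>) j) (d l) - of_int (K l j)) \<longlonglongrightarrow> 0"
      by (simp add: cvec_of_real_orb[symmetric] rpair_cvec_of_real)
  qed
  define ok where "ok q \<longleftrightarrow> lead_coeff q = 1 \<and> (\<exists>s. annihilates q (\<lambda>l j. K l (s + j)))" for q
  have "ok (\<Prod>l\<in>{1..m}. Q l)"
  proof -
    have "shift_act (\<Prod>l\<in>{1..m}. Q l) (K l) j = 0" if l: "l \<in> {1..m}" for l j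
    proof -
      have "(\<Prod>l\<in>{1..m}. Q l) = (\<Prod>k\<in>{1..m} - {l}. Q k) * Q l"
        using l by (simp add: prod.remove mult.commute)
      then show ?thesis by (simp add: shift_act_mult shift_act_eq_0 Q(2)[OF l])
    qed
    moreover have "lead_coeff (\<Prod>l\<in>{1..m}. Q l) = 1"
      unfolding lead_coeff_prod using Q(1) by (intro prod.neutral) simp
    ultimately show ?thesis unfolding ok_def annihilates_def by (intro conjI exI[of _ 0]) auto
  qed
  define q where "q = arg_min degree ok"
  have okq: "ok q" and qmin: "\<And>P. ok P \<Longrightarrow> degree q \<le> degree P"
    using arg_min_nat_lemma[of ok _ degree] \<open>ok (\<Prod>l\<in>{1..m}. Q l)\<close> unfolding q_def by blast+
  then obtain s where s: "annihilates q (\<lambda>l j. K l (s + j))" and lq: "lead_coeff q = 1"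
    by (auto simp: ok_def)
  define v where "v = orb B \<eta> s"
  define K' where "K' = (\<lambda>l j. K l (s + j))"
  have v0: "v \<noteq> 0" using \<eta> by (simp add: v_def orb_B_eq_0_iff)
  have app: "approximates (cvec_of_real v) K'"
    unfolding approximates_def
  proof
    fix l assume l: "l \<in> {1..m}"
    have "(\<lambda>j. rpair (orb Bc (cvec_of_real \<eta>) (j + s)) (d l) - of_int (K l (j + s))) \<longlonglongrightarrow> 0"
      using Kapp l unfolding approximates_def by (intro LIMSEQ_ignore_initial_segment) blast
    then show "(\<lambda>j. rpair (orb Bc (cvec_of_real v) j) (d l) - of_int (K' l j)) \<longlonglongrightarrow> 0"
      by (simp add: v_def K'_def cvec_of_real_orb orb_orb add.commute[of s])
  qed
  have K'0: "\<exists>l\<in>{1..m}. \<exists>j. K' l j \<noteq> 0"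
    using approximation_nonzero[OF app] v0 by simp
  have deg: "0 < degree q"
  proof (rule ccontr)
    assume "\<not> 0 < degree q"
    then have "q = 1" using lq by (metis degree_eq_zeroE gr0I lead_coeff_pCons(2) one_pCons)
    then show False using s K'0 by (auto simp: annihilates_def K'_def)
  qed
  have c0: "coeff q 0 \<noteq> 0"
  proof
    assume "coeff q 0 = 0"
    then obtain q' where q': "q = pCons 0 q'" by (cases q) auto
    then have "q' \<noteq> 0" using deg by auto
    \<comment> \<open>Dropping a factor of the variable amounts to one more shift of the
      sequences.\<close>
    have "ok q'"
      unfolding ok_def
    proof (intro conjI exI[of _ "Suc s"])
      show "lead_coeff q' = 1" using lq q' \<open>q' \<noteq> 0\<close> by simp
      show "annihilates q' (\<lambda>l j. K l (Suc s + j))"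
        using s shift_act_shift[of q' "\<lambda>j. K _ (s + j)" 1]
        by (simp add: annihilates_def q')
    qed
    then show False using qmin[of q'] q' \<open>q' \<noteq> 0\<close> by simp
  qed
  have minann: "minimal_annihilator q K'"
    unfolding minimal_annihilator_def
  proof (intro conjI allI impI)
    fix P assume "lead_coeff P = 1 \<and> annihilates P K'"
    then have "ok P" by (auto simp: ok_def K'_def)
    then show "degree q \<le> degree P" by (rule qmin)
  qed (use lq s in \<open>simp_all add: K'_def\<close>)
  show thesis
    by (rule that[OF v0 \<delta>(1) _ app minann c0 deg]) (simp add: v_def orb_orb \<delta>(2))
qed

end

section \<open>The generalized Pisot data\<close>


context irreducible_ifs
begin

text \<open>Minimality of \<open>q\<close> enters here: a cofactor \<open>r\<close> annihilating all
  sequences would beat \<open>q\<close>. So \<open>r(B) v\<close> with the sequences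
  \<open>shift_act r (K l)\<close> is a nontrivial pair annihilated by the prime
  \<open>f\<close>.\<close>

lemma prime_factor_data:
  assumes ap: "approximates v K" and q: "minimal_annihilator q K" and q0: "coeff q 0 \<noteq> 0"
    and z: "ipoly_at q z = 0"
  obtains f r where "prime f" "lead_coeff f = 1" "q = f * r" "ipoly_at f z = 0" "coeff f 0 \<noteq> 0"
    "approximates (poly_orb (map_poly of_int r) Bc v) (\<lambda>l. shift_act r (K l))"
    "annihilates f (\<lambda>l. shift_act r (K l))"
    "\<exists>l\<in>{1..m}. \<exists>j. shift_act r (K l) j \<noteq> 0"
proof -
  have lq: "lead_coeff q = 1" and an: "annihilates q K"
    and min: "\<And>P. lead_coeff P = 1 \<Longrightarrow> annihilates P K \<Longrightarrow> degree q \<le> degree P"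
    using q by (auto simp: minimal_annihilator_def)
  have "q \<noteq> 0" using lq by auto
  then obtain f where f: "prime f" "f dvd q" "ipoly_at f z = 0"
    using ex_prime_factor_with_root z by blast
  have lf: "lead_coeff f = 1" using prime_dvd_monic_imp_monic[OF f(1,2) lq] .
  obtain r where r: "q = f * r" using f(2) by (rule dvdE)
  have lr: "lead_coeff r = 1" using lq lf by (simp add: r lead_coeff_mult)
  have "coeff f 0 \<noteq> 0" using q0 by (simp add: r coeff_mult)
  moreover have "annihilates f (\<lambda>l. shift_act r (K l))"
    using an by (simp add: annihilates_def r shift_act_mult)
  moreover have "\<exists>l\<in>{1..m}. \<exists>j. shift_act r (K l) j \<noteq> 0"
  proof (rule ccontr)
    assume "\<not> ?thesis"
    then have "annihilates r K" by (auto simp: annihilates_def)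
    then have "degree q \<le> degree r" using lr by (intro min)
    moreover have "degree q = degree f + degree r"
      using r \<open>q \<noteq> 0\<close> by (auto intro: degree_mult_eq)
    ultimately have "degree f = 0" by simp
    then have "f = 1" using lf by (metis degree_eq_zeroE lead_coeff_pCons(2) one_pCons)
    then show False using f(3) by simp
  qed
  ultimately show thesis
    using that[of f r] f lf r approximates_poly_orb[OF ap] by blast
qed

lemma transpose_map_matrix: "transpose (map_matrix complex_of_real A) = Tc"
  by (simp add: vec_eq_iff transpose_def map_matrix_def)

text \<open>The tuple consists of the roots of \<open>f\<close> outside the closed disc; none lies
  on the circle, and one exists since \<open>f\<close> is monic with nonzero constant term. Any
  polynomial admissible for the tuple shares a root with the prime \<open>f\<close> and is a
  multiple of it, so \<open>f\<close> has least degree and decides the type.\<close>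

lemma pisot_data_of_prime:
  assumes ap: "approximates v K" and an: "annihilates f K"
    and f: "prime f" "lead_coeff f = 1" "coeff f 0 \<noteq> 0"
    and K: "\<exists>l\<in>{1..m}. \<exists>j. K l j \<noteq> 0"
    and z: "ipoly_at f z = 0"
  obtains k \<beta> \<zeta> where "generalized_pisot_data m A a k \<beta> \<zeta>"
    "norm z < 1 \<Longrightarrow> pisot_tuple_type_I (\<beta> ` {1..k})"
proof -
  define S where "S = {\<beta>. ipoly_at f \<beta> = 0 \<and> 1 < norm \<beta>}"
  have f0: "f \<noteq> 0" using f(2) by auto
  have F0: "map_poly of_int f \<noteq> (0 :: complex poly)"
    using f0 by (auto simp: poly_eq_iff coeff_map_poly)
  have deg: "0 < degree f"
    using z f0 by (cases "degree f = 0") (auto elim!: degree_eq_zeroE)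
  have big: "1 < norm \<beta>" if "ipoly_at f \<beta> = 0" "1 \<le> norm \<beta>" for \<beta>
    using prime_annihilator_roots(2)[OF ap an f(1,2) K that] .
  have finS: "finite S"
    by (rule finite_subset[OF _ poly_roots_finite[OF F0]]) (auto simp: S_def ipoly_at_def)
  obtain \<beta>0 where \<beta>0: "\<beta>0 \<in> S"
    using monic_int_poly_large_root[OF f(2) deg f(3)] big by (auto simp: S_def)
  have pisot: "pisot_poly S f"
    unfolding pisot_poly_def using f(2) big by (force simp: S_def)
  have tuple: "pisot_tuple S"
    unfolding pisot_tuple_def
  proof (intro conjI ballI)
    fix \<beta> assume \<beta>: "\<beta> \<in> S"
    then show "1 < norm \<beta>" by (simp add: S_def)
    show "algebraic_int \<beta>"
      unfolding algebraic_int_altdef_ipoly using \<beta> f(2)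
      by (intro exI[of _ f]) (simp add: S_def ipoly_at_def)
  qed (use finS \<beta>0 pisot in auto)
  obtain \<beta> where \<beta>: "bij_betw \<beta> {1..card S} S"
    using ex_bij_betw_nat_finite_1[OF finS] by blast
  then have im: "\<beta> ` {1..card S} = S" and inj: "inj_on \<beta> {1..card S}"
    by (auto simp: bij_betw_def)
  obtain R l0 where l0: "l0 \<in> {1..m}"
    and R: "\<And>\<beta> l. ipoly_at f \<beta> = 0 \<Longrightarrow> 1 \<le> norm \<beta> \<Longrightarrow> l \<in> {1..m} \<Longrightarrow>
      rpair (eigenvec f v \<beta>) (d l) = ipoly_at (R l) \<beta>"
    using prime_annihilator_pairing[OF ap an f(1,2) K] by metis
  have data: "generalized_pisot_data m A a (card S) \<beta> (\<lambda>j. eigenvec f v (\<beta> j))"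
    unfolding generalized_pisot_data_def im
  proof (intro conjI ballI)
    show "1 \<le> card S" using finS \<beta>0 by (simp add: Suc_le_eq card_gt_0_iff) blast
    show "inj_on \<beta> {1..card S}" "pisot_tuple S" by fact+
    fix j assume "j \<in> {1..card S}"
    then have "\<beta> j \<in> S" using im by blast
    then have j: "ipoly_at f (\<beta> j) = 0" "1 \<le> norm (\<beta> j)" by (auto simp: S_def)
    show "eigenvec f v (\<beta> j) \<noteq> 0"
      using prime_annihilator_roots(1)[OF ap an f(1,2) K j] .
    have "Tc *v (Bc *v eigenvec f v (\<beta> j)) = Tc *v (\<beta> j *s eigenvec f v (\<beta> j))"
      by (simp only: Bc_eigenvec[OF ap an j(1)])
    then have eq: "eigenvec f v (\<beta> j) = \<beta> j *s (Tc *v eigenvec f v (\<beta> j))"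
      by (simp add: matrix_vector_mul_assoc TcBc vector_scalar_commute)
    have "\<beta> j \<noteq> 0" using j(2) by auto
    then show "transpose (map_matrix complex_of_real A) *v eigenvec f v (\<beta> j)
        = inverse (\<beta> j) *s eigenvec f v (\<beta> j)"
      unfolding transpose_map_matrix by (subst (2) eq) (simp add: vector_smult_assoc)
  next
    fix l assume l: "l \<in> {1..m}"
    show "\<exists>P. \<forall>j\<in>{1..card S}. cinner (eigenvec f v (\<beta> j)) (cvec_of_real (a l - a 1)) = ipoly_at P (\<beta> j)"
    proof (intro exI ballI)
      fix j assume "j \<in> {1..card S}"
      then have "\<beta> j \<in> S" using im by blast
      then show "cinner (eigenvec f v (\<beta> j)) (cvec_of_real (a l - a 1)) = ipoly_at (R l) (\<beta> j)"
        unfolding cinner_cvec_of_real d_def[symmetric] by (intro R l) (auto simp: S_def)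
    qed
  qed
  moreover have "pisot_tuple_type_I (\<beta> ` {1..card S})" if "norm z < 1"
    unfolding im pisot_tuple_type_I_def
  proof (intro conjI exI[of _ f] allI impI tuple pisot)
    show "\<exists>z. ipoly_at f z = 0 \<and> norm z < 1" using z that by blast
    fix Q assume Q: "pisot_poly S Q"
    then have "ipoly_at Q \<beta>0 = 0" "Q \<noteq> 0" using \<beta>0 by (auto simp: pisot_poly_def)
    moreover have "ipoly_at f \<beta>0 = 0" using \<beta>0 by (simp add: S_def)
    ultimately show "degree f \<le> degree Q"
      using f(1) by (intro dvd_imp_degree_le prime_poly_dvd_if_common_root)
  qed
  ultimately show thesis by (rule that)
qed

lemma generalized_pisot_of_root:
  assumes ap: "approximates v K" and q: "minimal_annihilator q K" and q0: "coeff q 0 \<noteq> 0"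
    and z: "ipoly_at q z = 0"
  shows "generalized_pisot_ifs m A a" and "norm z < 1 \<Longrightarrow> generalized_pisot_ifs_type_I m A a"
proof -
  obtain f r where f: "prime f" "lead_coeff f = 1" "ipoly_at f z = 0" "coeff f 0 \<noteq> 0"
    and fr: "approximates (poly_orb (map_poly of_int r) Bc v) (\<lambda>l. shift_act r (K l))"
    "annihilates f (\<lambda>l. shift_act r (K l))"
    "\<exists>l\<in>{1..m}. \<exists>j. shift_act r (K l) j \<noteq> 0"
    using prime_factor_data[OF assms] by metis
  obtain k \<beta> \<zeta> where "generalized_pisot_data m A a k \<beta> \<zeta>"
    "norm z < 1 \<Longrightarrow> pisot_tuple_type_I (\<beta> ` {1..k})"
    using pisot_data_of_prime[OF fr(1,2) f(1,2,4) fr(3) f(3)] by metis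
  then show "generalized_pisot_ifs m A a" "norm z < 1 \<Longrightarrow> generalized_pisot_ifs_type_I m A a"
    using hom by (auto simp: generalized_pisot_ifs_def generalized_pisot_ifs_type_I_def)
qed

text \<open>With \<open>q = f * r\<close>, the quotient of \<open>q\<close> by \<open>x - z\<close>
  is that of \<open>f\<close> times \<open>r\<close>; so the eigenvector from \<open>q\<close> and
  \<open>v\<close> is the one from \<open>f\<close> and \<open>r(B) v\<close>, known to be
  nonzero.\<close>

lemma large_root:
  assumes ap: "approximates v K" and q: "minimal_annihilator q K" and q0: "coeff q 0 \<noteq> 0"
    and z: "ipoly_at q z = 0" "1 \<le> norm z"
  shows "1 < norm z" and "eigenvec q v z \<noteq> 0"
proof -
  obtain f r where f: "prime f" "lead_coeff f = 1" "q = f * r" "ipoly_at f z = 0"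
    and fr: "approximates (poly_orb (map_poly of_int r) Bc v) (\<lambda>l. shift_act r (K l))"
    "annihilates f (\<lambda>l. shift_act r (K l))"
    "\<exists>l\<in>{1..m}. \<exists>j. shift_act r (K l) j \<noteq> 0"
    using prime_factor_data[OF assms(1-4)] by metis
  note roots = prime_annihilator_roots[OF fr(1,2) f(1,2) fr(3) f(4) z(2)]
  show "1 < norm z" by (rule roots)
  have "[:- z, 1:] * synthetic_div (map_poly of_int q) z
      = [:- z, 1:] * (synthetic_div (map_poly of_int f) z * map_poly of_int r)"
    by (metis synthetic_div_root[OF z(1)] synthetic_div_root[OF f(4)] map_poly_of_int_mult f(3) mult.assoc)
  then have "synthetic_div (map_poly of_int q) z = synthetic_div (map_poly of_int f) z * map_poly of_int r"
    by (rule mult_left_cancel[THEN iffD1, rotated]) simp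
  then have "eigenvec q v z = eigenvec f (poly_orb (map_poly of_int r) Bc v) z"
    by (simp add: eigenvec_def poly_orb_mult)
  then show "eigenvec q v z \<noteq> 0" using roots(1) by simp
qed

end

lemma poly_orb_add: "poly_orb (f + g) M v = poly_orb f M v + poly_orb g M v"
  by (simp add: poly_orb_def vec_eq_iff shift_act_add)

text \<open>Applying the cofactor of a root \<open>c\<close> gives a geometric sequence with ratio
  \<open>c\<close> tending to 0, hence zero as \<open>norm c \<ge> 1\<close>; so the cofactor
  already annihilates \<open>u\<close>.\<close>

lemma expanding_recurrence_zero:
  fixes u :: "nat \<Rightarrow> complex"
  assumes "f \<noteq> 0" "\<And>j. shift_act f u j = 0" "u \<longlonglongrightarrow> 0" "\<And>z. poly f z = 0 \<Longrightarrow> 1 \<le> norm z"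
  shows "u j = 0"
  using assms
proof (induction "degree f" arbitrary: f j)
  case 0
  then obtain c where "f = [:c:]" "c \<noteq> 0" by (metis degree_eq_zeroE pCons_0_0)
  then show ?case using 0(3)[of j] by simp
next
  case (Suc n)
  obtain c where c: "poly f c = 0"
    using alg_closed_imp_poly_has_root[of f] Suc.hyps(2) by auto
  then obtain g where g: "f = [:- c, 1:] * g" by (auto simp: poly_eq_0_iff_dvd elim: dvdE)
  have g0: "g \<noteq> 0" using g Suc.prems by auto
  have "degree f = Suc (degree g)" unfolding g using g0 by (subst degree_mult_eq) auto
  then have dg: "n = degree g" using Suc.hyps by simp
  define w where "w = shift_act g u"
  have "w (Suc k) = c * w k" for k
    using Suc.prems(2)[of k] unfolding g shift_act_mult by (simp add: w_def)
  then have w: "w k = c ^ k * w 0" for k by (induction k) simp_all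
  have "w \<longlonglongrightarrow> 0" unfolding w_def by (rule tendsto_shift_act) fact
  moreover have "w = (\<lambda>k. c ^ k * w 0)" using w by (rule ext)
  ultimately have "(\<lambda>k. c ^ k * w 0) \<longlonglongrightarrow> 0" by metis
  then have "w 0 = 0" using Suc.prems(4)[OF c] by (rule eq_0_if_growth_tendsto_0)
  then have "shift_act g u k = 0" for k using w[of k] by (simp add: w_def)
  then show ?case
    using Suc.hyps(1)[OF dg g0 _ Suc.prems(3)] Suc.prems(4) by (simp add: g)
qed

context irreducible_ifs
begin

text \<open>The errors themselves obey the recurrence \<open>q\<close>, since
  \<open>q(B) v = 0\<close> and \<open>q\<close> annihilates the integers. None of its modes decays,
  so errors tending to 0 vanish.\<close>

lemma exact_approximation:
  assumes ap: "approximates v K" and an: "annihilates q K" and lq: "lead_coeff q = 1"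
    and roots: "\<And>z. ipoly_at q z = 0 \<Longrightarrow> 1 \<le> norm z" and l: "l \<in> {1..m}"
  shows "rpair (orb Bc v j) (d l) = of_int (K l j)"
proof -
  let ?q = "map_poly of_int q :: complex poly"
  have "?q \<noteq> 0" using lq by (auto simp: poly_eq_iff coeff_map_poly intro!: exI[of _ "degree q"])
  have "rpair (orb Bc v j) (d l) - of_int (K l j) = 0"
  proof (rule expanding_recurrence_zero[OF \<open>?q \<noteq> 0\<close>])
    show "shift_act ?q (\<lambda>k. rpair (orb Bc v k) (d l) - of_int (K l k)) j = 0" for j
      using an l poly_orb_eq_0[OF ap an] unfolding annihilates_def
      by (simp add: shift_act_seq_diff rpair_poly_orb[symmetric] shift_act_of_int[symmetric])
    show "(\<lambda>k. rpair (orb Bc v k) (d l) - of_int (K l k)) \<longlonglongrightarrow> 0"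
      using ap l by (simp add: approximates_def)
  qed (use roots in \<open>simp add: ipoly_at_def\<close>)
  then show ?thesis by simp
qed

text \<open>Let \<open>h\<close> be a complex annihilator of \<open>v\<close> of least degree, a
  divisor of \<open>q\<close>. At a root \<open>\<beta>\<close> of a nonconstant cofactor the
  quotient of \<open>q\<close> by \<open>x - \<beta>\<close> would still be a multiple of
  \<open>h\<close>, making an eigenvector vanish.\<close>

lemma degree_annihilator_ge:
  assumes ap: "approximates v K" and q: "minimal_annihilator q K" and q0: "coeff q 0 \<noteq> 0"
    and roots: "\<And>z. ipoly_at q z = 0 \<Longrightarrow> 1 \<le> norm z"
    and g: "g \<noteq> 0" "poly_orb g Bc v = 0"
  shows "degree q \<le> degree g"
proof -
  let ?q = "map_poly of_int q :: complex poly"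
  have lq: "lead_coeff q = 1" and an: "annihilates q K"
    using q by (auto simp: minimal_annihilator_def)
  have q0: "?q \<noteq> 0" using lq by (auto simp: poly_eq_iff coeff_map_poly intro!: exI[of _ "degree q"])
  define h where "h = arg_min degree (\<lambda>g. g \<noteq> 0 \<and> poly_orb g Bc v = 0)"
  have h: "h \<noteq> 0" "poly_orb h Bc v = 0"
    and min: "\<And>g. g \<noteq> 0 \<and> poly_orb g Bc v = 0 \<Longrightarrow> degree h \<le> degree g"
    using arg_min_nat_lemma[of "\<lambda>g. g \<noteq> 0 \<and> poly_orb g Bc v = 0" g degree] g
    by (auto simp: h_def)
  have "poly_orb ?q Bc v = poly_orb (?q div h * h) Bc v + poly_orb (?q mod h) Bc v"
    by (simp flip: poly_orb_add)
  then have "poly_orb (?q mod h) Bc v = 0"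
    using poly_orb_eq_0[OF ap an] h(2) by (simp add: poly_orb_mult)
  then have "?q mod h = 0"
    using min[of "?q mod h"] degree_mod_less[OF h(1), of ?q] by (metis not_less)
  then have qh: "?q = ?q div h * h" by (metis add.right_neutral div_mult_mod_eq)
  have "degree (?q div h) = 0"
  proof (rule ccontr)
    assume "degree (?q div h) \<noteq> 0"
    then obtain \<beta> where "poly (?q div h) \<beta> = 0"
      using alg_closed_imp_poly_has_root[of "?q div h"] by auto
    then obtain u where u: "?q div h = [:- \<beta>, 1:] * u" by (auto simp: poly_eq_0_iff_dvd elim: dvdE)
    have "poly ?q \<beta> = 0" by (subst qh) (simp add: u)
    then have root: "ipoly_at q \<beta> = 0" by (simp add: ipoly_at_def)
    have "[:- \<beta>, 1:] * synthetic_div ?q \<beta> = [:- \<beta>, 1:] * (u * h)"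
      unfolding synthetic_div_root[OF root, symmetric] mult.assoc[symmetric] u[symmetric] by (rule qh)
    then have "synthetic_div ?q \<beta> = u * h"
      by (rule mult_left_cancel[THEN iffD1, rotated]) simp
    then have "eigenvec q v \<beta> = 0" using h(2) by (simp add: eigenvec_def poly_orb_mult)
    then show False using large_root(2)[OF ap q assms(3) root roots[OF root]] by simp
  qed
  then have "degree ?q = degree h"
    using degree_mult_eq[of "?q div h" h] q0 qh h(1) by (metis add_0 mult_eq_0_iff)
  then show ?thesis using min[of g] g lq by (simp add: degree_map_poly)
qed

end

section \<open>The integral factor\<close>


text \<open>The supremum defining the spectral radius is meaningful only over a nonempty set. A root
  of a least-degree annihilator of one nonzero vector is an eigenvalue.\<close>

lemma spectrum_nonempty:
  fixes M :: "complex^'n::finite^'n"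
  shows "spectrum M \<noteq> {}"
proof -
  obtain i :: 'n where True by simp
  define v :: "complex^'n" where "v = axis i 1"
  have v: "v \<noteq> 0" by (simp add: v_def axis_eq_0_iff)
  obtain f0 where f0: "f0 \<noteq> 0 \<and> poly_orb f0 M v = 0" using ex_annihilating_poly by blast
  define f where "f = arg_min degree (\<lambda>f. f \<noteq> 0 \<and> poly_orb f M v = 0)"
  have f: "f \<noteq> 0" "poly_orb f M v = 0"
    and min: "\<And>g. g \<noteq> 0 \<and> poly_orb g M v = 0 \<Longrightarrow> degree f \<le> degree g"
    using arg_min_nat_lemma[of "\<lambda>f. f \<noteq> 0 \<and> poly_orb f M v = 0" f0 degree] f0
    by (auto simp: f_def)
  have "degree f > 0"
  proof (rule ccontr)
    assume "\<not> degree f > 0"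
    then obtain c where "f = [:c:]" "c \<noteq> 0" using f(1) by (auto elim: degree_eq_zeroE)
    then show False using f(2) v by (simp add: vec_eq_iff)
  qed
  then obtain c where "poly f c = 0" using alg_closed_imp_poly_has_root by blast
  then obtain g where g: "f = [:- c, 1:] * g" by (auto simp: poly_eq_0_iff_dvd elim: dvdE)
  have g0: "g \<noteq> 0" using g f by auto
  have "degree f = Suc (degree g)" unfolding g using g0 by (subst degree_mult_eq) auto
  then have "poly_orb g M v \<noteq> 0" using min[of g] g0 by auto
  moreover have "M *v poly_orb g M v = c *s poly_orb g M v"
    using f(2) unfolding g poly_orb_mult poly_orb_linear_factor by simp
  ultimately show ?thesis unfolding spectrum_def by blast
qed

lemma orth_proj:
  fixes V :: "(real^'n::finite) set"
  assumes V: "subspace V"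
  shows "orth_proj V x \<in> V" and "w \<in> V \<Longrightarrow> w \<bullet> orth_proj V x = w \<bullet> x"
proof -
  obtain y z where yz: "y \<in> span V" "\<And>w. w \<in> span V \<Longrightarrow> orthogonal z w" "x = y + z"
    using orthogonal_subspace_decomp_exists by metis
  have sV: "span V = V" using V by (simp add: span_eq_iff)
  have "orth_proj V x \<in> V \<and> (\<forall>v\<in>V. orthogonal (x - orth_proj V x) v)"
    unfolding orth_proj_def
  proof (rule theI[of _ y])
    show "y \<in> V \<and> (\<forall>v\<in>V. orthogonal (x - y) v)" using yz sV by simp
    fix y' assume y': "y' \<in> V \<and> (\<forall>v\<in>V. orthogonal (x - y') v)"
    then have "y' - y \<in> V" using yz(1) sV V by (simp add: subspace_diff)
    then have "(x - y) \<bullet> (y' - y) = 0" "(x - y') \<bullet> (y' - y) = 0"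
      using y' yz sV by (simp_all add: orthogonal_def)
    then have "(y' - y) \<bullet> (y' - y) = 0" by (simp add: inner_diff_left)
    then show "y' = y" by simp
  qed
  then show "orth_proj V x \<in> V" "w \<in> V \<Longrightarrow> w \<bullet> orth_proj V x = w \<bullet> x"
    by (auto simp: orthogonal_def inner_diff_left inner_commute[of w])
qed

text \<open>Coordinates of the factor are indexed by a subset \<open>J\<close> of \<open>'n\<close>,
  the basis \<open>B^i v\<close> by exponents below \<open>degree q\<close>; \<open>e\<close>
  translates between the two.\<close>

locale lattice_direction = irreducible_ifs A a m
  for A :: "real^'n::finite^'n" and a :: "nat \<Rightarrow> real^'n" and m :: nat +
  fixes v :: "real^'n" and q :: "int poly" and J :: "'n set" and e :: "'n \<Rightarrow> nat"
  assumes lq: "lead_coeff q = 1" and deg: "0 < degree q"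
    and qv: "poly_orb (map_poly of_int q) B v = 0"
    and indep: "\<And>c i. (\<Sum>i<degree q. c i *\<^sub>R orb B v i) = 0 \<Longrightarrow> i < degree q \<Longrightarrow> c i = 0"
    and roots: "\<And>z. ipoly_at q z = 0 \<Longrightarrow> 1 < norm z"
    and ints: "\<And>l j. l \<in> {1..m} \<Longrightarrow> orb B v j \<bullet> d l \<in> \<int>"
    and e: "bij_betw e J {..<degree q}"
begin

definition "w i = orb B v (e i)"
definition "V = span (w ` J)"

lemma J_nonempty: "J \<noteq> {}"
  using e deg by (auto simp: bij_betw_def)

lemma e_less: "i \<in> J \<Longrightarrow> e i < degree q"
  using e by (auto simp: bij_betw_def)

lemma sum_w: "(\<Sum>i\<in>J. c (e i) *\<^sub>R w i) = (\<Sum>k<degree q. c k *\<^sub>R orb B v k)"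
  unfolding w_def by (rule sum.reindex_bij_betw[OF e])

lemma w_indep:
  assumes "(\<Sum>i\<in>J. c i *\<^sub>R w i) = (\<Sum>i\<in>J. c' i *\<^sub>R w i)" "i \<in> J"
  shows "c i = c' i"
proof -
  define e' where "e' = inv_into J e"
  have e': "e' (e i) = i" if "i \<in> J" for i
    using e that by (simp add: e'_def bij_betw_def inv_into_f_f)
  have "(\<Sum>i\<in>J. (c (e' (e i)) - c' (e' (e i))) *\<^sub>R w i) = (\<Sum>i\<in>J. c i *\<^sub>R w i) - (\<Sum>i\<in>J. c' i *\<^sub>R w i)"
    by (simp add: e' scaleR_diff_left sum_subtractf)
  then have "(\<Sum>k<degree q. (c (e' k) - c' (e' k)) *\<^sub>R orb B v k) = 0"
    using assms(1) sum_w[of "\<lambda>k. c (e' k) - c' (e' k)"] by simp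
  from indep[OF this e_less[OF assms(2)]] show ?thesis by (simp add: e' assms(2))
qed

lemma inj_w: "inj_on w J"
proof
  fix i j assume ij: "i \<in> J" "j \<in> J" "w i = w j"
  have "(\<Sum>k\<in>J. (if k = i then 1 else 0) *\<^sub>R w k) = (\<Sum>k\<in>J. (if k = j then 1 else 0) *\<^sub>R w k)"
    using ij by (simp add: if_distrib[where f = "\<lambda>c. c *\<^sub>R _"] cong: if_cong)
  from w_indep[OF this ij(1)] show "i = j" by (simp split: if_splits)
qed

lemma V_coords:
  assumes "x \<in> V"
  obtains c where "x = (\<Sum>i\<in>J. c i *\<^sub>R w i)"
proof -
  have "x \<in> range (\<lambda>u. \<Sum>y\<in>w ` J. u y *\<^sub>R y)"
    using assms unfolding V_def by (subst (asm) span_finite) auto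
  then obtain u where "x = (\<Sum>y\<in>w ` J. u y *\<^sub>R y)" by blast
  then have "x = (\<Sum>i\<in>J. u (w i) *\<^sub>R w i)" by (simp add: sum.reindex[OF inj_w])
  then show thesis by (rule that)
qed

lemma subspace_V: "subspace V"
  by (simp add: V_def)

lemma w_in_V: "i \<in> J \<Longrightarrow> w i \<in> V"
  by (simp add: V_def span_base)

lemma dim_V: "dim V = card J"
proof -
  have "independent (w ` J)"
  proof (rule independent_if_scalars_zero)
    fix f y assume s: "(\<Sum>y\<in>w ` J. f y *\<^sub>R y) = 0" and "y \<in> w ` J"
    then obtain i where i: "i \<in> J" "y = w i" by blast
    have "(\<Sum>i\<in>J. f (w i) *\<^sub>R w i) = (\<Sum>i\<in>J. 0 *\<^sub>R w i)"
      using s by (simp add: sum.reindex[OF inj_w])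
    from w_indep[OF this i(1)] show "f y = 0" by (simp add: i)
  qed simp
  then show ?thesis
    by (simp add: V_def dim_eq_card_independent card_image[OF inj_w])
qed

text \<open>Row \<open>i\<close> holds the coordinates of \<open>B *v w i\<close> in the basis
  \<open>w\<close>. The last exponent is handled by \<open>q(B) v = 0\<close>; since
  \<open>q\<close> is monic and integral, all entries are integers.\<close>

definition companion :: "real^'n^'n" where
  "companion = (\<chi> i j. if i \<in> J \<and> j \<in> J then
     (if Suc (e i) < degree q then (if e j = Suc (e i) then 1 else 0) else - of_int (coeff q (e j)))
     else 0)"

lemma B_w:
  assumes i: "i \<in> J"
  shows "B *v w i = (\<Sum>j\<in>J. companion $ i $ j *\<^sub>R w j)"
proof (cases "Suc (e i) < degree q")
  case True
  have "(\<Sum>j\<in>J. companion $ i $ j *\<^sub>R w j)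
      = (\<Sum>j\<in>J. (if e j = Suc (e i) then 1 else 0) *\<^sub>R w j)"
    using i True by (intro sum.cong) (auto simp: companion_def)
  also have "\<dots> = (\<Sum>k<degree q. (if k = Suc (e i) then 1 else 0) *\<^sub>R orb B v k)"
    by (rule sum_w[of "\<lambda>k. if k = Suc (e i) then 1 else 0"])
  also have "\<dots> = orb B v (Suc (e i))"
    using True by (simp add: if_distrib[where f = "\<lambda>c. c *\<^sub>R _"] cong: if_cong)
  finally show ?thesis by (simp add: w_def orb_Suc)
next
  case False
  then have ei: "Suc (e i) = degree q" using e_less[OF i] by simp
  have "(\<Sum>j\<in>J. companion $ i $ j *\<^sub>R w j) = (\<Sum>j\<in>J. (- of_int (coeff q (e j))) *\<^sub>R w j)"
    using i False by (intro sum.cong) (auto simp: companion_def)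
  also have "\<dots> = (\<Sum>k<degree q. (- of_int (coeff q k)) *\<^sub>R orb B v k)"
    by (rule sum_w[of "\<lambda>k. - of_int (coeff q k)"])
  also have "\<dots> = orb B v (degree q)"
  proof -
    have dq: "degree (map_poly real_of_int q) = degree q" by (simp add: degree_map_poly)
    have "(\<Sum>k\<le>degree q. of_int (coeff q k) *\<^sub>R orb B v k) = poly_orb (map_poly of_int q) B v"
      by (simp add: poly_orb_def vec_eq_iff shift_act_def dq coeff_map_poly)
    then have "(\<Sum>k<degree q. of_int (coeff q k) *\<^sub>R orb B v k) + orb B v (degree q) = 0"
      using qv lq by (simp add: lessThan_Suc_atMost[symmetric])
    from minus_unique[OF this] show ?thesis by (simp add: sum_negf)
  qed
  finally show ?thesis by (simp add: w_def ei[symmetric] orb_Suc)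
qed

lemma B_image_V: "(*v) B ` V = V"
proof (rule subspace_dim_equal)
  have inj: "inj ((*v) B)"
    by (metis TB inj_on_inverseI matrix_vector_mul_assoc matrix_vector_mul_lid)
  show "(*v) B ` V \<subseteq> V"
  proof
    fix y assume "y \<in> (*v) B ` V"
    then obtain x where x: "x \<in> V" "y = B *v x" by blast
    obtain c where c: "x = (\<Sum>i\<in>J. c i *\<^sub>R w i)" using V_coords[OF x(1)] .
    have "y = (\<Sum>i\<in>J. c i *\<^sub>R (B *v w i))"
      by (simp add: x(2) c linear_sum[OF matrix_vector_mul_linear] linear_scale[OF matrix_vector_mul_linear])
    also have "\<dots> \<in> V"
      by (intro subspace_sum[OF subspace_V] subspace_scale[OF subspace_V])
        (simp add: B_w subspace_sum[OF subspace_V] subspace_scale[OF subspace_V] w_in_V)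
    finally show "y \<in> V" .
  qed
  have "dim ((*v) B ` V) = dim V"
    by (rule dim_image_eq) (auto intro: inj_on_subset[OF inj])
  then show "dim V \<le> dim ((*v) B ` V)" by simp
qed (simp_all add: subspace_V linear_subspace_image)

text \<open>\<open>B\<close> maps \<open>V\<close> onto itself by equality of dimensions, so its
  inverse preserves \<open>V\<close> too.\<close>

lemma T_in_V:
  assumes "x \<in> V"
  shows "transpose A *v x \<in> V"
proof -
  have "x \<in> (*v) B ` V" using assms unfolding B_image_V .
  then obtain y where "y \<in> V" "x = B *v y" by (rule imageE)
  then show ?thesis by (simp only: matrix_vector_mul_assoc TB matrix_vector_mul_lid)
qed

lemma orb_in_V: "orb B v k \<in> V"
proof (induction k)
  case 0
  have "0 \<in> e ` J" using e deg by (simp add: bij_betw_def)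
  then obtain i where "i \<in> J" "e i = 0" by auto
  then show ?case using w_in_V[of i] by (simp add: w_def)
next
  case (Suc k)
  then show ?case using B_image_V by (auto simp: orb_Suc)
qed

lemma ex_T_coords: "\<exists>c. transpose A *v w i = (\<Sum>j\<in>J. c j *\<^sub>R w j)" if "i \<in> J"
  using V_coords[OF T_in_V[OF w_in_V[OF that]]] by metis

text \<open>Rows are the coordinates of \<open>transpose A *v w i\<close>, so that the pairings
  \<open>w i \<bullet> x\<close> transform by this very matrix when \<open>A\<close> acts on
  \<open>x\<close>.\<close>

definition factor_matrix :: "real^'n^'n" where
  "factor_matrix = (\<chi> i j. if i \<in> J \<and> j \<in> J then
     (SOME c. transpose A *v w i = (\<Sum>j\<in>J. c j *\<^sub>R w j)) j else 0)"

lemma T_w: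
  assumes i: "i \<in> J"
  shows "transpose A *v w i = (\<Sum>j\<in>J. factor_matrix $ i $ j *\<^sub>R w j)"
proof -
  have "(\<Sum>j\<in>J. factor_matrix $ i $ j *\<^sub>R w j)
      = (\<Sum>j\<in>J. (SOME c. transpose A *v w i = (\<Sum>j\<in>J. c j *\<^sub>R w j)) j *\<^sub>R w j)"
    using i by (intro sum.cong) (auto simp: factor_matrix_def)
  then show ?thesis using someI_ex[OF ex_T_coords[OF i]] by simp
qed

text \<open>Row coordinates reverse composition: \<open>P ** Q\<close> describes \<open>N\<close>
  after \<open>M\<close> on the basis \<open>w\<close>.\<close>

lemma matrix_on_mult_eq_mat1:
  assumes P: "matrix_on J P" and Q: "matrix_on J Q"
    and Pw: "\<And>i. i \<in> J \<Longrightarrow> M *v w i = (\<Sum>j\<in>J. P $ i $ j *\<^sub>R w j)"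
    and Qw: "\<And>i. i \<in> J \<Longrightarrow> N *v w i = (\<Sum>j\<in>J. Q $ i $ j *\<^sub>R w j)"
    and NM: "N ** M = mat 1"
  shows "P ** Q = mat1_on J"
proof -
  have outside: "(P ** Q) $ i $ k = 0" if "i \<notin> J \<or> k \<notin> J" for i k
    using that P Q by (auto simp: matrix_matrix_mult_def matrix_on_def intro!: sum.neutral)
  have "(P ** Q) $ i $ k = (if i = k then 1 else 0)" if ik: "i \<in> J" "k \<in> J" for i k
  proof -
    have PQ: "(P ** Q) $ i $ k = (\<Sum>j\<in>J. P $ i $ j * Q $ j $ k)" for k
      unfolding matrix_matrix_mult_def vec_lambda_beta
      by (rule sum.mono_neutral_right) (use P in \<open>auto simp: matrix_on_def\<close>)
    have "(\<Sum>k\<in>J. (P ** Q) $ i $ k *\<^sub>R w k) = (\<Sum>k\<in>J. \<Sum>j\<in>J. (P $ i $ j * Q $ j $ k) *\<^sub>R w k)"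
      by (simp add: PQ scaleR_sum_left)
    also have "\<dots> = (\<Sum>j\<in>J. P $ i $ j *\<^sub>R (\<Sum>k\<in>J. Q $ j $ k *\<^sub>R w k))"
      by (subst sum.swap) (simp add: scaleR_sum_right)
    also have "\<dots> = (\<Sum>j\<in>J. P $ i $ j *\<^sub>R (N *v w j))" by (simp add: Qw)
    also have "\<dots> = N *v (M *v w i)"
      by (simp add: Pw[OF ik(1)] linear_sum[OF matrix_vector_mul_linear] linear_scale[OF matrix_vector_mul_linear])
    also have "\<dots> = w i" by (simp add: matrix_vector_mul_assoc NM)
    also have "\<dots> = (\<Sum>k\<in>J. (if i = k then 1 else 0) *\<^sub>R w k)"
      using ik by (simp add: if_distrib[where f = "\<lambda>c. c *\<^sub>R _"] cong: if_cong)
    finally show ?thesis using ik(2) by (rule w_indep)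
  qed
  then have "(P ** Q) $ i $ k = (if i = k \<and> i \<in> J then 1 else 0)" for i k
    using outside by (cases "i \<in> J \<and> k \<in> J") auto
  then show ?thesis by (simp add: mat1_on_def vec_eq_iff)
qed

lemma matrix_on_factor: "matrix_on J factor_matrix" "matrix_on J companion"
  by (auto simp: matrix_on_def factor_matrix_def companion_def)

lemma inverse_factor: "inverse_on J factor_matrix companion"
  unfolding inverse_on_def
  using matrix_on_mult_eq_mat1[OF matrix_on_factor T_w B_w BT]
    matrix_on_mult_eq_mat1[OF matrix_on_factor(2,1) B_w T_w TB] matrix_on_factor by blast

lemma companion_Ints: "companion $ i $ j \<in> \<int>"
  by (simp add: companion_def)

text \<open>The shift rows make the coordinates of the eigenvector geometric with ratio
  \<open>y\<close>; the last row then says that \<open>q(y)\<close> times the initial coordinate is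
  0, and that coordinate cannot vanish.\<close>

lemma companion_eigenvector_root:
  fixes z :: "complex^'n"
  assumes z: "z \<noteq> 0" "\<And>i. i \<notin> J \<Longrightarrow> z $ i = 0"
    and ev: "map_matrix complex_of_real companion *v z = y *s z"
  shows "ipoly_at q y = 0"
proof -
  define e' where "e' = inv_into J e"
  have e': "e' (e i) = i" if "i \<in> J" for i
    using e that by (simp add: e'_def bij_betw_def inv_into_f_f)
  have ee': "e' k \<in> J" "e (e' k) = k" if "k < degree q" for k
    using e that by (auto simp: e'_def bij_betw_def inv_into_into f_inv_into_f)
  have row: "y * z $ i = (\<Sum>j\<in>J. complex_of_real (companion $ i $ j) * z $ j)" for i
  proof -
    have "y * z $ i = (map_matrix complex_of_real companion *v z) $ i" by (simp add: ev)
    also have "\<dots> = (\<Sum>j\<in>UNIV. complex_of_real (companion $ i $ j) * z $ j)"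
      by (simp add: matrix_vector_mult_def map_matrix_def)
    also have "\<dots> = (\<Sum>j\<in>J. complex_of_real (companion $ i $ j) * z $ j)"
      by (rule sum.mono_neutral_right) (use z(2) in auto)
    finally show ?thesis .
  qed
  have next_coord: "z $ e' (Suc k) = y * z $ e' k" if k: "Suc k < degree q" for k
  proof -
    have kJ: "e' k \<in> J" "e (e' k) = k" using ee'[of k] k by auto
    have iff: "e j = Suc k \<longleftrightarrow> j = e' (Suc k)" if "j \<in> J" for j
      using ee'[OF k] e'[OF that] by auto
    have "y * z $ e' k = (\<Sum>j\<in>J. (if j = e' (Suc k) then z $ j else 0))"
      unfolding row using kJ k by (intro sum.cong) (simp_all add: companion_def iff)
    then show ?thesis using ee'[OF k] by simp
  qed
  have coords: "z $ e' k = y ^ k * z $ e' 0" if "k < degree q" for k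
    using that by (induction k) (simp_all add: next_coord)
  obtain i where i: "z $ i \<noteq> 0" using z(1) by (auto simp: vec_eq_iff)
  then have "i \<in> J" using z(2) by blast
  then have z0: "z $ e' 0 \<noteq> 0"
    using coords[of "e i"] e_less[of i] e'[of i] i by auto
  define D where "D = degree q - 1"
  have D: "Suc D = degree q" using deg by (simp add: D_def)
  then have DJ: "e' D \<in> J" "e (e' D) = D" using ee'[of D] by auto
  have "y * z $ e' D = (\<Sum>j\<in>J. - of_int (coeff q (e j)) * z $ e' (e j))"
    unfolding row using DJ D e' by (intro sum.cong) (auto simp: companion_def)
  also have "\<dots> = (\<Sum>k<degree q. - of_int (coeff q k) * z $ e' k)"
    by (rule sum.reindex_bij_betw[OF e])
  also have "\<dots> = (\<Sum>k<degree q. - of_int (coeff q k) * (y ^ k * z $ e' 0))"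
  proof (rule sum.cong)
    fix k assume "k \<in> {..<degree q}"
    then show "- of_int (coeff q k) * z $ e' k = - of_int (coeff q k) * (y ^ k * z $ e' 0)"
      using coords[of k] by simp
  qed simp
  finally have last: "y * z $ e' D = - ((\<Sum>k<degree q. of_int (coeff q k) * y ^ k) * z $ e' 0)"
    by (simp only: sum_distrib_right sum_negf[symmetric] mult.assoc mult_minus_left)
  have "y * z $ e' D = y ^ degree q * z $ e' 0"
    using coords[of D] by (simp flip: D)
  moreover have "(\<Sum>k\<le>degree q. of_int (coeff q k) * y ^ k)
      = (\<Sum>k<degree q. of_int (coeff q k) * y ^ k) + y ^ degree q"
    using lq by (simp add: lessThan_Suc_atMost[symmetric])
  ultimately have "(\<Sum>k\<le>degree q. of_int (coeff q k) * y ^ k) * z $ e' 0 = 0"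
    using last by (simp add: distrib_right) (metis add.right_inverse)
  then have "(\<Sum>k\<le>degree q. of_int (coeff q k) * y ^ k) = 0" using z0 by simp
  then show ?thesis by (simp add: ipoly_at_def poly_altdef degree_map_poly coeff_map_poly)
qed

text \<open>An eigenvector for a nonzero eigenvalue is supported in \<open>J\<close> and is one of
  the companion matrix for the inverse eigenvalue, a root of \<open>q\<close> and so of modulus
  above 1.\<close>

lemma spectral_radius_factor: "spectral_radius factor_matrix < 1"
proof -
  let ?M = "map_matrix complex_of_real factor_matrix"
  let ?C = "map_matrix complex_of_real companion"
  have sub: "spectrum ?M \<subseteq> insert 0 (inverse ` {z. ipoly_at q z = 0})"
  proof
    fix c assume "c \<in> spectrum ?M"
    then obtain z where z: "z \<noteq> 0" "?M *v z = c *s z" by (auto simp: spectrum_def)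
    show "c \<in> insert 0 (inverse ` {z. ipoly_at q z = 0})"
    proof (cases "c = 0")
      case False
      have zJ: "z $ i = 0" if "i \<notin> J" for i
      proof -
        have "c * z $ i = (?M *v z) $ i" by (simp add: z)
        also have "\<dots> = 0" using that by (simp add: matrix_vector_mult_def map_matrix_def factor_matrix_def)
        finally show ?thesis using False by simp
      qed
      have "?C ** ?M = map_matrix complex_of_real (companion ** factor_matrix)"
        by (simp add: vec_eq_iff map_matrix_def matrix_matrix_mult_def)
      then have CM: "?C ** ?M = map_matrix complex_of_real (mat1_on J)"
        using inverse_factor by (simp add: inverse_on_def)
      have "?C *v (c *s z) = (?C ** ?M) *v z" by (simp add: z(2)[symmetric] matrix_vector_mul_assoc)
      also have "\<dots> = z"
      proof -
        have "(\<Sum>j\<in>UNIV. complex_of_real (mat1_on J $ i $ j) * z $ j) = z $ i" for i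
        proof -
          have "(\<Sum>j\<in>UNIV. complex_of_real (mat1_on J $ i $ j) * z $ j) = (\<Sum>j\<in>UNIV. if j = i then z $ i else 0)"
            by (intro sum.cong) (auto simp: mat1_on_def zJ)
          then show ?thesis by simp
        qed
        then show ?thesis unfolding CM by (simp add: vec_eq_iff matrix_vector_mult_def map_matrix_def)
      qed
      finally have "c *s (?C *v z) = z" by (simp add: vector_scalar_commute)
      then have "inverse c *s z = inverse c *s (c *s (?C *v z))" by simp
      then have "?C *v z = inverse c *s z" using False by (simp add: vector_smult_assoc)
      then have "ipoly_at q (inverse c) = 0" using companion_eigenvector_root[OF z(1) zJ] by blast
      then show ?thesis by (metis (mono_tags) image_eqI insertCI inverse_inverse_eq mem_Collect_eq)
    qed simp
  qed
  have "map_poly of_int q \<noteq> (0 :: complex poly)"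
    using lq by (auto simp: poly_eq_iff coeff_map_poly intro!: exI[of _ "degree q"])
  then have "finite {z. ipoly_at q z = 0}"
    unfolding ipoly_at_def by (rule poly_roots_finite)
  then have fin: "finite (spectrum ?M)" by (intro finite_subset[OF sub]) auto
  have less: "norm c < 1" if c: "c \<in> spectrum ?M" for c
  proof -
    have "c = 0 \<or> (\<exists>z. ipoly_at q z = 0 \<and> c = inverse z)" using sub c by blast
    then show ?thesis using roots by (auto simp: norm_inverse inverse_less_1_iff)
  qed
  show ?thesis
    unfolding spectral_radius_def
    using fin spectrum_nonempty[of ?M] less by (subst finite_Sup_less_iff) auto
qed

section \<open>The chart onto the coordinate space\<close>

definition "x1 = (SOME x. A *v x + a 1 = x)"

lemma x1: "A *v x1 + a 1 = x1"
  unfolding x1_def by (rule someI_ex[OF fixed_point])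

text \<open>Coordinates are pairings with the basis \<open>w\<close>, not expansion coefficients in
  it: this makes \<open>b l\<close> integral, because the numbers
  \<open>orb B v j \<bullet> d l\<close> are. Centring the chart at the fixed point of the first map
  leaves only the differences \<open>d l\<close> as translations.\<close>

definition "L x = (\<chi> i. if i \<in> J then w i \<bullet> x else 0)"
definition "chart x = L (x - x1)"
definition "b l = L (d l)"

lemma linear_L: "linear L"
  unfolding L_def by (rule linearI) (auto simp: vec_eq_iff inner_add_right)

lemma chart_altdef: "chart x = L x + (- L x1)"
  by (simp add: chart_def linear_diff[OF linear_L])

lemma L_coord: "L x \<in> coord_space J"
  by (simp add: L_def coord_space_def)

lemma subspace_coord: "subspace (coord_space J :: (real^'n) set)"
  by (auto simp: coord_space_def subspace_def)

lemma chart_coord: "chart x \<in> coord_space J"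
  by (simp add: chart_def L_coord)

lemma inj_L: "inj_on L V"
proof (rule linear_inj_on_iff_eq_0[THEN iffD2, OF linear_L subspace_V], intro ballI impI)
  fix x assume x: "x \<in> V" "L x = 0"
  obtain c where c: "x = (\<Sum>i\<in>J. c i *\<^sub>R w i)" using V_coords[OF x(1)] .
  have "w i \<bullet> x = 0" if "i \<in> J" for i
    using x(2) that by (auto simp: L_def vec_eq_iff dest!: spec[of _ i])
  then have "x \<bullet> x = 0" by (subst (1) c) (simp add: inner_sum_left)
  then show "x = 0" by simp
qed

lemma L_image: "L ` V = coord_space J"
proof (rule subspace_dim_equal)
  have "dim (L ` V) = dim V"
    using inj_L by (intro dim_image_eq linear_L) (simp add: subspace_V span_eq_iff[THEN iffD2])
  then show "dim (coord_space J) \<le> dim (L ` V)" by (simp add: dim_V dim_coord_space)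
qed (auto simp: L_coord subspace_coord linear_subspace_image[OF linear_L subspace_V])

lemma chart_bij: "bij_betw chart V (coord_space J)"
proof (rule bij_betw_imageI)
  show "inj_on chart V" using inj_L by (auto simp: inj_on_def chart_altdef)
  show "chart ` V = coord_space J"
  proof
    show "coord_space J \<subseteq> chart ` V"
    proof
      fix y :: "real^'n" assume "y \<in> coord_space J"
      then have "y + L x1 \<in> L ` V" unfolding L_image
        by (intro subspace_add[OF subspace_coord] L_coord)
      then obtain x where "x \<in> V" "y + L x1 = L x" by blast
      then show "y \<in> chart ` V" by (intro image_eqI[of _ _ x]) (simp_all add: chart_altdef flip: \<open>y + L x1 = L x\<close>)
    qed
  qed (auto simp: chart_coord)
qed

text \<open>Each \<open>w i \<bullet> (A *v y)\<close> depends on \<open>y\<close> only through its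
  pairings with \<open>w\<close>. The relation holds on the whole space, so \<open>\<mu>\<close> can
  be pushed forward without first projecting to \<open>V\<close>.\<close>

lemma chart_intertwines: "chart (A *v x + a l) = ifs_map factor_matrix b l (chart x)"
proof -
  have "w i \<bullet> (A *v y) = (\<Sum>j\<in>J. factor_matrix $ i $ j * (w j \<bullet> y))" if "i \<in> J" for i y
  proof -
    have "w i \<bullet> (A *v y) = (transpose A *v w i) \<bullet> y"
      by (simp add: dot_lmul_matrix)
    then show ?thesis unfolding T_w[OF that] by (simp add: inner_sum_left)
  qed
  moreover have "(\<Sum>j\<in>UNIV. factor_matrix $ i $ j * (if j \<in> J then w j \<bullet> y else 0))
      = (\<Sum>j\<in>J. factor_matrix $ i $ j * (w j \<bullet> y))" for i y
    by (rule sum.mono_neutral_cong_right) auto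
  moreover have "factor_matrix $ i $ j = 0" if "i \<notin> J" for i j
    using that by (simp add: factor_matrix_def)
  ultimately have LA: "L (A *v y) = factor_matrix *v L y" for y
    by (simp add: L_def vec_eq_iff matrix_vector_mult_def)
  have "A *v x + a l - x1 = A *v (x - x1) + d l"
    by (subst (1) x1[symmetric]) (simp add: matrix_vector_mult_diff_distrib d_def)
  then show ?thesis
    unfolding chart_def by (simp add: linear_add[OF linear_L] LA ifs_map_def b_def)
qed

lemma chart_orth_proj: "chart (orth_proj V x + orth_proj V y) = chart (x + y)"
  by (simp add: chart_def L_def vec_eq_iff inner_diff_right inner_add_right orth_proj(2)[OF subspace_V w_in_V])

lemma integral_factor_cyclic: "integral_factor J m factor_matrix b A a"
  unfolding integral_factor_def
proof
  show "factor_ifs J m factor_matrix b A a"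
    unfolding factor_ifs_def
  proof (intro exI[of _ V] exI[of _ chart] conjI ballI)
    show "V \<noteq> {0}"
    proof
      assume "V = {0}"
      then have "card J = 0" using dim_V by simp
      then show False using J_nonempty by simp
    qed
    show "invertible_affine_map V (coord_space J) chart"
      unfolding invertible_affine_map_def using chart_bij linear_L chart_altdef by blast
    fix l y assume y: "(y :: real^'n) \<in> coord_space J"
    have "chart (inv_into V chart y) = y"
      using y chart_bij by (simp add: bij_betw_def f_inv_into_f)
    then show "ifs_map factor_matrix b l y = chart (orth_proj V (A *v inv_into V chart y) + orth_proj V (a l))"
      by (simp add: chart_orth_proj chart_intertwines)
  qed (use T_in_V in \<open>simp_all add: subspace_V dim_V\<close>)
  have "b l $ i \<in> \<int>" if "l \<in> {1..m}" for l i
    using ints[OF that] by (simp add: b_def L_def w_def)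
  then show "integral_affine_ifs J m factor_matrix b"
    unfolding integral_affine_ifs_def homogeneous_affine_ifs_def
    using J_nonempty m1 inverse_factor spectral_radius_factor companion_Ints L_coord
    by (auto simp: b_def)
qed

section \<open>The factor measure and its Fourier transform\<close>

definition factor_measure :: "(real^'n) measure \<Rightarrow> (real^'n) measure" where
  "factor_measure \<mu> = distr \<mu> (restrict_space borel (coord_space J)) chart"

lemma coord_borel [measurable]: "(coord_space J :: (real^'n) set) \<in> sets borel"
  by (intro borel_closed closed_subspace subspace_coord)

lemma chart_measurable:
  assumes "sets \<mu> = sets borel"
  shows "chart \<in> \<mu> \<rightarrow>\<^sub>M restrict_space borel (coord_space J)"
proof (rule measurable_restrict_space2)
  have "continuous_on UNIV chart"
    unfolding chart_altdef by (intro continuous_intros linear_continuous_on linear_conv_bounded_linear[THEN iffD1] linear_L)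
  then show "chart \<in> borel_measurable \<mu>"
    using assms by (simp add: measurable_cong_sets[OF assms refl] borel_measurable_continuous_onI)
qed (simp add: chart_coord)

lemma factor_measure_self_affine:
  assumes sa: "self_affine_measure UNIV m A a p \<mu>"
  shows "self_affine_measure J m factor_matrix b p (factor_measure \<mu>)"
  unfolding self_affine_measure_def
proof (intro conjI ballI)
  have \<mu>: "prob_space \<mu>" "sets \<mu> = sets borel" "space \<mu> = UNIV"
    using sa sets_eq_imp_space_eq[of \<mu> borel] by (auto simp: self_affine_measure_UNIV)
  note meas = chart_measurable[OF \<mu>(2)]
  show "prob_space (factor_measure \<mu>)"
    unfolding factor_measure_def using \<mu>(1) meas by (intro prob_space.prob_space_distr)
  show s: "sets (factor_measure \<mu>) = sets (restrict_space borel (coord_space J))"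
    by (simp add: factor_measure_def)
  fix X assume "X \<in> sets (factor_measure \<mu>)"
  then have X: "X \<in> sets (restrict_space borel (coord_space J))" using s by simp
  then have Xb: "X \<in> sets borel" by (simp add: sets_restrict_space_iff)
  have M: "measure (factor_measure \<mu>) Y = measure \<mu> (chart -` Y)"
    if "Y \<in> sets (restrict_space borel (coord_space J))" for Y
    unfolding factor_measure_def using measure_distr[OF meas that] by (simp add: \<mu>)
  have "chart -` X \<in> sets borel"
    using measurable_sets[OF meas X] by (simp add: \<mu>)
  then have "measure (factor_measure \<mu>) X = (\<Sum>l=1..m. p l * measure \<mu> (ifs_map A a l -` (chart -` X)))"
    using sa M[OF X] by (simp add: self_affine_measure_UNIV)
  also have "\<dots> = (\<Sum>l=1..m. p l * measure (factor_measure \<mu>) (ifs_map factor_matrix b l -` X \<inter> coord_space J))"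
  proof (rule sum.cong)
    fix l
    have "continuous_on UNIV (ifs_map factor_matrix b l)"
      unfolding ifs_map_def by (intro continuous_intros linear_continuous_on) simp
    then have "ifs_map factor_matrix b l -` X \<in> sets borel"
      using measurable_sets[OF borel_measurable_continuous_onI Xb] by simp
    then have "ifs_map factor_matrix b l -` X \<inter> coord_space J \<in> sets (restrict_space borel (coord_space J))"
      by (simp add: sets_restrict_space_iff)
    moreover have "ifs_map A a l -` (chart -` X) = chart -` (ifs_map factor_matrix b l -` X \<inter> coord_space J)"
      using chart_intertwines[of _ l] by (auto simp: ifs_map_def[of A] chart_coord)
    ultimately show "p l * measure \<mu> (ifs_map A a l -` (chart -` X))
        = p l * measure (factor_measure \<mu>) (ifs_map factor_matrix b l -` X \<inter> coord_space J)"
      by (simp add: M)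
  qed simp
  finally show "measure (factor_measure \<mu>) X
    = (\<Sum>l=1..m. p l * measure (factor_measure \<mu>) (ifs_map factor_matrix b l -` X \<inter> coord_space J))" .
qed

text \<open>The sum on the right is the adjoint of \<open>L\<close> applied to \<open>\<xi>\<close>;
  the translation in the chart contributes only a factor of modulus 1.\<close>

lemma norm_fourier_factor_measure:
  assumes \<mu>: "sets \<mu> = sets borel"
  shows "norm (fourier (factor_measure \<mu>) \<xi>) = norm (fourier \<mu> (\<Sum>i\<in>J. \<xi> $ i *\<^sub>R w i))"
proof -
  let ?u = "\<Sum>i\<in>J. \<xi> $ i *\<^sub>R w i"
  have dot: "\<xi> \<bullet> chart x = - (?u \<bullet> x1) + ?u \<bullet> x" for x
  proof -
    have "\<xi> \<bullet> chart x = (\<Sum>i\<in>J. \<xi> $ i * (w i \<bullet> (x - x1)))"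
      unfolding inner_vec_def chart_def L_def vec_lambda_beta
      by (rule sum.mono_neutral_cong_right) auto
    also have "\<dots> = ?u \<bullet> (x - x1)" by (simp add: inner_sum_left)
    finally show ?thesis by (simp add: inner_diff_right)
  qed
  have "(\<lambda>y. echar (\<xi> \<bullet> y)) \<in> borel_measurable (restrict_space borel (coord_space J))"
    by (intro measurable_restrict_space1 measurable_echar_inner) simp
  then have "fourier (factor_measure \<mu>) \<xi> = (\<integral>x. echar (\<xi> \<bullet> chart x) \<partial>\<mu>)"
    unfolding fourier_echar factor_measure_def by (intro integral_distr chart_measurable \<mu>)
  also have "\<dots> = echar (- (?u \<bullet> x1)) * fourier \<mu> ?u"
    unfolding dot echar_add fourier_echar by simp
  finally show ?thesis by (simp add: norm_mult)
qed

text \<open>Each \<open>B^N v\<close> comes from a frequency in the coordinate space with Fourier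
  modulus at least \<open>\<delta>\<close>. Decay would bound these frequencies and hence the orbit;
  but \<open>v \<bullet> v\<close> is the pairing of \<open>B^N v\<close> with \<open>A^N v\<close>,
  and the latter tends to 0.\<close>

lemma factor_measure_nonrajchman:
  assumes \<mu>: "sets \<mu> = sets borel" and \<delta>: "0 < \<delta>" "\<And>j. \<delta> \<le> norm (fourier \<mu> (orb B v j))"
  shows "\<not> rajchman J (factor_measure \<mu>)"
proof
  assume "rajchman J (factor_measure \<mu>)"
  then have "eventually (\<lambda>\<xi>. dist (fourier (factor_measure \<mu>) \<xi>) 0 < \<delta>) (inf at_infinity (principal (coord_space J)))"
    unfolding rajchman_def using \<delta>(1) by (rule tendstoD)
  then obtain r where r: "\<And>\<xi>. r \<le> norm \<xi> \<Longrightarrow> \<xi> \<in> coord_space J \<Longrightarrow> norm (fourier (factor_measure \<mu>) \<xi>) < \<delta>"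
    by (auto simp: eventually_inf_principal eventually_at_infinity)
  define c where "c = \<bar>r\<bar> * (\<Sum>i\<in>J. norm (w i))"
  have bound: "norm (orb B v N) \<le> c" for N
  proof -
    obtain u where u: "orb B v N = (\<Sum>i\<in>J. u i *\<^sub>R w i)" using V_coords[OF orb_in_V] .
    define \<xi> :: "real^'n" where "\<xi> = (\<chi> i. if i \<in> J then u i else 0)"
    have \<xi>: "orb B v N = (\<Sum>i\<in>J. \<xi> $ i *\<^sub>R w i)" "\<xi> \<in> coord_space J"
      unfolding u by (auto simp: \<xi>_def coord_space_def intro!: sum.cong)
    have "\<not> r \<le> norm \<xi>"
      using r[OF _ \<xi>(2)] \<delta>(2)[of N] norm_fourier_factor_measure[OF \<mu>, of \<xi>] \<xi>(1) by auto
    then have "\<bar>\<xi> $ i\<bar> \<le> \<bar>r\<bar>" for i using component_le_norm_cart[of \<xi> i] by linarith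
    then have "(\<Sum>i\<in>J. \<bar>\<xi> $ i\<bar> * norm (w i)) \<le> (\<Sum>i\<in>J. \<bar>r\<bar> * norm (w i))"
      by (intro sum_mono mult_right_mono) auto
    moreover have "norm (orb B v N) \<le> (\<Sum>i\<in>J. \<bar>\<xi> $ i\<bar> * norm (w i))"
      unfolding \<xi>(1) by (rule order.trans[OF norm_sum]) simp
    ultimately show ?thesis by (simp add: c_def sum_distrib_left)
  qed
  have "v \<bullet> v = 0"
  proof -
    have "\<bar>v \<bullet> v\<bar> \<le> c * norm (orb A v N)" for N
    proof -
      have "v \<bullet> v = orb B v N \<bullet> orb A v N"
        using orb_inverse[OF TB, of v N 0] inner_orb_transpose[of A "orb B v N" N v] by simp
      also have "\<bar>\<dots>\<bar> \<le> norm (orb B v N) * norm (orb A v N)" by (rule Cauchy_Schwarz_ineq2)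
      also have "\<dots> \<le> c * norm (orb A v N)" by (intro mult_right_mono bound) simp
      finally show ?thesis .
    qed
    moreover have "(\<lambda>N. c * norm (orb A v N)) \<longlonglongrightarrow> c * norm (0 :: real^'n)"
      by (intro tendsto_intros orb_A_tendsto)
    ultimately have "\<bar>v \<bullet> v\<bar> \<le> c * norm (0 :: real^'n)"
      by (intro LIMSEQ_le_const) auto
    then have "v \<bullet> v \<le> 0" by simp
    then show ?thesis using inner_ge_zero[of v] by linarith
  qed
  moreover have "v \<noteq> 0"
  proof
    assume "v = 0"
    then have "(\<Sum>i<degree q. (1::real) *\<^sub>R orb B v i) = 0" by simp
    from indep[OF this deg] show False by simp
  qed
  ultimately show False by simp
qed

end

theorem theorem1p12:
  fixes A :: "real^'n::finite^'n"
    and a :: "nat \<Rightarrow> real^'n"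
    and m :: nat
    and p :: "nat \<Rightarrow> real"
    and \<mu> :: "(real^'n) measure"
  assumes "homogeneous_affine_ifs UNIV m A a"
    and "affinely_irreducible m A a"
    and "probability_vector m p"
    and "\<forall>l\<in>{1..m}. 0 < p l"
    and "self_affine_measure UNIV m A a p \<mu>"
    and "\<not> rajchman UNIV \<mu>"
  shows "generalized_pisot_ifs m A a \<and>
    (generalized_pisot_ifs_type_I m A a \<or>
     (\<exists>J B b \<nu>. integral_factor J m B b A a \<and>
        self_affine_measure J m B b p \<nu> \<and> \<not> rajchman J \<nu>))"
proof -
  interpret irreducible_ifs A a m by standard fact+
  obtain v K q \<delta> where v: "v \<noteq> 0" and \<delta>: "0 < \<delta>" "\<And>j. \<delta> \<le> norm (fourier \<mu> (orb B v j))"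
    and ap: "approximates (cvec_of_real v) K" and q: "minimal_annihilator q K"
    and q0: "coeff q 0 \<noteq> 0" and deg: "0 < degree q"
    using minimal_data[OF assms(5,3) _ assms(6)] assms(4) by metis
  have lq: "lead_coeff q = 1" and an: "annihilates q K"
    using q by (auto simp: minimal_annihilator_def)
  note pisot = generalized_pisot_of_root[OF ap q q0]
  have "degree (map_poly complex_of_int q) = degree q" by (simp add: degree_map_poly)
  then obtain z0 where "ipoly_at q z0 = 0"
    using alg_closed_imp_poly_has_root[of "map_poly complex_of_int q"] deg
    unfolding ipoly_at_def by auto
  then have gp: "generalized_pisot_ifs m A a" by (rule pisot(1))
  show ?thesis
  proof (cases "\<exists>z. ipoly_at q z = 0 \<and> norm z < 1")
    case True
    then show ?thesis using gp pisot(2) by blast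
  next
    case False
    then have roots1: "\<And>z. ipoly_at q z = 0 \<Longrightarrow> 1 \<le> norm z" by (auto simp: not_less)
    \<comment> \<open>After complexification a relation is an annihilating polynomial of degree
      below \<open>degree q\<close>.\<close>
    have indep: "c i = 0" if s: "(\<Sum>i<degree q. c i *\<^sub>R orb B v i) = 0" and i: "i < degree q"
      for c :: "nat \<Rightarrow> real" and i
    proof (rule ccontr)
      assume "c i \<noteq> 0"
      obtain g where g: "degree g \<le> degree q - 1"
        "\<And>i. i \<le> degree q - 1 \<Longrightarrow> coeff g i = complex_of_real (c i)"
        "\<And>u j. shift_act g u j = (\<Sum>i\<le>degree q - 1. of_real (c i) * u (i + j))"
        using poly_of_coeffs[where n = "degree q - 1" and q = "\<lambda>i. complex_of_real (c i)"] by blast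
      have "{..degree q - 1} = {..<degree q}" using deg by auto
      then have "poly_orb g Bc (cvec_of_real v) = cvec_of_real (\<Sum>i<degree q. c i *\<^sub>R orb B v i)"
        by (simp add: poly_orb_def vec_eq_iff g(3) flip: cvec_of_real_orb)
      then have "poly_orb g Bc (cvec_of_real v) = 0" using s by simp
      moreover have "i \<le> degree q - 1" using i by linarith
      then have "g \<noteq> 0" using g(2)[of i] \<open>c i \<noteq> 0\<close> by auto
      ultimately have "degree q \<le> degree g"
        using degree_annihilator_ge[OF ap q q0 roots1] by blast
      then show False using g(1) deg by simp
    qed
    \<comment> \<open>This bounds \<open>degree q\<close> by \<open>CARD('n)\<close>, so that an
      index set \<open>J\<close> of that size exists.\<close>
    have ind: "inj_on (orb B v) {..<degree q} \<and> independent (orb B v ` {..<degree q})"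
    proof
      show inj: "inj_on (orb B v) {..<degree q}"
      proof
        fix i j assume ij: "i \<in> {..<degree q}" "j \<in> {..<degree q}" "orb B v i = orb B v j"
        have "(\<Sum>k<degree q. ((if k = i then 1 else 0) - (if k = j then 1 else 0)) *\<^sub>R orb B v k) = 0"
          using ij by (simp add: scaleR_diff_left sum_subtractf
              if_distrib[where f = "\<lambda>c. c *\<^sub>R _"] cong: if_cong)
        from indep[OF this, of i] ij show "i = j" by (simp split: if_splits)
      qed
      show "independent (orb B v ` {..<degree q})"
      proof (rule independent_if_scalars_zero)
        fix f y assume "(\<Sum>y\<in>orb B v ` {..<degree q}. f y *\<^sub>R y) = 0" and y: "y \<in> orb B v ` {..<degree q}"
        then have "(\<Sum>i<degree q. f (orb B v i) *\<^sub>R orb B v i) = 0" by (simp add: sum.reindex[OF inj])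
        from indep[OF this] y show "f y = 0" by auto
      qed simp
    qed
    then have "degree q \<le> DIM(real^'n)"
      using independent_card_le[of "orb B v ` {..<degree q}"] by (simp add: card_image)
    then have "degree q \<le> card (UNIV :: 'n set)" by simp
    then obtain J :: "'n set" where J: "card J = degree q"
      by (metis obtain_subset_with_card_n)
    then have "\<exists>e. bij_betw e J {..<degree q}" by (intro finite_same_card_bij) auto
    then obtain e where e: "bij_betw e J {..<degree q}" by blast
    interpret lattice_direction A a m v q J e
    proof
      have "cvec_of_real (poly_orb (map_poly of_int q) B v) = poly_orb (map_poly of_int q) Bc (cvec_of_real v)"
        by (simp add: poly_orb_def vec_eq_iff shift_act_def degree_map_poly coeff_map_poly
            flip: cvec_of_real_orb)
      then show "poly_orb (map_poly of_int q) B v = 0"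
        using poly_orb_eq_0[OF ap an] by simp
      show "1 < norm z" if "ipoly_at q z = 0" for z
        using large_root(1)[OF ap q q0 that roots1[OF that]] .
      show "orb B v j \<bullet> d l \<in> \<int>" if "l \<in> {1..m}" for l j
      proof -
        have "complex_of_real (orb B v j \<bullet> d l) = of_int (K l j)"
          using exact_approximation[OF ap an lq roots1 that, of j]
          by (simp add: rpair_cvec_of_real flip: cvec_of_real_orb)
        then have "orb B v j \<bullet> d l = of_int (K l j)"
          by (metis of_real_eq_iff of_real_of_int_eq)
        then show ?thesis by simp
      qed
    qed (fact lq deg e | use indep in blast)+
    have "sets \<mu> = sets borel" using assms(5) by (simp add: self_affine_measure_UNIV)
    from factor_measure_nonrajchman[OF this \<delta>] show ?thesis
      using gp integral_factor_cyclic factor_measure_self_affine[OF assms(5)] by blast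
  qed
qed

end
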